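(* Let $n\ge1$ and let $\rho_n(\infty)$ be the probability that a random real $n$-ary quadratic form chosen according to the $n$-dimensional Gaussian Orthogonal Ensemble is isotropic over $\mathbb{R}$. Then $\rho_n(\infty)$ is a polynomial in $\pi^{-1}$ having coefficients in $\mathbb{Q}(\sqrt2)$ and degree at most $\lfloor (n+1)/4\rfloor$; i.e., there is a polynomial $P\in\mathbb{Q}(\sqrt2)[T]$ of degree at most $\lfloor (n+1)/4\rfloor$ with $\rho_n(\infty)=P(\pi^{-1})$.
   Context: The $n$-dimensional Gaussian Orthogonal Ensemble (GOE) is the distribution of the random real symmetric $n\times n$ matrix $M=\frac1{\sqrt2}(B+B^t)$, where the entries of the $n\times n$ matrix $B$ are i.i.d. (standard, mean zero) Gaussians. A symmetric matrix $M$ is identified with the real quadratic form $x\mapsto x^tMx$. A real quadratic form is isotropic over $\mathbb{R}$ if it has a nonzero real zero (up to a set of probability zero, this means it is indefinite). *)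

theory Defs
  imports "HOL-Probability.Probability" "Jordan_Normal_Form.Matrix"
begin

abbreviation std_normal_measure :: "real measure" where
  "std_normal_measure \<equiv> density lborel (\<lambda>x. ennreal (std_normal_density x))"

definition gaussian_entries :: "nat \<Rightarrow> (nat \<times> nat \<Rightarrow> real) measure" where
  "gaussian_entries n = PiM ({..<n} \<times> {..<n}) (\<lambda>_. std_normal_measure)"

text \<open>The Borel structure on real n by n matrices: the sigma-algebra generated by the entries.\<close>

definition mat_borel :: "nat \<Rightarrow> real mat measure" where
  "mat_borel n = vimage_algebra (carrier_mat n n) (\<lambda>A. \<lambda>ij\<in>{..<n} \<times> {..<n}. A $$ ij)
     (PiM ({..<n} \<times> {..<n}) (\<lambda>_. borel))"

definition GOE :: "nat \<Rightarrow> real mat measure" where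
  "GOE n = distr (gaussian_entries n) (mat_borel n)
     (\<lambda>b. let B = mat n n b in (1 / sqrt 2) \<cdot>\<^sub>m (B + transpose_mat B))"

definition quad_form :: "'a::comm_ring_1 mat \<Rightarrow> 'a vec \<Rightarrow> 'a" where
  "quad_form A x = scalar_prod x (A *\<^sub>v x)"

definition isotropic :: "'a::comm_ring_1 mat \<Rightarrow> bool" where
  "isotropic A \<longleftrightarrow> (\<exists>x \<in> carrier_vec (dim_row A). x \<noteq> 0\<^sub>v (dim_row A) \<and> quad_form A x = 0)"

definition rho_inf :: "nat \<Rightarrow> real" where
  "rho_inf n = measure (GOE n) {M \<in> space (GOE n). isotropic M}"

definition is_subfield :: "'a::field set \<Rightarrow> bool" where
  "is_subfield K \<longleftrightarrow> 0 \<in> K \<and> 1 \<in> K \<and>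
     (\<forall>x\<in>K. \<forall>y\<in>K. x + y \<in> K \<and> x * y \<in> K) \<and> (\<forall>x\<in>K. - x \<in> K \<and> inverse x \<in> K)"

definition Rats_adjoin :: "'a::field_char_0 \<Rightarrow> 'a set" where
  "Rats_adjoin a = \<Inter>{K. is_subfield K \<and> \<rat> \<subseteq> K \<and> a \<in> K}"

lemma space_mat_borel [simp]: "space (mat_borel n) = carrier_mat n n"
  by (simp add: mat_borel_def)

lemma prob_space_gaussian_entries: "prob_space (gaussian_entries n)"
  unfolding gaussian_entries_def
  by (intro prob_space_PiM prob_space_normal_density) simp

lemma measurable_GOE_map:
  "(\<lambda>b. let B = mat n n b in (1 / sqrt 2) \<cdot>\<^sub>m (B + transpose_mat B))
     \<in> gaussian_entries n \<rightarrow>\<^sub>M mat_borel n"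
  unfolding mat_borel_def
proof (rule measurable_vimage_algebra2)
  show "(\<lambda>b. let B = mat n n b in (1 / sqrt 2) \<cdot>\<^sub>m (B + transpose_mat B))
    \<in> space (gaussian_entries n) \<rightarrow> carrier_mat n n"
    by (auto simp: Let_def)
  have sets: "sets (gaussian_entries n) = sets (PiM ({..<n} \<times> {..<n}) (\<lambda>_. borel :: real measure))"
    unfolding gaussian_entries_def by (intro sets_PiM_cong) auto
  have "(\<lambda>b. \<lambda>ij\<in>{..<n} \<times> {..<n}. (1 / sqrt 2) * (b ij + b (snd ij, fst ij)))
     \<in> PiM ({..<n} \<times> {..<n}) (\<lambda>_. borel :: real measure)
        \<rightarrow>\<^sub>M PiM ({..<n} \<times> {..<n}) (\<lambda>_. borel)"
    by (intro measurable_restrict borel_measurable_times borel_measurable_add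
        measurable_const measurable_component_singleton) auto
  also have "(\<lambda>b. \<lambda>ij\<in>{..<n} \<times> {..<n}. (1 / sqrt 2) * (b ij + b (snd ij, fst ij))) =
     (\<lambda>b. \<lambda>ij\<in>{..<n} \<times> {..<n}.
        (let B = mat n n b in (1 / sqrt 2) \<cdot>\<^sub>m (B + transpose_mat B)) $$ ij)"
    by (intro ext) (auto simp: restrict_def Let_def)
  finally show "(\<lambda>b. \<lambda>ij\<in>{..<n} \<times> {..<n}.
        (let B = mat n n b in (1 / sqrt 2) \<cdot>\<^sub>m (B + transpose_mat B)) $$ ij)
     \<in> gaussian_entries n \<rightarrow>\<^sub>M PiM ({..<n} \<times> {..<n}) (\<lambda>_. borel)"
    using measurable_cong_sets[OF sets refl] by blast
qed

lemma prob_space_GOE: "prob_space (GOE n)"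
  unfolding GOE_def
  by (intro prob_space.prob_space_distr prob_space_gaussian_entries measurable_GOE_map)

lemma Rats_adjoin_sqrt2:
  "Rats_adjoin (sqrt 2) = {a + b * sqrt 2 | a b. a \<in> \<rat> \<and> b \<in> \<rat>}" (is "_ = ?R")
proof
  have sub: "a + b * sqrt 2 \<in> ?R" if "a \<in> \<rat>" "b \<in> \<rat>" for a b
    using that by blast
  have mult: "x * y \<in> ?R" if xy: "x \<in> ?R" "y \<in> ?R" for x y
  proof -
    obtain a b c d where *: "x = a + b * sqrt 2" "y = c + d * sqrt 2"
      "a \<in> \<rat>" "b \<in> \<rat>" "c \<in> \<rat>" "d \<in> \<rat>" using xy by blast
    have "x * y = (a * c + 2 * b * d) + (a * d + b * c) * sqrt 2"
      unfolding * by (simp add: algebra_simps)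
    also have "\<dots> \<in> ?R" by (rule sub) (auto intro!: Rats_add Rats_mult * Rats_number_of)
    finally show ?thesis .
  qed
  have add: "x + y \<in> ?R" if xy: "x \<in> ?R" "y \<in> ?R" for x y
  proof -
    obtain a b c d where *: "x = a + b * sqrt 2" "y = c + d * sqrt 2"
      "a \<in> \<rat>" "b \<in> \<rat>" "c \<in> \<rat>" "d \<in> \<rat>" using xy by blast
    have "x + y = (a + c) + (b + d) * sqrt 2"
      unfolding * by (simp add: algebra_simps)
    also have "\<dots> \<in> ?R" by (rule sub) (auto intro!: Rats_add *)
    finally show ?thesis .
  qed
  have uminus: "- x \<in> ?R" if xy: "x \<in> ?R" for x
  proof -
    obtain a b where *: "x = a + b * sqrt 2" "a \<in> \<rat>" "b \<in> \<rat>" using xy by blast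
    have "- x = (- a) + (- b) * sqrt 2" unfolding * by simp
    also have "\<dots> \<in> ?R" by (rule sub) (use * in auto)
    finally show ?thesis .
  qed
  have inv: "inverse x \<in> ?R" if xy: "x \<in> ?R" for x
  proof -
    obtain a b where *: "x = a + b * sqrt 2" "a \<in> \<rat>" "b \<in> \<rat>" using xy by blast
    define N where "N = a\<^sup>2 - 2 * b\<^sup>2"
    have prod: "x * (a - b * sqrt 2) = N"
      unfolding * N_def by (simp add: algebra_simps power2_eq_square)
    have N_rat: "N \<in> \<rat>" unfolding N_def
      by (intro Rats_diff Rats_mult Rats_power *) simp
    show ?thesis
    proof (cases "sqrt 2 \<in> \<rat>")
      case True
      then have "inverse x \<in> \<rat>"
        unfolding * by (intro Rats_inverse Rats_add Rats_mult *)
      then show ?thesis using sub[of "inverse x" 0] by simp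
    next
      case irr: False
      show ?thesis
      proof (cases "x = 0")
        case True then show ?thesis using sub[of 0 0] by simp
      next
        case False
        have "a - b * sqrt 2 \<noteq> 0"
        proof
          assume eq: "a - b * sqrt 2 = 0"
          have "b = 0"
          proof (rule ccontr)
            assume "b \<noteq> 0"
            with eq have "sqrt 2 = a / b" by (simp add: field_simps)
            with * irr show False by (metis Rats_divide)
          qed
          with eq False * show False by simp
        qed
        with False prod have N0: "N \<noteq> 0" by (metis mult_eq_0_iff)
        have "inverse x = (a - b * sqrt 2) / N"
          using False N0 prod by (simp add: field_simps)
        also have "\<dots> = a / N + (- b / N) * sqrt 2" by (simp add: diff_divide_distrib)
        also have "\<dots> \<in> ?R" by (rule sub) (auto intro!: Rats_divide Rats_minus_iff[THEN iffD2] * N_rat)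
        finally show ?thesis .
      qed
    qed
  qed
  have "is_subfield ?R"
    unfolding is_subfield_def
    using sub[of 0 0] sub[of 1 0] add mult uminus inv by simp
  moreover have "\<rat> \<subseteq> ?R" using sub[of _ 0] by auto
  moreover have "sqrt 2 \<in> ?R" using sub[of 0 1] by simp
  ultimately show "Rats_adjoin (sqrt 2) \<subseteq> ?R" unfolding Rats_adjoin_def by blast
  show "?R \<subseteq> Rats_adjoin (sqrt 2)"
    unfolding Rats_adjoin_def is_subfield_def by blast
qed

end

(*
  Up to a positive factor, the GOE matrix is M = (B + B^t)/2.  Gaussian integration by parts in the
  entries of B gives loop equations for the mixed moments of the traces tr M^k, damped by exp(-t tr M^2).
  Integration by parts in independent standard normals x_1, ..., x_n weighted by
  prod_{i<j} |x_i - x_j| gives the same equations for the power sums of x.  The equations determine the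
  moments, so the traces have the same joint moments in both models, and after damping the spectrum
  into [-1,1] polynomial approximation shows that P(M > 0) is a quotient of two integrals of
  prod_{i<j} |x_i - x_j|, over the positive orthant and over the whole space.  No change of variables to
  eigenvalues is needed.

  M is isotropic unless it is definite.  Writing |z| = z sgn z, expanding prod_{i<j} (x_j - x_i) into
  monomials and expanding prod_{i<j} sgn (x_j - x_i) along one index as a Pfaffian reduces the integrals
  to products of one- and two-dimensional ones.  These lie in Q(sqrt 2) up to powers of sqrt pi; a parity
  grading keeps track of the powers and yields the degree bound.
*)

theory Submission
  imports Defs "Jordan_Normal_Form.Schur_Decomposition"
begin

text \<open>The loop equations of the two models agree although their terms arise differently. The
  term in tr M^(k-1) has its factor 1/2 on the matrix side because only the symmetric part of B
  enters, and on the eigenvalue side because the weight takes back half of what differentiating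
  x_i^k produced. Moments do not directly give the probability of a sign condition, which is
  discontinuous on an unbounded spectrum. Hence every eigenvalue is multiplied by exp(- tr M^2). A
  monomial of degree d in the damped power sums is the undamped one times exp(- d tr M^2), and the
  loop equation for tr M^2 is a differential equation in t that evaluates this factor. In the
  arithmetic, a mere quotient of polynomials in pi would not do. Powers of sqrt pi below the top one
  come from boundary terms at the origin. The whole space has none, so the denominator is an element
  of Q(sqrt 2) times the single power with exponent (n+1) div 2. The numerators contain lower
  powers, but only of the same parity; dividing leaves a polynomial in 1/pi of half that
  degree.\<close>

section \<open>Gaussian integration by parts\<close>

abbreviation std_phi :: "real \<Rightarrow> real" ("\<phi>") where "\<phi> \<equiv> std_normal_density"

abbreviation stdN :: "real measure" where "stdN \<equiv> std_normal_measure"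

lemma prob_space_stdN: "prob_space stdN"
  by (intro prob_space_normal_density) simp

lemma integral_stdN:
  fixes f :: "real \<Rightarrow> real"
  assumes "f \<in> borel_measurable borel"
  shows "(\<integral>x. f x \<partial>stdN) = (\<integral>x. \<phi> x * f x \<partial>lborel)"
  using assms by (subst integral_density) auto

lemma integrable_stdN:
  fixes f :: "real \<Rightarrow> real"
  assumes "f \<in> borel_measurable borel"
  shows "integrable stdN f \<longleftrightarrow> integrable lborel (\<lambda>x. \<phi> x * f x)"
  using assms by (subst integrable_density) auto

lemma std_normal_mult_exp:
  "\<phi> x * exp (m * x) = exp (m\<^sup>2 / 2) * normal_density m 1 x"
proof -
  have "\<phi> x * exp (m * x) = (1 / sqrt (2 * pi)) * exp (- x\<^sup>2 / 2 + m * x)"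
    unfolding std_normal_density_def exp_add by simp
  also have "- x\<^sup>2 / 2 + m * x = m\<^sup>2 / 2 + (- (x - m)\<^sup>2 / 2)"
    by (simp add: power2_eq_square field_simps)
  finally show ?thesis by (simp add: normal_density_def exp_add[symmetric])
qed

lemma integrable_std_normal_exp_abs:
  "integrable lborel (\<lambda>x. \<phi> x * exp (m * \<bar>x\<bar>))"
proof (rule Bochner_Integration.integrable_bound)
  have "integrable lborel (\<lambda>x. \<phi> x * exp (a * x))" for a
    unfolding std_normal_mult_exp by (intro integrable_mult_right integrable_normal_density) simp
  from Bochner_Integration.integrable_add[OF this[of m] this[of "- m"]]
  show "integrable lborel (\<lambda>x. \<phi> x * exp (m * x) + \<phi> x * exp (- m * x))" .
  show "AE x in lborel. norm (\<phi> x * exp (m * \<bar>x\<bar>))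
      \<le> norm (\<phi> x * exp (m * x) + \<phi> x * exp (- m * x))"
  proof (rule AE_I2)
    fix x
    have "\<phi> x * exp (m * x) \<ge> 0" "\<phi> x * exp (- m * x) \<ge> 0"
      by simp_all
    then show "norm (\<phi> x * exp (m * \<bar>x\<bar>))
      \<le> norm (\<phi> x * exp (m * x) + \<phi> x * exp (- m * x))"
      by (cases "x \<ge> 0") auto
  qed
qed measurable

lemma integrable_stdN_exp_abs: "integrable stdN (\<lambda>x. exp (m * \<bar>x\<bar>))"
  by (subst integrable_stdN) (auto simp: integrable_std_normal_exp_abs)

lemma DERIV_std_normal_density:
  "(\<phi> has_real_derivative - x * \<phi> x) (at x)"
  unfolding std_normal_density_def
  by (rule derivative_eq_intros refl | simp)+

text \<open>The finite exceptional set accommodates the kinks of \<open>\<bar>x i - x j\<bar>\<close>.\<close>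

lemma stdN_ibp:
  fixes f f' :: "real \<Rightarrow> real"
  assumes fin: "finite T" and der: "\<And>x. x \<notin> T \<Longrightarrow> (f has_real_derivative f' x) (at x)"
    and cont: "continuous_on UNIV f"
    and bf: "\<And>x. \<bar>f x\<bar> \<le> C * exp (m * \<bar>x\<bar>)" and bf': "\<And>x. \<bar>f' x\<bar> \<le> C * exp (m * \<bar>x\<bar>)"
    and meas: "f' \<in> borel_measurable borel"
  shows "(\<integral>x. x * f x \<partial>stdN) = (\<integral>x. f' x \<partial>stdN)"
proof -
  define g where "g x = f x * \<phi> x" for x
  define g' where "g' x = f' x * \<phi> x - x * f x * \<phi> x" for x
  have measf: "f \<in> borel_measurable borel"
    using cont by (rule borel_measurable_continuous_onI)
  have C0: "C \<ge> 0" using bf[of 0] by simp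
  have bxf: "\<bar>x * f x\<bar> \<le> C * exp ((m + 1) * \<bar>x\<bar>)" for x
  proof -
    have "\<bar>x * f x\<bar> \<le> exp \<bar>x\<bar> * (C * exp (m * \<bar>x\<bar>))"
      unfolding abs_mult using bf[of x] order_trans[OF _ exp_ge_add_one_self[of "\<bar>x\<bar>"], of "\<bar>x\<bar>"]
      by (intro mult_mono) auto
    then show ?thesis by (simp add: exp_add algebra_simps)
  qed
  have int: "integrable lborel (\<lambda>x. \<phi> x * h x)"
    if h: "h \<in> borel_measurable borel" "\<And>x. \<bar>h x\<bar> \<le> C * exp (k * \<bar>x\<bar>)" for h k
  proof (rule Bochner_Integration.integrable_bound)
    show "integrable lborel (\<lambda>x. C * (\<phi> x * exp (k * \<bar>x\<bar>)))"
      by (intro integrable_mult_right integrable_std_normal_exp_abs)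
    show "AE x in lborel. norm (\<phi> x * h x)
        \<le> norm (C * (\<phi> x * exp (k * \<bar>x\<bar>)))"
      using mult_left_mono[OF h(2), of "\<phi> _"] C0
      by (intro AE_I2) (simp add: abs_mult mult_ac)
  qed (use h(1) in measurable)
  have i1: "integrable lborel (\<lambda>x. \<phi> x * f' x)" by (rule int[OF meas bf'])
  have i2: "integrable lborel (\<lambda>x. \<phi> x * (x * f x))"
    by (rule int[OF _ bxf]) (use measf in measurable)
  have ig': "integrable lborel g'"
    using Bochner_Integration.integrable_diff[OF i1 i2] by (simp add: g'_def[abs_def] mult_ac)
  have gder: "(g has_real_derivative g' x) (at x)" if "x \<notin> T" for x
    unfolding g_def g'_def
    by (rule derivative_eq_intros der[OF that] DERIV_std_normal_density refl)+ (simp add: algebra_simps)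
  have contg: "continuous_on A g" for A
    unfolding g_def std_normal_density_def
    by (intro continuous_intros continuous_on_subset[OF cont]) auto
  \<comment> \<open>Integrate over a growing interval: by dominated convergence the left side tends
    to the integral of \<open>g'\<close>, while the boundary values vanish because the Gaussian
    density beats every exponential.\<close>
  have FTC: "(LINT x|lborel. indicator {- real k..real k} x *\<^sub>R g' x) = g (real k) - g (- real k)" for k :: nat
  proof -
    have "(g' has_integral (g (real k) - g (- real k))) {- real k..real k}"
      by (rule fundamental_theorem_of_calculus_interior_strong[OF fin])
        (use gder contg in \<open>auto simp: has_real_derivative_iff_has_vector_derivative\<close>)
    moreover have "set_integrable lborel {- real k..real k} g'"
      unfolding set_integrable_def using ig' by (intro integrable_mult_indicator) auto
    ultimately show ?thesis
      using set_borel_integral_eq_integral(2) by (fastforce simp: set_lebesgue_integral_def)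
  qed
  have lim1: "(\<lambda>k. LINT x|lborel. indicator {- real k..real k} x *\<^sub>R g' x) \<longlonglongrightarrow> (LINT x|lborel. g' x)"
  proof (rule integral_dominated_convergence[where w = "\<lambda>x. \<bar>g' x\<bar>"])
    show "AE x in lborel. (\<lambda>k. indicator {- real k..real k} x *\<^sub>R g' x) \<longlonglongrightarrow> g' x"
    proof (rule AE_I2, rule tendsto_eventually)
      fix x :: real
      show "\<forall>\<^sub>F k in sequentially. indicator {- real k..real k} x *\<^sub>R g' x = g' x"
        by (rule eventually_sequentiallyI[of "nat \<lceil>\<bar>x\<bar>\<rceil>"])
           (auto simp: indicator_def abs_le_iff nat_le_iff ceiling_le_iff)
    qed
  qed (use ig' in \<open>auto simp: indicator_def\<close>)
  have gbound: "\<bar>g x\<bar> \<le> C * exp (m * \<bar>x\<bar>) * \<phi> x" for x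
    unfolding g_def abs_mult using bf[of x] by (intro mult_mono) auto
  have "(\<lambda>k. C * exp (m * real k) * \<phi> (real k)) \<longlonglongrightarrow> 0"
    unfolding std_normal_density_def
  proof -
    have "((\<lambda>x. exp (m * x - x\<^sup>2 / 2)) \<longlongrightarrow> 0) at_top"
      by real_asymp
    from tendsto_mult_right_zero[OF this, of "C / sqrt (2 * pi)"]
    have "((\<lambda>x. C / sqrt (2 * pi) * exp (m * x - x\<^sup>2 / 2)) \<longlongrightarrow> 0) at_top" .
    moreover have "C / sqrt (2 * pi) * exp (m * x - x\<^sup>2 / 2) =
        C * exp (m * x) * (1 / sqrt (2 * pi) * exp (- x\<^sup>2 / 2))" for x
      by (simp add: diff_conv_add_uminus exp_add del: add_uminus_conv_diff)
    ultimately have "((\<lambda>x. C * exp (m * x) * (1 / sqrt (2 * pi) * exp (- x\<^sup>2 / 2))) \<longlongrightarrow> 0) at_top"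
      by (simp only:)
    then show "(\<lambda>k. C * exp (m * real k) * (1 / sqrt (2 * pi) * exp (- (real k)\<^sup>2 / 2))) \<longlonglongrightarrow> 0"
      by (rule filterlim_compose[OF _ filterlim_real_sequentially])
  qed
  note lim0 = this
  have gl1: "(\<lambda>k. g (real k)) \<longlonglongrightarrow> 0"
    by (rule Lim_null_comparison[OF always_eventually lim0])
      (use gbound[of "real _"] in auto)
  have gl2: "(\<lambda>k. g (- real k)) \<longlonglongrightarrow> 0"
    by (rule Lim_null_comparison[OF always_eventually lim0])
      (use gbound[of "- real _"] in \<open>auto simp: std_normal_density_def\<close>)
  have "(LINT x|lborel. g' x) = 0"
    using LIMSEQ_unique[OF lim1[unfolded FTC] tendsto_diff[OF gl1 gl2]] by simp
  moreover have "(LINT x|lborel. g' x) =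
      (LINT x|lborel. \<phi> x * f' x) - (LINT x|lborel. \<phi> x * (x * f x))"
    using Bochner_Integration.integral_diff[OF i1 i2] by (simp add: g'_def[abs_def] mult_ac)
  ultimately show ?thesis
    using meas measf by (simp add: integral_stdN)
qed

section \<open>Products of standard normals\<close>

abbreviation gaussN :: "'i set \<Rightarrow> ('i \<Rightarrow> real) measure" where
  "gaussN I \<equiv> PiM I (\<lambda>_. stdN)"

abbreviation borelN :: "'i set \<Rightarrow> ('i \<Rightarrow> real) measure" where
  "borelN I \<equiv> PiM I (\<lambda>_. borel)"

lemma sets_gaussN: "sets (gaussN I) = sets (borelN I)"
  by (intro sets_PiM_cong) auto

lemma borel_measurable_gaussN: "borel_measurable (gaussN I) = borel_measurable (borelN I)"
  by (intro measurable_cong_sets sets_gaussN) auto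

lemma prob_space_gaussN: "prob_space (gaussN I)"
  by (intro prob_space_PiM prob_space_stdN)

interpretation G: product_prob_space "\<lambda>_::'i. stdN" UNIV
  by (intro product_prob_spaceI prob_space_stdN)

section \<open>Functions of at most exponential growth\<close>

definition exp_bdd :: "'i set \<Rightarrow> (('i \<Rightarrow> real) \<Rightarrow> real) \<Rightarrow> bool" where
  "exp_bdd I f \<longleftrightarrow> (\<exists>C m. 0 \<le> C \<and> 0 \<le> m \<and> (\<forall>x. \<bar>f x\<bar> \<le> C * exp (m * (\<Sum>i\<in>I. \<bar>x i\<bar>))))"

lemma exp_bddI: "0 \<le> C \<Longrightarrow> 0 \<le> m \<Longrightarrow> (\<And>x. \<bar>f x\<bar> \<le> C * exp (m * (\<Sum>i\<in>I. \<bar>x i\<bar>))) \<Longrightarrow> exp_bdd I f"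
  unfolding exp_bdd_def by blast

lemma exp_bdd_bounded: "(\<And>x. \<bar>f x\<bar> \<le> c) \<Longrightarrow> exp_bdd I f"
  by (rule exp_bddI[of "\<bar>c\<bar>" 0]) (auto intro: order_trans[OF _ abs_ge_self])

lemma exp_bdd_const: "exp_bdd I (\<lambda>_. c)"
  by (rule exp_bdd_bounded[of _ "\<bar>c\<bar>"]) simp

lemma exp_bdd_mono: "exp_bdd I g \<Longrightarrow> (\<And>x. \<bar>f x\<bar> \<le> \<bar>g x\<bar>) \<Longrightarrow> exp_bdd I f"
  unfolding exp_bdd_def by (meson order_trans)

lemma exp_bdd_proj:
  assumes "finite I" "i \<in> I" shows "exp_bdd I (\<lambda>x. x i)"
proof (rule exp_bddI[of 1 1])
  fix x :: "'a \<Rightarrow> real"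
  have "\<bar>x i\<bar> \<le> (\<Sum>i\<in>I. \<bar>x i\<bar>)" using assms by (intro member_le_sum) auto
  also have "\<dots> \<le> exp (\<Sum>i\<in>I. \<bar>x i\<bar>)" using exp_ge_add_one_self[of "\<Sum>i\<in>I. \<bar>x i\<bar>"] by linarith
  finally show "\<bar>x i\<bar> \<le> 1 * exp (1 * (\<Sum>i\<in>I. \<bar>x i\<bar>))" by simp
qed auto

lemma exp_bdd_add:
  assumes "exp_bdd I f" "exp_bdd I g" shows "exp_bdd I (\<lambda>x. f x + g x)"
proof -
  obtain C m D k where *: "0 \<le> C" "0 \<le> m" "\<And>x. \<bar>f x\<bar> \<le> C * exp (m * (\<Sum>i\<in>I. \<bar>x i\<bar>))"
    "0 \<le> D" "0 \<le> k" "\<And>x. \<bar>g x\<bar> \<le> D * exp (k * (\<Sum>i\<in>I. \<bar>x i\<bar>))"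
    using assms unfolding exp_bdd_def by blast
  show ?thesis
  proof (rule exp_bddI[of "C + D" "m + k"])
    fix x :: "'a \<Rightarrow> real"
    let ?s = "\<Sum>i\<in>I. \<bar>x i\<bar>"
    have s: "0 \<le> ?s" by (intro sum_nonneg) auto
    have "C * exp (m * ?s) \<le> C * exp ((m + k) * ?s)" "D * exp (k * ?s) \<le> D * exp ((m + k) * ?s)"
      using * s by (auto intro!: mult_left_mono mult_right_mono)
    with *(3,6)[of x] show "\<bar>f x + g x\<bar> \<le> (C + D) * exp ((m + k) * ?s)"
      by (simp add: distrib_right)
  qed (use * in auto)
qed

lemma exp_bdd_mult:
  assumes "exp_bdd I f" "exp_bdd I g" shows "exp_bdd I (\<lambda>x. f x * g x)"
proof -
  obtain C m D k where *: "0 \<le> C" "0 \<le> m" "\<And>x. \<bar>f x\<bar> \<le> C * exp (m * (\<Sum>i\<in>I. \<bar>x i\<bar>))"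
    "0 \<le> D" "0 \<le> k" "\<And>x. \<bar>g x\<bar> \<le> D * exp (k * (\<Sum>i\<in>I. \<bar>x i\<bar>))"
    using assms unfolding exp_bdd_def by blast
  show ?thesis
  proof (rule exp_bddI[of "C * D" "m + k"])
    fix x :: "'a \<Rightarrow> real"
    let ?s = "\<Sum>i\<in>I. \<bar>x i\<bar>"
    have "\<bar>f x * g x\<bar> \<le> (C * exp (m * ?s)) * (D * exp (k * ?s))"
      unfolding abs_mult using *(3,6)[of x] * by (intro mult_mono) auto
    then show "\<bar>f x * g x\<bar> \<le> (C * D) * exp ((m + k) * ?s)"
      by (simp add: distrib_right exp_add mult_ac)
  qed (use * in auto)
qed

lemma exp_bdd_uminus: "exp_bdd I f \<Longrightarrow> exp_bdd I (\<lambda>x. - f x)"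
  by (rule exp_bdd_mono) auto

lemma exp_bdd_diff: "exp_bdd I f \<Longrightarrow> exp_bdd I g \<Longrightarrow> exp_bdd I (\<lambda>x. f x - g x)"
  using exp_bdd_add[OF _ exp_bdd_uminus] by fastforce

lemma exp_bdd_divide: "exp_bdd I f \<Longrightarrow> exp_bdd I (\<lambda>x. f x / c)"
  using exp_bdd_mult[OF _ exp_bdd_const, of I f "inverse c"] by (simp add: divide_inverse)

lemma exp_bdd_power: "exp_bdd I f \<Longrightarrow> exp_bdd I (\<lambda>x. f x ^ k)"
  by (induction k) (auto intro: exp_bdd_const exp_bdd_mult)

lemma exp_bdd_sum: "(\<And>a. a \<in> A \<Longrightarrow> exp_bdd I (f a)) \<Longrightarrow> exp_bdd I (\<lambda>x. \<Sum>a\<in>A. f a x)"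
  by (induction A rule: infinite_finite_induct) (auto intro: exp_bdd_const exp_bdd_add)

lemma exp_bdd_prod: "(\<And>a. a \<in> A \<Longrightarrow> exp_bdd I (f a)) \<Longrightarrow> exp_bdd I (\<lambda>x. \<Prod>a\<in>A. f a x)"
  by (induction A rule: infinite_finite_induct) (auto intro: exp_bdd_const exp_bdd_mult)

lemma exp_bdd_abs: "exp_bdd I f \<Longrightarrow> exp_bdd I (\<lambda>x. \<bar>f x\<bar>)"
  by (rule exp_bdd_mono) auto

lemmas exp_bdd_intros = exp_bdd_const exp_bdd_proj exp_bdd_add exp_bdd_mult exp_bdd_uminus
  exp_bdd_diff exp_bdd_divide exp_bdd_power exp_bdd_sum exp_bdd_prod exp_bdd_abs

text \<open>The majorant is a product of functions of one coordinate each, so integrability reduces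
  to dimension one.\<close>

lemma exp_bdd_integrable:
  assumes fin: "finite I" and f: "exp_bdd I f" "f \<in> borel_measurable (borelN I)"
  shows "integrable (gaussN I) f"
proof -
  obtain C m where *: "0 \<le> C" "\<And>x. \<bar>f x\<bar> \<le> C * exp (m * (\<Sum>i\<in>I. \<bar>x i\<bar>))"
    using f unfolding exp_bdd_def by blast
  show ?thesis
  proof (rule Bochner_Integration.integrable_bound)
    show "integrable (gaussN I) (\<lambda>x. C * (\<Prod>i\<in>I. exp (m * \<bar>x i\<bar>)))"
      using fin by (intro integrable_mult_right G.product_integrable_prod integrable_stdN_exp_abs)
    show "AE x in gaussN I. norm (f x) \<le> norm (C * (\<Prod>i\<in>I. exp (m * \<bar>x i\<bar>)))"
      using *  by (intro AE_I2) (auto simp: exp_sum[OF fin, symmetric] sum_distrib_left)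
    show "f \<in> borel_measurable (gaussN I)" using f by (simp add: borel_measurable_gaussN)
  qed
qed

lemma gaussN_ibp:
  fixes F F' :: "('i \<Rightarrow> real) \<Rightarrow> real"
  assumes fin: "finite I" and i: "i \<in> I"
    and F: "exp_bdd I F" "F \<in> borel_measurable (borelN I)"
    and F': "exp_bdd I F'" "F' \<in> borel_measurable (borelN I)"
    and cont: "\<And>x. continuous_on UNIV (\<lambda>y. F (x(i := y)))"
    and der: "\<And>x. \<exists>T. finite T \<and>
      (\<forall>y. y \<notin> T \<longrightarrow> ((\<lambda>y. F (x(i := y))) has_real_derivative F' (x(i := y))) (at y))"
  shows "(\<integral>x. x i * F x \<partial>gaussN I) = (\<integral>x. F' x \<partial>gaussN I)"
proof -
  define J where "J = I - {i}"
  have J: "I = insert i J" "i \<notin> J" "finite J" using i fin by (auto simp: J_def)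
  have meas: "(\<lambda>x. x i * F x) \<in> borel_measurable (borelN I)"
    using F(2) i by measurable
  have I1: "integrable (gaussN (insert i J)) (\<lambda>x. x i * F x)"
    unfolding J(1)[symmetric] using fin i F(1) meas
    by (intro exp_bdd_integrable exp_bdd_intros)
  have I2: "integrable (gaussN (insert i J)) F'"
    unfolding J(1)[symmetric] using fin F' by (intro exp_bdd_integrable)
  have "(\<integral>x. x i * F x \<partial>gaussN I) = (\<integral>x. (\<integral>y. (x(i:=y)) i * F (x(i:=y)) \<partial>stdN) \<partial>gaussN J)"
    by (subst J(1), rule G.product_integral_insert[OF J(3,2) I1])
  also have "\<dots> = (\<integral>x. (\<integral>y. F' (x(i:=y)) \<partial>stdN) \<partial>gaussN J)"
  proof (rule Bochner_Integration.integral_cong[OF refl])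
    fix x assume x: "x \<in> space (gaussN J)"
    obtain T where T: "finite T"
      "\<And>y. y \<notin> T \<Longrightarrow> ((\<lambda>y. F (x(i := y))) has_real_derivative F' (x(i := y))) (at y)"
      using der by meson
    have bd: "\<exists>C m. 0 \<le> C \<and> 0 \<le> m \<and> (\<forall>y. \<bar>H (x(i := y))\<bar> \<le> C * exp (m * \<bar>y\<bar>))" if H: "exp_bdd I H" for H
    proof -
      obtain C m where *: "0 \<le> C" "0 \<le> m" "\<And>x. \<bar>H x\<bar> \<le> C * exp (m * (\<Sum>i\<in>I. \<bar>x i\<bar>))"
        using H unfolding exp_bdd_def by blast
      have "\<bar>H (x(i := y))\<bar> \<le> (C * exp (m * (\<Sum>j\<in>J. \<bar>x j\<bar>))) * exp (m * \<bar>y\<bar>)" for y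
      proof -
        have "(\<Sum>j\<in>I. \<bar>(x(i := y)) j\<bar>) = \<bar>y\<bar> + (\<Sum>j\<in>J. \<bar>x j\<bar>)"
          using J(2,3) unfolding J(1) by (subst sum.insert) (auto intro!: sum.cong)
        then show ?thesis using *(3)[of "x(i := y)"] by (simp add: distrib_left exp_add mult_ac)
      qed
      with * show ?thesis by (meson exp_ge_zero mult_nonneg_nonneg)
    qed
    obtain C m where C: "0 \<le> C" "0 \<le> m" "\<And>y. \<bar>F (x(i := y))\<bar> \<le> C * exp (m * \<bar>y\<bar>)" using bd[OF F(1)] by blast
    obtain D k where D: "0 \<le> D" "0 \<le> k" "\<And>y. \<bar>F' (x(i := y))\<bar> \<le> D * exp (k * \<bar>y\<bar>)" using bd[OF F'(1)] by blast
    \<comment> \<open>\<open>stdN_ibp\<close> wants one bound for the function and its derivative;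
      the sums of the constants serve both.\<close>
    have le: "C * exp (m * \<bar>y\<bar>) \<le> (C + D) * exp ((m + k) * \<bar>y\<bar>)"
      "D * exp (k * \<bar>y\<bar>) \<le> (C + D) * exp ((m + k) * \<bar>y\<bar>)" for y
      using C D by (auto intro!: mult_mono mult_right_mono)
    have "(\<integral>y. y * F (x(i:=y)) \<partial>stdN) = (\<integral>y. F' (x(i:=y)) \<partial>stdN)"
    proof (rule stdN_ibp[OF T(1) T(2) cont])
      show "\<bar>F (x(i := y))\<bar> \<le> (C + D) * exp ((m + k) * \<bar>y\<bar>)" for y
        using C(3) le(1) order_trans by blast
      show "\<bar>F' (x(i := y))\<bar> \<le> (C + D) * exp ((m + k) * \<bar>y\<bar>)" for y
        using D(3) le(2) order_trans by blast
      have "(\<lambda>y. x(i := y)) \<in> borel \<rightarrow>\<^sub>M borelN (insert i J)"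
        using measurable_component_update[of x J "\<lambda>_. borel" i] x J(2) by (simp add: space_PiM)
      then show "(\<lambda>y. F' (x(i := y))) \<in> borel_measurable borel"
        using F'(2) unfolding J(1) by (rule measurable_compose)
    qed
    then show "(\<integral>y. (x(i:=y)) i * F (x(i:=y)) \<partial>stdN) = (\<integral>y. F' (x(i:=y)) \<partial>stdN)"
      by simp
  qed
  also have "\<dots> = (\<integral>x. F' x \<partial>gaussN I)"
    using G.product_integral_insert[OF J(3,2) I2] J(1) by simp
  finally show ?thesis .
qed

text \<open>The divergence theorem for the vector field \<open>F\<close> under the Gaussian measure.
  Both loop equations are instances of it, for suitable fields.\<close>

lemma gaussN_divergence:
  fixes F F' :: "'i \<Rightarrow> ('i \<Rightarrow> real) \<Rightarrow> real"
  assumes fin: "finite I"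
    and F: "\<And>i. i \<in> I \<Longrightarrow> exp_bdd I (F i)" "\<And>i. i \<in> I \<Longrightarrow> F i \<in> borel_measurable (borelN I)"
    and F': "\<And>i. i \<in> I \<Longrightarrow> exp_bdd I (F' i)" "\<And>i. i \<in> I \<Longrightarrow> F' i \<in> borel_measurable (borelN I)"
    and cont: "\<And>i x. i \<in> I \<Longrightarrow> continuous_on UNIV (\<lambda>y. F i (x(i := y)))"
    and der: "\<And>i x. i \<in> I \<Longrightarrow> \<exists>T. finite T \<and>
      (\<forall>y. y \<notin> T \<longrightarrow> ((\<lambda>y. F i (x(i := y))) has_real_derivative F' i (x(i := y))) (at y))"
  shows "integrable (gaussN I) (\<lambda>x. \<Sum>i\<in>I. x i * F i x) \<and> integrable (gaussN I) (\<lambda>x. \<Sum>i\<in>I. F' i x) \<and>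
    (\<integral>x. (\<Sum>i\<in>I. x i * F i x) \<partial>gaussN I) = (\<integral>x. (\<Sum>i\<in>I. F' i x) \<partial>gaussN I)"
proof -
  have iF: "integrable (gaussN I) (\<lambda>x. x i * F i x)" and iF': "integrable (gaussN I) (F' i)" if "i \<in> I" for i
    using fin F[OF that] F'[OF that] that
    by (auto intro!: exp_bdd_integrable exp_bdd_intros borel_measurable_times measurable_component_singleton)
  have "(\<integral>x. x i * F i x \<partial>gaussN I) = (\<integral>x. F' i x \<partial>gaussN I)" if "i \<in> I" for i
    by (rule gaussN_ibp[OF fin that F[OF that] F'[OF that] cont[OF that] der[OF that]])
  then show ?thesis using iF iF' by (simp add: Bochner_Integration.integral_sum)
qed

definition PL :: "(nat \<Rightarrow> real) \<Rightarrow> nat list \<Rightarrow> real" where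
  "PL \<tau> ls = prod_list (map \<tau> ls)"

text \<open>The derivation that sends \<open>\<tau> l\<close> to \<open>d l\<close>, applied to the
  product \<open>PL \<tau> ls\<close> by the Leibniz rule.\<close>

fun pderL :: "(nat \<Rightarrow> real) \<Rightarrow> (nat \<Rightarrow> real) \<Rightarrow> nat list \<Rightarrow> real" where
  "pderL \<tau> d [] = 0"
| "pderL \<tau> d (l # ls) = d l * PL \<tau> ls + \<tau> l * pderL \<tau> d ls"

lemma PL_simps [simp]: "PL \<tau> [] = 1" "PL \<tau> (l # ls) = \<tau> l * PL \<tau> ls"
  "PL \<tau> (ks @ ls) = PL \<tau> ks * PL \<tau> ls"
  by (simp_all add: PL_def)

lemma DERIV_PL:
  assumes "\<And>l. ((\<lambda>y. \<tau> y l) has_real_derivative d l) (at y)"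
  shows "((\<lambda>y. PL (\<tau> y) ls) has_real_derivative pderL (\<tau> y) d ls) (at y)"
proof (induction ls)
  case (Cons l ls)
  from DERIV_mult[OF assms[of l] Cons] show ?case by (simp add: mult_ac add_ac)
qed simp

lemma pderL_sum: "(\<Sum>i\<in>A. c i * pderL \<tau> (d i) ls) = pderL \<tau> (\<lambda>l. \<Sum>i\<in>A. c i * d i l) ls"
proof (induction ls)
  case (Cons l ls)
  have "(\<Sum>i\<in>A. c i * pderL \<tau> (d i) (l # ls)) =
      (\<Sum>i\<in>A. c i * d i l) * PL \<tau> ls + \<tau> l * (\<Sum>i\<in>A. c i * pderL \<tau> (d i) ls)"
    by (simp add: distrib_left sum.distrib sum_distrib_left sum_distrib_right mult_ac)
  then show ?case by (simp add: Cons)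
qed simp

lemma pderL_cong: "(\<And>l. d l = d' l) \<Longrightarrow> pderL \<tau> d ls = pderL \<tau> d' ls"
  by (induction ls) auto

lemma borel_measurable_PL [measurable]:
  assumes "\<And>l. (\<lambda>x. \<tau> x l) \<in> borel_measurable M"
  shows "(\<lambda>x. PL (\<tau> x) ls) \<in> borel_measurable M"
proof (induction ls)
  case (Cons l ls)
  show ?case unfolding PL_simps by (rule borel_measurable_times[OF assms Cons])
qed simp

lemma borel_measurable_pderL [measurable]:
  assumes \<tau>: "\<And>l. (\<lambda>x. \<tau> x l) \<in> borel_measurable M" and d: "\<And>l. (\<lambda>x. d x l) \<in> borel_measurable M"
  shows "(\<lambda>x. pderL (\<tau> x) (d x) ls) \<in> borel_measurable M"
proof (induction ls)
  case (Cons l ls)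
  show ?case unfolding pderL.simps
    by (intro borel_measurable_add borel_measurable_times d \<tau> Cons borel_measurable_PL)
qed simp

lemma exp_bdd_PL:
  assumes "\<And>l. exp_bdd I (\<lambda>x. \<tau> x l)"
  shows "exp_bdd I (\<lambda>x. PL (\<tau> x) ls)"
  by (induction ls) (auto intro!: exp_bdd_intros assms)

lemma exp_bdd_pderL:
  assumes "\<And>l. exp_bdd I (\<lambda>x. \<tau> x l)" "\<And>l. exp_bdd I (\<lambda>x. d x l)"
  shows "exp_bdd I (\<lambda>x. pderL (\<tau> x) (d x) ls)"
  by (induction ls) (auto intro!: exp_bdd_intros assms exp_bdd_PL)

text \<open>What integration by parts makes of \<open>\<tau> (k + 1) * PL \<tau> ls\<close>, for power sums weighted by the Vandermonde
  product as well as for traces of powers.\<close>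

definition loop_rhs :: "(nat \<Rightarrow> real) \<Rightarrow> nat \<Rightarrow> nat list \<Rightarrow> real" where
  "loop_rhs \<tau> k ls = (real k * \<tau> (k - 1) + (\<Sum>u<k. \<tau> u * \<tau> (k - 1 - u))) / 2 * PL \<tau> ls
     + pderL \<tau> (\<lambda>l. real l * \<tau> (k + l - 1)) ls"

section \<open>The eigenvalue model\<close>

definition psum :: "nat \<Rightarrow> (nat \<Rightarrow> real) \<Rightarrow> nat \<Rightarrow> real" where
  "psum n x k = (\<Sum>i<n. x i ^ k)"

definition pairs :: "nat \<Rightarrow> (nat \<times> nat) set" where
  "pairs n = {(a, b). a < b \<and> b < n}"

lemma finite_pairs [simp]: "finite (pairs n)"
  by (rule finite_subset[of _ "{..<n} \<times> {..<n}"]) (auto simp: pairs_def)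

definition aVdm :: "nat \<Rightarrow> (nat \<Rightarrow> real) \<Rightarrow> real" where
  "aVdm n x = (\<Prod>p\<in>pairs n. \<bar>x (snd p) - x (fst p)\<bar>)"

text \<open>The partial derivative of \<open>aVdm n\<close> in direction \<open>i\<close>, written without division so that
  \<open>sum_aVdm'\<close> below also holds when coordinates coincide.\<close>

definition aVdm' :: "nat \<Rightarrow> nat \<Rightarrow> (nat \<Rightarrow> real) \<Rightarrow> real" where
  "aVdm' n i x = (\<Sum>p\<in>pairs n. (of_bool (i = snd p) - of_bool (i = fst p)) *
      sgn (x (snd p) - x (fst p)) * (\<Prod>q\<in>pairs n - {p}. \<bar>x (snd q) - x (fst q)\<bar>))"

lemma DERIV_psum:
  assumes "i < n"
  shows "((\<lambda>y. psum n (x(i := y)) l) has_real_derivative real l * y ^ (l - 1)) (at y)"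
proof -
  have "((\<lambda>y. \<Sum>j<n. (x(i := y)) j ^ l) has_real_derivative
      (\<Sum>j<n. if j = i then real l * y ^ (l - 1) else 0)) (at y)"
    by (intro DERIV_sum) (auto intro!: derivative_eq_intros)
  then show ?thesis using assms by (simp add: psum_def)
qed

lemma DERIV_abs_real: "z \<noteq> c \<Longrightarrow> ((\<lambda>y::real. \<bar>y - c\<bar>) has_real_derivative sgn (z - c)) (at z)"
proof (cases "z > c")
  case True
  have "((\<lambda>y. y - c) has_real_derivative 1) (at z)" by (auto intro!: derivative_eq_intros)
  then have "((\<lambda>y. \<bar>y - c\<bar>) has_real_derivative 1) (at z)"
    by (rule has_field_derivative_transform_within_open[of _ _ _ "{c<..}"]) (use True in auto)
  then show ?thesis using True by simp
next
  case False
  assume "z \<noteq> c"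
  with False have "z < c" by simp
  have "((\<lambda>y. c - y) has_real_derivative - 1) (at z)" by (auto intro!: derivative_eq_intros)
  then have "((\<lambda>y. \<bar>y - c\<bar>) has_real_derivative - 1) (at z)"
    by (rule has_field_derivative_transform_within_open[of _ _ _ "{..<c}"]) (use \<open>z < c\<close> in auto)
  then show ?thesis using \<open>z < c\<close> by simp
qed

lemma DERIV_aVdm:
  assumes "y \<notin> x ` {..<n}"
  shows "((\<lambda>y. aVdm n (x(i := y))) has_real_derivative aVdm' n i (x(i := y))) (at y)"
proof -
  have *: "((\<lambda>y. \<bar>(x(i := y)) (snd p) - (x(i := y)) (fst p)\<bar>) has_real_derivative
      (of_bool (i = snd p) - of_bool (i = fst p)) * sgn ((x(i := y)) (snd p) - (x(i := y)) (fst p))) (at y)"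
    if "p \<in> pairs n" for p
  proof -
    obtain a b where p: "p = (a, b)" "a < b" "b < n" using \<open>p \<in> pairs n\<close> by (auto simp: pairs_def)
    have ne: "y \<noteq> x a" "y \<noteq> x b" using assms p by auto
    consider "i = b" | "i = a" | "i \<noteq> a" "i \<noteq> b" by blast
    then show ?thesis
    proof cases
      case 1
      then show ?thesis using p DERIV_abs_real[OF ne(1)] by simp
    next
      case 2
      have "sgn (x b - y) = - sgn (y - x b)" by (simp add: sgn_if)
      then show ?thesis using 2 p DERIV_abs_real[OF ne(2)] by (simp add: abs_minus_commute)
    next
      case 3
      then show ?thesis using p by simp
    qed
  qed
  show ?thesis
    unfolding aVdm_def aVdm'_def
    by (rule has_field_derivative_prod) (rule *)
qed

text \<open>A pair with values a, b contributes the quotient of b^k - a^k by b - a, times the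
  weight. This quotient is the symmetric polynomial \<open>h\<close>, so the sum over
  \<open>pairs n\<close> is half of the sum over all ordered pairs minus the diagonal. The full sum
  factors into power sums, and the diagonal gives \<open>real k * psum n x (k - 1)\<close>.\<close>

lemma sum_aVdm':
  "(\<Sum>i<n. x i ^ k * aVdm' n i x) =
   (\<Sum>u<k. psum n x u * psum n x (k - 1 - u)) / 2 * aVdm n x - real k * psum n x (k - 1) / 2 * aVdm n x"
proof -
  define P where "P p = (\<Prod>q\<in>pairs n - {p}. \<bar>x (snd q) - x (fst q)\<bar>)" for p
  define h where "h a b = (\<Sum>u<k. a ^ (k - 1 - u) * b ^ u)" for a b :: real
  have hsym: "h a b = h b a" for a b
    unfolding h_def by (rule sum.reindex_bij_witness[of _ "\<lambda>u. k - 1 - u" "\<lambda>u. k - 1 - u"]) auto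
  have pow: "b ^ k - a ^ k = (b - a) * h b a" for a b :: real
    by (subst hsym) (simp add: h_def power_diff_sumr2)
  have "(\<Sum>i<n. x i ^ k * aVdm' n i x) =
      (\<Sum>p\<in>pairs n. \<Sum>i<n. x i ^ k * ((of_bool (i = snd p) - of_bool (i = fst p)) * (sgn (x (snd p) - x (fst p)) * P p)))"
    unfolding aVdm'_def sum_distrib_left P_def[symmetric] by (subst sum.swap) (simp add: mult_ac)
  also have "\<dots> = (\<Sum>p\<in>pairs n. h (x (snd p)) (x (fst p)) * aVdm n x)"
  proof (rule sum.cong[OF refl])
    fix p assume "p \<in> pairs n"
    then obtain a b where p: "p = (a, b)" "a < b" "b < n" "p \<in> pairs n" by (auto simp: pairs_def)
    have "(\<Sum>i<n. x i ^ k * ((of_bool (i = snd p) - of_bool (i = fst p)) * (sgn (x (snd p) - x (fst p)) * P p)))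
      = (\<Sum>i<n. (if i = b then x i ^ k else 0) - (if i = a then x i ^ k else 0)) * (sgn (x b - x a) * P p)"
      unfolding sum_distrib_right p(1) by (intro sum.cong) auto
    also have "\<dots> = (x b ^ k - x a ^ k) * (sgn (x b - x a) * P p)"
      using p by (simp add: sum_subtractf)
    also have "\<dots> = h (x b) (x a) * (\<bar>x b - x a\<bar> * P p)"
      unfolding pow by (simp add: abs_sgn mult_ac)
    also have "\<bar>x b - x a\<bar> * P p = aVdm n x"
      unfolding aVdm_def P_def using prod.remove[OF finite_pairs p(4), of "\<lambda>q. \<bar>x (snd q) - x (fst q)\<bar>"] p(1)
      by simp
    finally show "(\<Sum>i<n. x i ^ k * ((of_bool (i = snd p) - of_bool (i = fst p)) * (sgn (x (snd p) - x (fst p)) * P p)))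
      = h (x (snd p)) (x (fst p)) * aVdm n x" using p(1) by simp
  qed
  also have "\<dots> = (\<Sum>p\<in>pairs n. h (x (snd p)) (x (fst p))) * aVdm n x"
    by (simp add: sum_distrib_right)
  also have "(\<Sum>p\<in>pairs n. h (x (snd p)) (x (fst p))) =
      (\<Sum>u<k. psum n x u * psum n x (k - 1 - u)) / 2 - real k * psum n x (k - 1) / 2"
  proof -
    define H where "H p = h (x (snd p)) (x (fst p))" for p :: "nat \<times> nat"
    have split: "{..<n} \<times> {..<n} = pairs n \<union> (prod.swap ` pairs n \<union> (\<lambda>i. (i, i)) ` {..<n})"
      by (auto simp: pairs_def image_iff)
    have "sum H ({..<n} \<times> {..<n}) = sum H (pairs n) + (sum H (prod.swap ` pairs n) + sum H ((\<lambda>i. (i, i)) ` {..<n}))"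
    proof -
      have "prod.swap ` pairs n \<inter> (\<lambda>i. (i, i)) ` {..<n} = {}"
        "pairs n \<inter> (prod.swap ` pairs n \<union> (\<lambda>i. (i, i)) ` {..<n}) = {}"
        by (auto simp: pairs_def)
      then show ?thesis unfolding split by (simp add: sum.union_disjoint)
    qed
    also have "sum H (prod.swap ` pairs n) = sum H (pairs n)"
      by (subst sum.reindex) (auto simp: H_def hsym intro!: sum.cong)
    also have "sum H ((\<lambda>i. (i, i)) ` {..<n}) = (\<Sum>i<n. h (x i) (x i))"
      by (subst sum.reindex) (auto simp: H_def inj_on_def)
    also have "(\<Sum>i<n. h (x i) (x i)) = real k * psum n x (k - 1)"
      unfolding h_def psum_def sum_distrib_left
      by (rule sum.cong[OF refl]) (simp add: power_add[symmetric])
    also have "sum H ({..<n} \<times> {..<n}) = (\<Sum>u<k. psum n x u * psum n x (k - 1 - u))"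
      unfolding H_def h_def
      by (subst sum.swap) (simp add: psum_def sum_product sum.cartesian_product case_prod_beta mult_ac)
    finally show ?thesis by (simp add: H_def field_simps)
  qed
  finally show ?thesis by (simp add: left_diff_distrib)
qed

lemma continuous_on_fun_upd_arg: "continuous_on UNIV (\<lambda>y::real. (x(i := y)) j)"
  by (cases "j = i") auto

lemma exp_bdd_psum: "i \<le> n \<Longrightarrow> exp_bdd {..<n} (\<lambda>x. psum n x k)"
  unfolding psum_def by (intro exp_bdd_intros) auto

lemma borel_psum [measurable]: "(\<lambda>x. psum n x k) \<in> borel_measurable (borelN {..<n})"
  unfolding psum_def by measurable

lemma exp_bdd_aVdm: "exp_bdd {..<n} (aVdm n)"
  unfolding aVdm_def[abs_def] by (intro exp_bdd_intros) (auto simp: pairs_def)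

lemma exp_bdd_aVdm': "exp_bdd {..<n} (aVdm' n i)"
proof -
  have "exp_bdd {..<n} (\<lambda>x. sgn (x a - x b))" for a b
    by (rule exp_bdd_bounded[of _ 1]) (simp add: sgn_if)
  then show ?thesis
    unfolding aVdm'_def[abs_def] by (intro exp_bdd_intros) (auto simp: pairs_def)
qed

lemma borel_aVdm [measurable]: "aVdm n \<in> borel_measurable (borelN {..<n})"
  unfolding aVdm_def[abs_def]
  by (intro borel_measurable_prod borel_measurable_abs borel_measurable_diff measurable_component_singleton)
     (auto simp: pairs_def)

lemma borel_aVdm' [measurable]: "aVdm' n i \<in> borel_measurable (borelN {..<n})"
  unfolding aVdm'_def[abs_def]
  by (intro borel_measurable_prod borel_measurable_abs borel_measurable_diff measurable_component_singleton
      borel_measurable_sum borel_measurable_times borel_measurable_const borel_measurable_sgn)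
     (auto simp: pairs_def)

lemma psum_2_nonneg: "psum n x 2 \<ge> 0"
  unfolding psum_def by (intro sum_nonneg) auto

lemma exp_bdd_exp_neg: "t \<ge> 0 \<Longrightarrow> (\<And>x. f x \<ge> 0) \<Longrightarrow> exp_bdd I (\<lambda>x. exp (- t * f x))"
  by (rule exp_bdd_bounded[of _ 1]) simp

text \<open>The field is \<open>x i ^ k\<close> times the product of power sums, the damping and the
  weight. Differentiating the damping returns \<open>- 2 * t\<close> times the left-hand integral,
  whence the factor \<open>1 + 2 * t\<close>. By \<open>sum_aVdm'\<close> the weight turns the term
  \<open>real k * psum n x (k - 1)\<close> into its half.\<close>

theorem eigenvalue_loop:
  fixes n k :: nat
  assumes t: "t \<ge> 0"
  defines "w \<equiv> \<lambda>x. exp (- t * psum n x 2)"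
  shows "(1 + 2 * t) * (\<integral>x. w x * PL (psum n x) (Suc k # ls) * aVdm n x \<partial>gaussN {..<n}) =
    (\<integral>x. w x * loop_rhs (psum n x) k ls * aVdm n x \<partial>gaussN {..<n})"
proof -
  let ?P = "\<lambda>x. PL (psum n x) ls"
  define d :: "nat \<Rightarrow> (nat \<Rightarrow> real) \<Rightarrow> nat \<Rightarrow> real" where "d i x l = real l * x i ^ (l - 1)" for i x l
  define F where "F i x = x i ^ k * ?P x * w x * aVdm n x" for i x
  define F' where "F' i x = real k * x i ^ (k - 1) * ?P x * w x * aVdm n x
       + x i ^ k * pderL (psum n x) (d i x) ls * w x * aVdm n x
       + x i ^ k * ?P x * (- t * (2 * x i) * w x) * aVdm n x
       + x i ^ k * ?P x * w x * aVdm' n i x" for i x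
  have sF: "(\<Sum>i<n. x i * F i x) = w x * PL (psum n x) (Suc k # ls) * aVdm n x" for x
    unfolding F_def psum_def PL_simps by (simp add: sum_distrib_left sum_distrib_right mult_ac)
  have sF': "(\<Sum>i<n. F' i x) = w x * loop_rhs (psum n x) k ls * aVdm n x
      - 2 * t * (w x * PL (psum n x) (Suc k # ls) * aVdm n x)" for x
  proof -
    have 1: "(\<Sum>i<n. real k * x i ^ (k - 1) * ?P x * w x * aVdm n x) =
        real k * psum n x (k - 1) * ?P x * w x * aVdm n x"
      by (simp add: psum_def sum_distrib_left sum_distrib_right)
    have "(\<Sum>i<n. x i ^ k * pderL (psum n x) (d i x) ls) = pderL (psum n x) (\<lambda>l. real l * psum n x (k + l - 1)) ls"
      unfolding pderL_sum
    proof (rule pderL_cong)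
      \<comment> \<open>For \<open>l = 0\<close> the factor \<open>real l\<close> annihilates both
        sides, so the truncated exponents do no harm.\<close>
      show "(\<Sum>i<n. x i ^ k * d i x l) = real l * psum n x (k + l - 1)" for l
        by (cases l) (simp_all add: d_def psum_def sum_distrib_left power_add mult_ac)
    qed
    then have 2: "(\<Sum>i<n. x i ^ k * pderL (psum n x) (d i x) ls * w x * aVdm n x) =
        pderL (psum n x) (\<lambda>l. real l * psum n x (k + l - 1)) ls * w x * aVdm n x"
      by (simp add: sum_distrib_right[symmetric])
    have 3: "(\<Sum>i<n. x i ^ k * ?P x * (- t * (2 * x i) * w x) * aVdm n x) =
        - 2 * t * (w x * PL (psum n x) (Suc k # ls) * aVdm n x)"
      unfolding psum_def PL_simps
      by (simp add: sum_distrib_left sum_distrib_right mult_ac sum_negf)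
    have 4: "(\<Sum>i<n. x i ^ k * ?P x * w x * aVdm' n i x) = ?P x * w x * (\<Sum>i<n. x i ^ k * aVdm' n i x)"
      by (simp add: sum_distrib_left mult_ac)
    show ?thesis
      unfolding F'_def sum.distrib 1 2 3 4 sum_aVdm' loop_rhs_def
      by (simp add: algebra_simps add_divide_distrib)
  qed
  note eb = exp_bdd_psum[OF order_refl] exp_bdd_PL exp_bdd_pderL
    exp_bdd_exp_neg[OF t psum_2_nonneg] exp_bdd_aVdm exp_bdd_aVdm' exp_bdd_intros
  note bm = borel_measurable_times borel_measurable_add borel_measurable_power borel_measurable_PL
    borel_measurable_pderL borel_psum borel_aVdm borel_aVdm' borel_measurable_const measurable_component_singleton
  have [measurable]: "w \<in> borel_measurable (borelN {..<n})" unfolding w_def by measurable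
  have "integrable (gaussN {..<n}) (\<lambda>x. \<Sum>i<n. x i * F i x) \<and> integrable (gaussN {..<n}) (\<lambda>x. \<Sum>i<n. F' i x) \<and>
      (\<integral>x. (\<Sum>i<n. x i * F i x) \<partial>gaussN {..<n}) = (\<integral>x. (\<Sum>i<n. F' i x) \<partial>gaussN {..<n})"
  proof (rule gaussN_divergence)
    fix i and x :: "nat \<Rightarrow> real" assume i: "i \<in> {..<n}"
    show "exp_bdd {..<n} (F i)" "exp_bdd {..<n} (F' i)"
      unfolding F_def F'_def w_def d_def by (intro eb; use i in simp)+
    show "F i \<in> borel_measurable (borelN {..<n})" "F' i \<in> borel_measurable (borelN {..<n})"
      unfolding F_def F'_def d_def by (intro bm; use i in simp)+
    let ?x = "\<lambda>y :: real. x(i := y)"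
    have Dp: "((\<lambda>y. psum n (?x y) l) has_real_derivative d i (?x y) l) (at y)" for l y
      using DERIV_psum i by (simp add: d_def)
    have DPL: "((\<lambda>y. ?P (?x y)) has_real_derivative pderL (psum n (?x y)) (d i (?x y)) ls) (at y)" for y
      by (rule DERIV_PL) (rule Dp)
    have Dw: "((\<lambda>y. w (?x y)) has_real_derivative - t * (2 * ?x y i) * w (?x y)) (at y)" for y
      unfolding w_def using Dp[of 2 y] by (auto intro!: derivative_eq_intros simp: d_def)
    have Dk: "((\<lambda>y. ?x y i ^ k) has_real_derivative real k * ?x y i ^ (k - 1)) (at y)" for y
      by (auto intro!: derivative_eq_intros)
    show "continuous_on UNIV (\<lambda>y. F i (?x y))"
      unfolding F_def aVdm_def
      by (intro continuous_intros continuous_on_fun_upd_arg)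
        (use DPL Dw in \<open>auto intro: DERIV_isCont continuous_at_imp_continuous_on\<close>)
    have "((\<lambda>y. F i (?x y)) has_real_derivative F' i (?x y)) (at y)" if "y \<notin> x ` {..<n}" for y
      unfolding F_def F'_def
      by (rule DERIV_cong[OF DERIV_mult[OF DERIV_mult[OF DERIV_mult[OF Dk DPL] Dw] DERIV_aVdm[OF that]]])
        (simp only: ring_distribs mult_ac add_ac)
    then show "\<exists>T. finite T \<and> (\<forall>y. y \<notin> T \<longrightarrow> ((\<lambda>y. F i (?x y)) has_real_derivative F' i (?x y)) (at y))"
      by (intro exI[of _ "x ` {..<n}"]) auto
  qed auto
  then have iF: "integrable (gaussN {..<n}) (\<lambda>x. w x * PL (psum n x) (Suc k # ls) * aVdm n x)"
    and iF': "integrable (gaussN {..<n}) (\<lambda>x. w x * loop_rhs (psum n x) k ls * aVdm n x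
      - 2 * t * (w x * PL (psum n x) (Suc k # ls) * aVdm n x))"
    and eq: "(\<integral>x. w x * PL (psum n x) (Suc k # ls) * aVdm n x \<partial>gaussN {..<n}) =
      (\<integral>x. w x * loop_rhs (psum n x) k ls * aVdm n x
        - 2 * t * (w x * PL (psum n x) (Suc k # ls) * aVdm n x) \<partial>gaussN {..<n})"
    unfolding sF sF' by blast+
  have "integrable (gaussN {..<n}) (\<lambda>x. w x * loop_rhs (psum n x) k ls * aVdm n x)"
    using Bochner_Integration.integrable_add[OF iF' integrable_mult_right[OF iF, of "2 * t"]] by simp
  then show ?thesis using eq iF by (simp add: distrib_right del: PL_simps)
qed

section \<open>The matrix model\<close>

text \<open>With this scaling the symmetric matrix has a density proportional to exp(- tr M^2 / 2),
  which matches standard normals on the eigenvalue side. Isotropy does not depend on the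
  scale.\<close>

definition symm :: "(nat \<times> nat \<Rightarrow> real) \<Rightarrow> nat \<Rightarrow> nat \<Rightarrow> real" where
  "symm b i j = (b (i, j) + b (j, i)) / 2"

text \<open>Powers are given by scalar recursions, so that they can be differentiated and measured
  entry by entry; \<open>cmat_pow\<close> links them to matrix powers.\<close>

fun mpow :: "nat \<Rightarrow> (nat \<times> nat \<Rightarrow> real) \<Rightarrow> nat \<Rightarrow> nat \<Rightarrow> nat \<Rightarrow> real" where
  "mpow n b 0 i j = of_bool (i = j)"
| "mpow n b (Suc k) i j = (\<Sum>l<n. symm b i l * mpow n b k l j)"

definition trp :: "nat \<Rightarrow> (nat \<times> nat \<Rightarrow> real) \<Rightarrow> nat \<Rightarrow> real" where
  "trp n b k = (\<Sum>i<n. mpow n b k i i)"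

lemma symm_commute: "symm b i j = symm b j i"
  by (simp add: symm_def add.commute)

lemma sum_of_bool_left [simp]:
  fixes f :: "nat \<Rightarrow> real"
  shows "i < n \<Longrightarrow> (\<Sum>l<n. of_bool (i = l) * f l) = f i" "i < n \<Longrightarrow> (\<Sum>l<n. of_bool (l = i) * f l) = f i"
    "i < n \<Longrightarrow> (\<Sum>l<n. f l * of_bool (i = l)) = f i" "i < n \<Longrightarrow> (\<Sum>l<n. f l * of_bool (l = i)) = f i"
proof -
  assume i: "i < n"
  have "(\<Sum>l<n. if l = i then f l else 0) = f i" using i by simp
  moreover have "of_bool (i = l) * f l = (if l = i then f l else 0)"
    "of_bool (l = i) * f l = (if l = i then f l else 0)"
    "f l * of_bool (i = l) = (if l = i then f l else 0)"
    "f l * of_bool (l = i) = (if l = i then f l else 0)" for l by auto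
  ultimately show "(\<Sum>l<n. of_bool (i = l) * f l) = f i" "(\<Sum>l<n. of_bool (l = i) * f l) = f i"
    "(\<Sum>l<n. f l * of_bool (i = l)) = f i" "(\<Sum>l<n. f l * of_bool (l = i)) = f i"
    by simp_all
qed

lemma mpow_add:
  assumes "i < n"
  shows "mpow n b (a + c) i j = (\<Sum>l<n. mpow n b a i l * mpow n b c l j)"
  using assms
proof (induction a arbitrary: i)
  case (Suc a)
  have "mpow n b (Suc a + c) i j = (\<Sum>m<n. \<Sum>l<n. symm b i m * mpow n b a m l * mpow n b c l j)"
    using Suc.IH by (simp add: sum_distrib_left mult.assoc)
  also have "\<dots> = (\<Sum>l<n. \<Sum>m<n. symm b i m * mpow n b a m l * mpow n b c l j)"
    by (rule sum.swap)
  finally show ?case by (simp add: sum_distrib_right)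
qed simp

lemma mpow_sym: "i < n \<Longrightarrow> j < n \<Longrightarrow> mpow n b k i j = mpow n b k j i"
proof (induction k arbitrary: i j)
  case (Suc k)
  have 1: "mpow n b 1 l i = symm b l i" for l using Suc.prems by simp
  have "mpow n b (Suc k) j i = (\<Sum>l<n. mpow n b k j l * mpow n b 1 l i)"
    using mpow_add[OF Suc.prems(2), of b k 1 i] by simp
  also have "\<dots> = (\<Sum>l<n. symm b i l * mpow n b k l j)"
    unfolding 1 using Suc by (intro sum.cong) (auto simp: symm_commute[of b i])
  finally show ?case by simp
qed auto

lemma trp_add: "trp n b (a + c) = (\<Sum>r<n. \<Sum>s<n. mpow n b a r s * mpow n b c r s)"
  unfolding trp_def
proof (rule sum.cong[OF refl])
  fix r assume "r \<in> {..<n}"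
  then show "mpow n b (a + c) r r = (\<Sum>s<n. mpow n b a r s * mpow n b c r s)"
    by (subst mpow_add) (auto intro!: sum.cong simp: mpow_sym[of r n _ b c])
qed

lemma trp_2_nonneg: "trp n b 2 \<ge> 0"
proof -
  have "trp n b (1 + 1) \<ge> 0" unfolding trp_add by (intro sum_nonneg) auto
  then show ?thesis by (simp add: numeral_2_eq_2)
qed

lemma trp_Suc: "trp n b (Suc k) = (\<Sum>r<n. \<Sum>s<n. b (r, s) * mpow n b k r s)"
proof -
  have "trp n b (Suc k) = (\<Sum>r<n. \<Sum>s<n. symm b r s * mpow n b k r s)"
    using trp_add[of n b 1 k] by simp
  also have "\<dots> = (\<Sum>r<n. \<Sum>s<n. b (r, s) * mpow n b k r s) / 2 + (\<Sum>r<n. \<Sum>s<n. b (s, r) * mpow n b k r s) / 2"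
    by (simp add: symm_def sum_divide_distrib sum.distrib add_divide_distrib distrib_right)
  also have "(\<Sum>r<n. \<Sum>s<n. b (s, r) * mpow n b k r s) = (\<Sum>r<n. \<Sum>s<n. b (r, s) * mpow n b k r s)"
    by (subst sum.swap) (auto intro!: sum.cong simp: mpow_sym[of _ n _ b k])
  finally show ?thesis by simp
qed

text \<open>The derivative of an entry of M^k with respect to \<open>b (r, s)\<close>: since M
  depends on this variable through (E_rs + E_sr) / 2, that matrix is inserted in each of the
  \<open>k\<close> positions of the product.\<close>

definition dmpow :: "nat \<Rightarrow> (nat \<times> nat \<Rightarrow> real) \<Rightarrow> nat \<Rightarrow> nat \<Rightarrow> nat \<Rightarrow> nat \<Rightarrow> nat \<Rightarrow> real" where
  "dmpow n b r s k i j = (\<Sum>u<k. (mpow n b u i r * mpow n b (k - 1 - u) s j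
      + mpow n b u i s * mpow n b (k - 1 - u) r j) / 2)"

lemma dmpow_Suc:
  assumes "r < n" "s < n"
  shows "dmpow n b r s (Suc k) i j =
    (of_bool (i = r) * mpow n b k s j + of_bool (i = s) * mpow n b k r j) / 2
    + (\<Sum>l<n. symm b i l * dmpow n b r s k l j)"
proof -
  have "dmpow n b r s (Suc k) i j = (of_bool (i = r) * mpow n b k s j + of_bool (i = s) * mpow n b k r j) / 2
    + (\<Sum>u<k. (mpow n b (Suc u) i r * mpow n b (k - 1 - u) s j
      + mpow n b (Suc u) i s * mpow n b (k - 1 - u) r j) / 2)"
    unfolding dmpow_def sum.lessThan_Suc_shift by simp
  also have "(\<Sum>u<k. (mpow n b (Suc u) i r * mpow n b (k - 1 - u) s j
      + mpow n b (Suc u) i s * mpow n b (k - 1 - u) r j) / 2) = (\<Sum>l<n. symm b i l * dmpow n b r s k l j)"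
    unfolding dmpow_def sum_distrib_left
    by (subst sum.swap)
       (simp add: sum_distrib_left sum_distrib_right sum.distrib add_divide_distrib distrib_left
         sum_divide_distrib mult_ac)
  finally show ?thesis .
qed

lemma DERIV_mpow:
  assumes rs: "r < n" "s < n"
  shows "((\<lambda>y. mpow n (b((r, s) := y)) k i j) has_real_derivative dmpow n (b((r, s) := y)) r s k i j) (at y)"
proof (induction k arbitrary: i j)
  case 0
  show ?case by (simp add: dmpow_def)
next
  case (Suc k)
  define e :: "nat \<Rightarrow> real" where "e l = (of_bool (i = r) * of_bool (l = s) + of_bool (i = s) * of_bool (l = r)) / 2" for l
  have e: "((\<lambda>y. symm (b((r, s) := y)) i l) has_real_derivative e l) (at y)" for l
    unfolding symm_def e_def by (auto intro!: derivative_eq_intros)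
  have "((\<lambda>y. mpow n (b((r, s) := y)) (Suc k) i j) has_real_derivative
     (\<Sum>l<n. e l * mpow n (b((r, s) := y)) k l j + dmpow n (b((r, s) := y)) r s k l j * symm (b((r, s) := y)) i l)) (at y)"
    unfolding mpow.simps by (intro DERIV_sum DERIV_mult e Suc)
  also have "(\<Sum>l<n. e l * mpow n (b((r, s) := y)) k l j + dmpow n (b((r, s) := y)) r s k l j * symm (b((r, s) := y)) i l)
    = dmpow n (b((r, s) := y)) r s (Suc k) i j"
    using rs
    by (simp add: dmpow_Suc e_def sum.distrib add_divide_distrib distrib_right mult_ac
        sum_divide_distrib[symmetric] sum_distrib_left[symmetric] mult.assoc)
  finally show ?case .
qed

text \<open>The trace is cyclic, so all \<open>l\<close> positions of the insertion yield the same
  entry of M^(l-1).\<close>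

lemma sum_dmpow_diag:
  assumes rs: "r < n" "s < n"
  shows "(\<Sum>i<n. dmpow n b r s l i i) = real l * mpow n b (l - 1) r s"
proof -
  have "(\<Sum>i<n. dmpow n b r s l i i) = (\<Sum>u<l. \<Sum>i<n. (mpow n b (l - 1 - u) s i * mpow n b u i r
      + mpow n b (l - 1 - u) r i * mpow n b u i s) / 2)"
    unfolding dmpow_def by (subst sum.swap) (simp add: mult.commute)
  also have "\<dots> = (\<Sum>u<l. mpow n b (l - 1) r s)"
  proof (rule sum.cong[OF refl])
    fix u assume u: "u \<in> {..<l}"
    have "(\<Sum>i<n. (mpow n b (l - 1 - u) s i * mpow n b u i r + mpow n b (l - 1 - u) r i * mpow n b u i s) / 2)
      = (mpow n b (l - 1 - u + u) s r + mpow n b (l - 1 - u + u) r s) / 2"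
      using rs by (simp only: mpow_add sum.distrib sum_divide_distrib[symmetric])
    also have "l - 1 - u + u = l - 1" using u by auto
    also have "mpow n b (l - 1) s r = mpow n b (l - 1) r s" by (rule mpow_sym) fact+
    finally show "(\<Sum>i<n. (mpow n b (l - 1 - u) s i * mpow n b u i r + mpow n b (l - 1 - u) r i * mpow n b u i s) / 2)
      = mpow n b (l - 1) r s" by simp
  qed
  finally show ?thesis by simp
qed

lemma DERIV_trp:
  assumes rs: "r < n" "s < n"
  shows "((\<lambda>y. trp n (b((r, s) := y)) l) has_real_derivative real l * mpow n (b((r, s) := y)) (l - 1) r s) (at y)"
  unfolding trp_def sum_dmpow_diag[OF rs, symmetric] by (intro DERIV_sum DERIV_mpow rs)

text \<open>Of the two halves of the symmetrised insertion, one splits the trace into a product of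
  two traces, and the other, with its indices exchanged, closes up to the single trace of
  M^(k-1).\<close>

lemma sum_dmpow:
  "(\<Sum>r<n. \<Sum>s<n. dmpow n b r s k r s) = (real k * trp n b (k - 1) + (\<Sum>u<k. trp n b u * trp n b (k - 1 - u))) / 2"
proof -
  have "(\<Sum>r<n. \<Sum>s<n. dmpow n b r s k r s) =
     (\<Sum>u<k. \<Sum>r<n. \<Sum>s<n. (mpow n b u r r * mpow n b (k - 1 - u) s s + mpow n b u r s * mpow n b (k - 1 - u) r s) / 2)"
    unfolding dmpow_def sum.swap[of _ "{..<k}"] by (rule refl)
  also have "\<dots> = (\<Sum>u<k. (trp n b u * trp n b (k - 1 - u) + trp n b (u + (k - 1 - u))) / 2)"
    unfolding trp_add by (simp add: trp_def sum_product sum.distrib sum_divide_distrib[symmetric])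
  also have "\<dots> = (\<Sum>u<k. (trp n b u * trp n b (k - 1 - u) + trp n b (k - 1)) / 2)"
    by (intro sum.cong) auto
  also have "\<dots> = (real k * trp n b (k - 1) + (\<Sum>u<k. trp n b u * trp n b (k - 1 - u))) / 2"
    by (simp add: sum.distrib sum_divide_distrib[symmetric])
  finally show ?thesis .
qed

abbreviation sq :: "nat \<Rightarrow> (nat \<times> nat) set" where "sq n \<equiv> {..<n} \<times> {..<n}"

lemma exp_bdd_mpow:
  assumes "i < n" "j < n" shows "exp_bdd (sq n) (\<lambda>b. mpow n b k i j)"
  using assms
proof (induction k arbitrary: i)
  case (Suc k)
  then show ?case unfolding mpow.simps symm_def by (intro exp_bdd_intros) auto
qed (simp add: exp_bdd_const)

lemma exp_bdd_trp: "exp_bdd (sq n) (\<lambda>b. trp n b k)"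
  unfolding trp_def by (intro exp_bdd_intros exp_bdd_mpow) auto

lemma borel_mpow:
  assumes "i < n" "j < n" shows "(\<lambda>b. mpow n b k i j) \<in> borel_measurable (borelN (sq n))"
  using assms
proof (induction k arbitrary: i)
  case (Suc k)
  have "(\<lambda>b. b p) \<in> borel_measurable (borelN (sq n))" if "p \<in> sq n" for p
    using that by (rule measurable_component_singleton)
  then show ?case unfolding mpow.simps symm_def
    using Suc by (intro borel_measurable_sum borel_measurable_times borel_measurable_divide borel_measurable_add) auto
qed simp

lemma borel_trp [measurable]: "(\<lambda>b. trp n b k) \<in> borel_measurable (borelN (sq n))"
  unfolding trp_def by (intro borel_measurable_sum borel_mpow) auto

text \<open>Here the field is M^k times the product of traces and the damping. The divergence of
  M^k, computed in \<open>sum_dmpow\<close>, supplies what \<open>x i ^ k\<close> and the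
  Vandermonde weight gave together in \<open>eigenvalue_loop\<close>.\<close>

theorem matrix_loop:
  fixes n k :: nat
  assumes t: "t \<ge> 0"
  defines "w \<equiv> \<lambda>b. exp (- t * trp n b 2)"
  shows "(1 + 2 * t) * (\<integral>b. w b * PL (trp n b) (Suc k # ls) \<partial>gaussN (sq n)) =
    (\<integral>b. w b * loop_rhs (trp n b) k ls \<partial>gaussN (sq n))"
proof -
  let ?P = "\<lambda>b. PL (trp n b) ls" and ?m = "\<lambda>k b p. mpow n b k (fst p) (snd p)"
  define d where "d p b l = real l * ?m (l - 1) b p" for p b l
  define F where "F p b = ?m k b p * ?P b * w b" for p b
  define F' where "F' p b = dmpow n b (fst p) (snd p) k (fst p) (snd p) * ?P b * w b
       + ?m k b p * pderL (trp n b) (d p b) ls * w b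
       + ?m k b p * ?P b * (- t * (2 * ?m 1 b p) * w b)" for p b
  have trp_add': "(\<Sum>p\<in>sq n. ?m a b p * ?m c b p) = trp n b (a + c)" for a c b
    by (simp add: trp_add sum.cartesian_product case_prod_beta)
  have sF: "(\<Sum>p\<in>sq n. b p * F p b) = w b * PL (trp n b) (Suc k # ls)" for b
    unfolding F_def PL_simps trp_Suc
    by (simp add: sum_distrib_left sum_distrib_right sum.cartesian_product case_prod_beta mult_ac)
  have sF': "(\<Sum>p\<in>sq n. F' p b) = w b * loop_rhs (trp n b) k ls
      - 2 * t * (w b * PL (trp n b) (Suc k # ls))" for b
  proof -
    have 1: "(\<Sum>p\<in>sq n. dmpow n b (fst p) (snd p) k (fst p) (snd p) * ?P b * w b) =
       (real k * trp n b (k - 1) + (\<Sum>u<k. trp n b u * trp n b (k - 1 - u))) / 2 * ?P b * w b"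
      unfolding sum_dmpow[symmetric] by (simp add: sum_distrib_right sum.cartesian_product case_prod_beta)
    have "(\<Sum>p\<in>sq n. ?m k b p * pderL (trp n b) (d p b) ls) = pderL (trp n b) (\<lambda>l. real l * trp n b (k + l - 1)) ls"
      unfolding pderL_sum
    proof (rule pderL_cong)
      show "(\<Sum>p\<in>sq n. ?m k b p * d p b l) = real l * trp n b (k + l - 1)" for l
        using trp_add'[where a = k and b = b and c = "l - 1"] by (cases l) (simp_all add: d_def sum_distrib_left[symmetric] mult.left_commute)
    qed
    then have 2: "(\<Sum>p\<in>sq n. ?m k b p * pderL (trp n b) (d p b) ls * w b) =
        pderL (trp n b) (\<lambda>l. real l * trp n b (k + l - 1)) ls * w b"
      by (simp add: sum_distrib_right[symmetric])
    have 3: "(\<Sum>p\<in>sq n. ?m k b p * ?P b * (- t * (2 * ?m 1 b p) * w b)) =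
        - 2 * t * (w b * PL (trp n b) (Suc k # ls))"
      using trp_add'[where a = k and b = b and c = 1, symmetric] unfolding PL_simps
      by (simp add: sum_distrib_left sum_distrib_right mult_ac sum_negf del: mpow.simps)
    show ?thesis
      unfolding F'_def sum.distrib 1 2 3 loop_rhs_def by (simp add: algebra_simps)
  qed
  note eb = exp_bdd_trp exp_bdd_mpow exp_bdd_PL exp_bdd_pderL
    exp_bdd_exp_neg[OF t trp_2_nonneg] exp_bdd_intros
  note bm = borel_measurable_times borel_measurable_add borel_measurable_PL borel_measurable_pderL
    borel_trp borel_mpow borel_measurable_const borel_measurable_sum borel_measurable_divide
  have bw: "w \<in> borel_measurable (borelN (sq n))" unfolding w_def by measurable
  have "integrable (gaussN (sq n)) (\<lambda>b. \<Sum>p\<in>sq n. b p * F p b) \<and> integrable (gaussN (sq n)) (\<lambda>b. \<Sum>p\<in>sq n. F' p b) \<and>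
      (\<integral>b. (\<Sum>p\<in>sq n. b p * F p b) \<partial>gaussN (sq n)) = (\<integral>b. (\<Sum>p\<in>sq n. F' p b) \<partial>gaussN (sq n))"
  proof (rule gaussN_divergence)
    fix p and b :: "nat \<times> nat \<Rightarrow> real" assume p: "p \<in> sq n"
    then have rs: "fst p < n" "snd p < n" by auto
    show "exp_bdd (sq n) (F p)" "exp_bdd (sq n) (F' p)"
      unfolding F_def F'_def w_def d_def dmpow_def by (intro eb rs)+
    show "F p \<in> borel_measurable (borelN (sq n))" "F' p \<in> borel_measurable (borelN (sq n))"
      unfolding F_def F'_def d_def dmpow_def by (intro bm bw rs)+
    let ?u = "\<lambda>y :: real. b(p := y)"
    have Dm: "((\<lambda>y. ?m k (?u y) p) has_real_derivative dmpow n (?u y) (fst p) (snd p) k (fst p) (snd p)) (at y)" for y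
      using DERIV_mpow[OF rs] by simp
    have Dp: "((\<lambda>y. trp n (?u y) l) has_real_derivative d p (?u y) l) (at y)" for l y
      using DERIV_trp[OF rs] by (simp add: d_def)
    have DPL: "((\<lambda>y. ?P (?u y)) has_real_derivative pderL (trp n (?u y)) (d p (?u y)) ls) (at y)" for y
      by (rule DERIV_PL) (rule Dp)
    have Dw: "((\<lambda>y. w (?u y)) has_real_derivative - t * (2 * ?m 1 (?u y) p) * w (?u y)) (at y)" for y
      unfolding w_def using Dp[of 2 y] by (auto intro!: derivative_eq_intros simp: d_def)
    have D: "((\<lambda>y. F p (?u y)) has_real_derivative F' p (?u y)) (at y)" for y
      unfolding F_def F'_def
      by (rule DERIV_cong[OF DERIV_mult[OF DERIV_mult[OF Dm DPL] Dw]])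
        (simp only: ring_distribs mult_ac add_ac)
    then show "continuous_on UNIV (\<lambda>y. F p (?u y))"
      by (auto intro: DERIV_isCont continuous_at_imp_continuous_on)
    show "\<exists>T. finite T \<and> (\<forall>y. y \<notin> T \<longrightarrow> ((\<lambda>y. F p (?u y)) has_real_derivative F' p (?u y)) (at y))"
      using D by blast
  qed auto
  then have iF: "integrable (gaussN (sq n)) (\<lambda>b. w b * PL (trp n b) (Suc k # ls))"
    and iF': "integrable (gaussN (sq n)) (\<lambda>b. w b * loop_rhs (trp n b) k ls - 2 * t * (w b * PL (trp n b) (Suc k # ls)))"
    and eq: "(\<integral>b. w b * PL (trp n b) (Suc k # ls) \<partial>gaussN (sq n)) =
      (\<integral>b. w b * loop_rhs (trp n b) k ls - 2 * t * (w b * PL (trp n b) (Suc k # ls)) \<partial>gaussN (sq n))"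
    unfolding sF sF' by blast+
  have "integrable (gaussN (sq n)) (\<lambda>b. w b * loop_rhs (trp n b) k ls)"
    using Bochner_Integration.integrable_add[OF iF' integrable_mult_right[OF iF, of "2 * t"]] by simp
  then show ?thesis using eq iF by (simp add: distrib_right del: PL_simps)
qed

section \<open>Comparison of spectral models\<close>

lemma pderL_euler: "pderL \<tau> (\<lambda>l. real l * \<tau> l) ls = real (sum_list ls) * PL \<tau> ls"
  by (induction ls) (simp_all add: algebra_simps)

lemma exp_minus_lipschitz:
  fixes x y :: real
  assumes "x \<ge> 0" "y \<ge> 0" shows "\<bar>exp (- x) - exp (- y)\<bar> \<le> \<bar>x - y\<bar>"
  using assms
proof (induction x y rule: linorder_wlog)
  case (le x y)
  have "exp (- x) - exp (- y) = exp (- x) * (1 - exp (x - y))"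
    by (simp add: right_diff_distrib exp_add[symmetric])
  also have "\<dots> \<le> 1 * (y - x)"
  proof (rule mult_mono)
    show "1 - exp (x - y) \<le> y - x" using exp_ge_add_one_self[of "x - y"] by linarith
  qed (use le in auto)
  finally show ?case using le by simp
qed (simp add: abs_minus_commute)

text \<open>A Taylor remainder that dominates the difference quotient of \<open>lap\<close>. The
  point is the inequality exp u - 1 - u \<le> u * (exp u - 1), whose right side is controlled by the
  Lipschitz bound for either sign of u.\<close>

lemma exp_second_order_bound:
  fixes Y s t :: real
  assumes "Y \<ge> 0" "s \<ge> 0" "t \<ge> 0"
  shows "\<bar>exp (- s * Y) - exp (- t * Y) + (s - t) * (Y * exp (- t * Y))\<bar> \<le> (s - t)\<^sup>2 * Y\<^sup>2"
proof -
  define u where "u = (t - s) * Y"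
  have s: "exp (- s * Y) = exp (- t * Y) * exp u" by (simp add: u_def exp_add[symmetric] algebra_simps)
  have "(1 - u) * exp u \<le> exp (- u) * exp u"
    using exp_ge_add_one_self[of "- u"] by (intro mult_right_mono) auto
  then have "exp u - 1 - u \<le> u * (exp u - 1)" by (simp add: exp_minus field_simps)
  then have "exp (- t * Y) * (exp u - 1 - u) \<le> exp (- t * Y) * (u * (exp u - 1))"
    by (intro mult_left_mono) auto
  also have "\<dots> = u * (exp (- (s * Y)) - exp (- (t * Y)))" using s by (simp add: algebra_simps)
  also have "\<dots> \<le> \<bar>u\<bar> * \<bar>exp (- (s * Y)) - exp (- (t * Y))\<bar>"
    unfolding abs_mult[symmetric] by (rule abs_ge_self)
  also have "\<dots> \<le> \<bar>u\<bar> * \<bar>s * Y - t * Y\<bar>"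
    using assms by (intro mult_left_mono exp_minus_lipschitz) auto
  also have "\<dots> = (s - t)\<^sup>2 * Y\<^sup>2"
  proof -
    have "s * Y - t * Y = - u" by (simp add: u_def algebra_simps)
    then have "\<bar>u\<bar> * \<bar>s * Y - t * Y\<bar> = u\<^sup>2" by (simp add: power2_eq_square)
    then show ?thesis by (simp add: u_def power_mult_distrib power2_commute)
  qed
  finally have "exp (- t * Y) * (exp u - 1 - u) \<le> (s - t)\<^sup>2 * Y\<^sup>2" .
  moreover have "exp u - 1 - u \<ge> 0" using exp_ge_add_one_self[of u] by linarith
  then have "exp (- t * Y) * (exp u - 1 - u) \<ge> 0" by simp
  moreover have "exp (- s * Y) - exp (- t * Y) + (s - t) * (Y * exp (- t * Y)) = exp (- t * Y) * (exp u - 1 - u)"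
    unfolding s by (simp add: u_def algebra_simps)
  ultimately show ?thesis by linarith
qed

text \<open>What the two models share. Through \<open>roots\<close> every value of
  \<open>\<tau>\<close> is a sequence of power sums of \<open>n\<close> real numbers, so that sign
  conditions on the spectrum can be stated in terms of \<open>\<tau>\<close> alone.\<close>

locale spectral_model =
  fixes \<mu> :: "'a measure" and D :: "'a \<Rightarrow> real" and \<tau> :: "'a \<Rightarrow> nat \<Rightarrow> real" and n :: nat
  assumes D_nonneg: "\<And>x. D x \<ge> 0"
    and D_meas [measurable]: "D \<in> borel_measurable \<mu>"
    and \<tau>_meas [measurable]: "\<And>k. (\<lambda>x. \<tau> x k) \<in> borel_measurable \<mu>"
    and PL_integrable: "\<And>ls. integrable \<mu> (\<lambda>x. PL (\<tau> x) ls * D x)"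
    and D_norm: "(\<integral>x. D x \<partial>\<mu>) = 1"
    and roots: "\<And>x. \<exists>\<theta>. \<tau> x = psum n \<theta>"
    and loop: "\<And>t k ls. t \<ge> 0 \<Longrightarrow>
      (1 + 2 * t) * (\<integral>x. exp (- t * \<tau> x 2) * PL (\<tau> x) (Suc k # ls) * D x \<partial>\<mu>) =
      (\<integral>x. exp (- t * \<tau> x 2) * loop_rhs (\<tau> x) k ls * D x \<partial>\<mu>)"
begin

lemma \<tau>_0: "\<tau> x 0 = real n"
  using roots[of x] by (auto simp: psum_def)

lemma \<tau>_2_nonneg: "\<tau> x 2 \<ge> 0"
  using roots[of x] psum_2_nonneg by auto

section \<open>Laplace transforms of mixed moments in the variable \<open>\<tau> x 2\<close>\<close>

definition lap :: "nat list \<Rightarrow> real \<Rightarrow> real" where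
  "lap ls t = (\<integral>x. exp (- t * \<tau> x 2) * PL (\<tau> x) ls * D x \<partial>\<mu>)"

lemma lap_integrable:
  assumes "t \<ge> 0" shows "integrable \<mu> (\<lambda>x. exp (- t * \<tau> x 2) * PL (\<tau> x) ls * D x)"
proof (rule Bochner_Integration.integrable_bound[OF PL_integrable])
  have "exp (- t * \<tau> x 2) * (\<bar>PL (\<tau> x) ls\<bar> * \<bar>D x\<bar>) \<le> 1 * (\<bar>PL (\<tau> x) ls\<bar> * \<bar>D x\<bar>)" for x
    using assms \<tau>_2_nonneg[of x] by (intro mult_right_mono) auto
  then show "AE x in \<mu>. norm (exp (- t * \<tau> x 2) * PL (\<tau> x) ls * D x) \<le> norm (PL (\<tau> x) ls * D x)"
    by (intro AE_I2) (simp add: abs_mult mult.assoc)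
qed measurable

text \<open>The case \<open>k = 1\<close> of the loop equations closes up because \<open>pderL\<close> becomes Euler's operator;
  \<open>(n + n * n) / 2\<close> is the dimension of the space of symmetric matrices.\<close>

lemma lap_rec:
  assumes "t \<ge> 0"
  shows "(1 + 2 * t) * lap (2 # ls) t = ((real n + real n * real n) / 2 + real (sum_list ls)) * lap ls t"
proof -
  have "loop_rhs (\<tau> x) 1 ls = ((real n + real n * real n) / 2 + real (sum_list ls)) * PL (\<tau> x) ls" for x
    by (simp add: loop_rhs_def \<tau>_0 pderL_euler distrib_right)
  then have "exp (- t * \<tau> x 2) * loop_rhs (\<tau> x) 1 ls * D x =
     ((real n + real n * real n) / 2 + real (sum_list ls)) * (exp (- t * \<tau> x 2) * PL (\<tau> x) ls * D x)" for x
    by (simp only: mult_ac)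
  then show ?thesis
    using loop[OF assms, of 1 ls] unfolding lap_def
    by (simp only: numeral_2_eq_2[symmetric] One_nat_def[symmetric] Suc_1 integral_mult_right_zero)
qed

text \<open>Differentiation under the integral: the error of the difference quotient is at most
  \<open>\<bar>y - t\<bar>\<close> times an absolute moment with two more factors
  \<open>\<tau> x 2\<close>.\<close>

lemma DERIV_lap:
  assumes t: "t \<ge> 0"
  shows "(lap ls has_real_derivative - lap (2 # ls) t) (at t within {0..})"
proof -
  define K where "K = (\<integral>x. \<bar>PL (\<tau> x) (2 # 2 # ls) * D x\<bar> \<partial>\<mu>)"
  have "((\<lambda>y. (lap ls y - lap ls t) / (y - t) - - lap (2 # ls) t) \<longlongrightarrow> 0) (at t within {0..})"
  proof (rule Lim_null_comparison)
    show "((\<lambda>y. K * \<bar>y - t\<bar>) \<longlongrightarrow> 0) (at t within {0..})"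
      by (auto intro!: tendsto_eq_intros)
    have "norm ((lap ls y - lap ls t) / (y - t) - - lap (2 # ls) t) \<le> K * \<bar>y - t\<bar>" if y: "y \<ge> 0" "y \<noteq> t" for y
    proof -
      let ?g = "\<lambda>x. exp (- y * \<tau> x 2) * PL (\<tau> x) ls * D x - exp (- t * \<tau> x 2) * PL (\<tau> x) ls * D x
         + (y - t) * (exp (- t * \<tau> x 2) * PL (\<tau> x) (2 # ls) * D x)"
      have ig: "integrable \<mu> ?g" using y t by (intro Bochner_Integration.integrable_add
          Bochner_Integration.integrable_diff integrable_mult_right lap_integrable)
      have e: "lap ls y - lap ls t + (y - t) * lap (2 # ls) t = (\<integral>x. ?g x \<partial>\<mu>)"
        unfolding lap_def using lap_integrable[OF t, of ls] lap_integrable[OF y(1), of ls] lap_integrable[OF t, of "2 # ls"]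
        by simp
      have "\<bar>\<integral>x. ?g x \<partial>\<mu>\<bar> \<le> (\<integral>x. (y - t)\<^sup>2 * \<bar>PL (\<tau> x) (2 # 2 # ls) * D x\<bar> \<partial>\<mu>)"
      proof (rule order_trans[OF integral_abs_bound], rule integral_mono)
        show "integrable \<mu> (\<lambda>x. \<bar>?g x\<bar>)" using ig by simp
        show "integrable \<mu> (\<lambda>x. (y - t)\<^sup>2 * \<bar>PL (\<tau> x) (2 # 2 # ls) * D x\<bar>)"
          by (intro integrable_mult_right integrable_abs PL_integrable)
        fix x
        have "?g x = (exp (- y * \<tau> x 2) - exp (- t * \<tau> x 2) + (y - t) * (\<tau> x 2 * exp (- t * \<tau> x 2))) * (PL (\<tau> x) ls * D x)"
          by (simp add: algebra_simps)
        then have "\<bar>?g x\<bar> = \<bar>exp (- y * \<tau> x 2) - exp (- t * \<tau> x 2) + (y - t) * (\<tau> x 2 * exp (- t * \<tau> x 2))\<bar> * \<bar>PL (\<tau> x) ls * D x\<bar>"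
          by (simp only: abs_mult)
        also have "\<dots> \<le> ((y - t)\<^sup>2 * (\<tau> x 2)\<^sup>2) * \<bar>PL (\<tau> x) ls * D x\<bar>"
          by (intro mult_right_mono exp_second_order_bound \<tau>_2_nonneg y t) auto
        also have "\<dots> = (y - t)\<^sup>2 * \<bar>PL (\<tau> x) (2 # 2 # ls) * D x\<bar>"
          using \<tau>_2_nonneg[of x] by (simp add: abs_mult power2_eq_square mult_ac)
        finally show "\<bar>?g x\<bar> \<le> (y - t)\<^sup>2 * \<bar>PL (\<tau> x) (2 # 2 # ls) * D x\<bar>" .
      qed
      then have "\<bar>lap ls y - lap ls t + (y - t) * lap (2 # ls) t\<bar> \<le> K * \<bar>y - t\<bar> * \<bar>y - t\<bar>"
        unfolding e K_def by (simp add: power2_eq_square mult_ac)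
      moreover have "(lap ls y - lap ls t) / (y - t) - - lap (2 # ls) t =
          (lap ls y - lap ls t + (y - t) * lap (2 # ls) t) / (y - t)"
        using y by (simp add: field_simps)
      ultimately show ?thesis using y by (simp add: pos_divide_le_eq)
    qed
    then show "\<forall>\<^sub>F y in at t within {0..}. norm ((lap ls y - lap ls t) / (y - t) - - lap (2 # ls) t) \<le> K * \<bar>y - t\<bar>"
      by (auto simp: eventually_at_filter)
  qed
  from LIM_zero_cancel[OF this] show ?thesis by (simp add: has_field_derivative_iff)
qed

text \<open>By \<open>lap_rec\<close> and \<open>DERIV_lap\<close> the transform solves (1 + 2t) y'
  = - c y, and multiplying by (1 + 2t)^(c/2) makes it constant. The exponent depends only on
  \<open>n\<close> and \<open>ls\<close>, hence is the same in every model.\<close>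

lemma lap_eq:
  assumes t: "t \<ge> 0"
  shows "lap ls t = lap ls 0 * (1 + 2 * t) powr (- ((real n + real n * real n) / 2 + real (sum_list ls)) / 2)"
proof -
  define c where "c = (real n + real n * real n) / 2 + real (sum_list ls)"
  have "\<exists>k. \<forall>s\<in>{0..}. lap ls s * (1 + 2 * s) powr (c / 2) = k"
  proof (rule has_derivative_zero_constant)
    fix s :: real assume "s \<in> {0..}"
    then have s: "s \<ge> 0" by simp
    have p: "((\<lambda>s. (1 + 2 * s) powr (c / 2)) has_real_derivative c * (1 + 2 * s) powr (c / 2 - 1)) (at s within {0..})"
      using s by (auto intro!: derivative_eq_intros)
    have "((\<lambda>s. lap ls s * (1 + 2 * s) powr (c / 2)) has_real_derivative
       - lap (2 # ls) s * (1 + 2 * s) powr (c / 2) + c * (1 + 2 * s) powr (c / 2 - 1) * lap ls s) (at s within {0..})"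
      by (rule DERIV_mult[OF DERIV_lap[OF s] p])
    also have "- lap (2 # ls) s * (1 + 2 * s) powr (c / 2) + c * (1 + 2 * s) powr (c / 2 - 1) * lap ls s =
       (1 + 2 * s) powr (c / 2 - 1) * (c * lap ls s - (1 + 2 * s) * lap (2 # ls) s)"
    proof -
      have "(1 + 2 * s) powr (c / 2) = (1 + 2 * s) powr (c / 2 - 1) * (1 + 2 * s)"
        using s powr_add[of "1 + 2 * s" "c / 2 - 1" 1] by simp
      then show ?thesis by (simp only: right_diff_distrib mult_ac)
    qed
    also have "\<dots> = 0" using lap_rec[OF s, of ls] by (simp add: c_def)
    finally show "((\<lambda>s. lap ls s * (1 + 2 * s) powr (c / 2)) has_derivative (\<lambda>h. 0)) (at s within {0..})"
      by (simp add: has_field_derivative_def lambda_zero)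
  qed (simp add: convex_real_interval)
  then obtain k where k: "\<And>s. s \<ge> 0 \<Longrightarrow> lap ls s * (1 + 2 * s) powr (c / 2) = k" by auto
  have "lap ls t * (1 + 2 * t) powr (c / 2) = lap ls 0"
    using k[of 0] k[OF t] by simp
  then show ?thesis unfolding c_def[symmetric] using t
    by (simp add: powr_minus field_simps)
qed

end

text \<open>Power sums of the numbers obtained by multiplying every eigenvalue by
  \<open>exp (- \<tau> 2)\<close>. By \<open>PL_damp\<close> the damping of a product is governed by
  its total degree.\<close>

definition damp :: "(nat \<Rightarrow> real) \<Rightarrow> nat \<Rightarrow> real" where
  "damp \<tau> k = \<tau> k * exp (- real k * \<tau> 2)"

lemma PL_damp: "PL (damp \<tau>) ls = exp (- real (sum_list ls) * \<tau> 2) * PL \<tau> ls"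
proof (induction ls)
  case (Cons l ls)
  have "exp (- real (sum_list (l # ls)) * \<tau> 2) = exp (- real l * \<tau> 2) * exp (- real (sum_list ls) * \<tau> 2)"
    by (simp add: exp_add[symmetric] algebra_simps)
  then have "damp \<tau> l * (exp (- real (sum_list ls) * \<tau> 2) * PL \<tau> ls) =
      exp (- real (sum_list (l # ls)) * \<tau> 2) * (\<tau> l * PL \<tau> ls)"
    unfolding damp_def by (simp only: mult_ac)
  then show ?case unfolding PL_simps Cons .
qed simp

section \<open>Equality of the moments of two models\<close>

locale two_spectral_models =
  M1: spectral_model \<mu>1 D1 \<tau>1 n + M2: spectral_model \<mu>2 D2 \<tau>2 n
  for \<mu>1 :: "'a measure" and D1 \<tau>1 and \<mu>2 :: "'b measure" and D2 \<tau>2 and n :: nat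
begin

definition agree :: "((nat \<Rightarrow> real) \<Rightarrow> real) \<Rightarrow> bool" where
  "agree F \<longleftrightarrow> integrable \<mu>1 (\<lambda>x. F (\<tau>1 x) * D1 x) \<and> integrable \<mu>2 (\<lambda>x. F (\<tau>2 x) * D2 x) \<and>
     (\<integral>x. F (\<tau>1 x) * D1 x \<partial>\<mu>1) = (\<integral>x. F (\<tau>2 x) * D2 x \<partial>\<mu>2)"

lemma agree_add: "agree F \<Longrightarrow> agree G \<Longrightarrow> agree (\<lambda>\<tau>. F \<tau> + G \<tau>)"
  by (simp add: agree_def distrib_right)

lemma agree_cmult: "agree F \<Longrightarrow> agree (\<lambda>\<tau>. c * F \<tau>)"
  by (simp add: agree_def mult.assoc)

lemma agree_0: "agree (\<lambda>\<tau>. 0)"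
  by (simp add: agree_def)

lemma agree_diff: "agree F \<Longrightarrow> agree G \<Longrightarrow> agree (\<lambda>\<tau>. F \<tau> - G \<tau>)"
  by (simp add: agree_def left_diff_distrib)

lemma agree_sum: "(\<And>a. a \<in> A \<Longrightarrow> agree (F a)) \<Longrightarrow> agree (\<lambda>\<tau>. \<Sum>a\<in>A. F a \<tau>)"
  by (induction A rule: infinite_finite_induct) (auto intro: agree_add agree_0)

text \<open>Leibniz expansion in which the factors already passed are collected in
  \<open>as\<close>, so that every term is again a plain product of weight below
  \<open>N\<close>.\<close>

lemma agree_pderL:
  assumes "\<And>ms. sum_list ms + length ms < N \<Longrightarrow> agree (\<lambda>\<tau>. PL \<tau> ms)"
    and "sum_list as + length as + sum_list ls + length ls + k < N"
  shows "agree (\<lambda>\<tau>. PL \<tau> as * pderL \<tau> (\<lambda>l. real l * \<tau> (k + l - 1)) ls)"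
  using assms(2)
proof (induction ls arbitrary: as)
  case Nil
  then show ?case by (simp add: agree_0)
next
  case (Cons l ls)
  have "agree (\<lambda>\<tau>. real l * PL \<tau> (as @ (k + l - 1) # ls))"
    by (intro agree_cmult assms(1)) (use Cons.prems in auto)
  moreover have "agree (\<lambda>\<tau>. PL \<tau> (l # as) * pderL \<tau> (\<lambda>l. real l * \<tau> (k + l - 1)) ls)"
    by (rule Cons.IH) (use Cons.prems in auto)
  ultimately show ?case
    using agree_add by (fastforce simp: algebra_simps)
qed

text \<open>The loop equation at \<open>t = 0\<close> trades the factor \<open>Suc k\<close> for at
  most two factors of total degree \<open>k - 1\<close>, or raises another factor by
  \<open>k - 1\<close>. The sum of the list plus its length drops in every term, also when a factor
  of degree 0 is removed.\<close>

lemma agree_PL: "agree (\<lambda>\<tau>. PL \<tau> ls)"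
proof (induction "sum_list ls + length ls" arbitrary: ls rule: less_induct)
  case less
  note IH = less
  show ?case
  proof (cases ls)
    case Nil
    then show ?thesis
      using M1.PL_integrable[of "[]"] M2.PL_integrable[of "[]"] by (simp add: agree_def M1.D_norm M2.D_norm)
  next
    case (Cons l ms)
    show ?thesis
    proof (cases l)
      case 0
      have "agree (\<lambda>\<tau>. real n * PL \<tau> ms)" by (intro agree_cmult IH) (simp add: Cons)
      then show ?thesis by (simp add: agree_def Cons 0 M1.\<tau>_0 M2.\<tau>_0)
    next
      case (Suc k)
      let ?N = "sum_list ls + length ls"
      have small: "agree (\<lambda>\<tau>. PL \<tau> as)" if "sum_list as + length as < ?N" for as
        by (rule IH) (use that in auto)
      have "agree (\<lambda>\<tau>. real k / 2 * PL \<tau> ((k - 1) # ms))"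
        by (intro agree_cmult small) (auto simp: Cons Suc)
      moreover have "agree (\<lambda>\<tau>. 1 / 2 * (\<Sum>u<k. PL \<tau> (u # (k - 1 - u) # ms)))"
        by (intro agree_cmult agree_sum small) (auto simp: Cons Suc)
      moreover have "agree (\<lambda>\<tau>. PL \<tau> [] * pderL \<tau> (\<lambda>l. real l * \<tau> (k + l - 1)) ms)"
        by (rule agree_pderL[of ?N, OF small]) (auto simp: Cons Suc)
      ultimately have "agree (\<lambda>\<tau>. real k / 2 * PL \<tau> ((k - 1) # ms) + 1 / 2 * (\<Sum>u<k. PL \<tau> (u # (k - 1 - u) # ms))
          + PL \<tau> [] * pderL \<tau> (\<lambda>l. real l * \<tau> (k + l - 1)) ms)"
        by (intro agree_add)
      also have "(\<lambda>\<tau>. real k / 2 * PL \<tau> ((k - 1) # ms) + 1 / 2 * (\<Sum>u<k. PL \<tau> (u # (k - 1 - u) # ms))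
          + PL \<tau> [] * pderL \<tau> (\<lambda>l. real l * \<tau> (k + l - 1)) ms) = (\<lambda>\<tau>. loop_rhs \<tau> k ms)"
        by (simp add: loop_rhs_def fun_eq_iff distrib_right add_divide_distrib sum_distrib_right sum_divide_distrib mult.assoc)
      finally have "agree (\<lambda>\<tau>. loop_rhs \<tau> k ms)" .
      then show ?thesis
        using M1.loop[of 0 k ms] M2.loop[of 0 k ms] M1.PL_integrable[of ls] M2.PL_integrable[of ls]
        unfolding agree_def by (simp add: Cons Suc)
    qed
  qed
qed

lemma agree_PL_damp: "agree (\<lambda>\<tau>. PL (damp \<tau>) ls)"
proof -
  let ?t = "real (sum_list ls)"
  have "M1.lap ls 0 = M2.lap ls 0"
    using agree_PL[of ls] by (simp add: agree_def M1.lap_def M2.lap_def)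
  then have "M1.lap ls ?t = M2.lap ls ?t"
    by (subst M1.lap_eq, simp, subst M2.lap_eq) simp_all
  then show ?thesis
    using M1.lap_integrable[of ?t ls] M2.lap_integrable[of ?t ls]
    unfolding agree_def PL_damp M1.lap_def M2.lap_def by simp
qed

text \<open>The prefix \<open>ls\<close> is there for the induction: multiplying out one factor
  appends an index to it.\<close>

lemma agree_prod_damp:
  fixes N :: nat
  assumes "finite J"
  shows "agree (\<lambda>\<tau>. PL (damp \<tau>) ls * (\<Prod>j\<in>J. 1 - c j * (\<Sum>k\<le>N. a k * damp \<tau> k)))"
  using assms
proof (induction J arbitrary: ls)
  case empty
  then show ?case by (simp add: agree_PL_damp)
next
  case (insert j J)
  define R where "R \<tau> = (\<Prod>j\<in>J. 1 - c j * (\<Sum>k\<le>N. a k * damp \<tau> k))" for \<tau>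
  have "agree (\<lambda>\<tau>. PL (damp \<tau>) ls * R \<tau> - c j * (\<Sum>k\<le>N. a k * (PL (damp \<tau>) (k # ls) * R \<tau>)))"
    unfolding R_def by (intro agree_diff agree_cmult agree_sum insert.IH)
  also have "(\<lambda>\<tau>. PL (damp \<tau>) ls * R \<tau> - c j * (\<Sum>k\<le>N. a k * (PL (damp \<tau>) (k # ls) * R \<tau>))) =
     (\<lambda>\<tau>. PL (damp \<tau>) ls * (\<Prod>j\<in>insert j J. 1 - c j * (\<Sum>k\<le>N. a k * damp \<tau> k)))"
  proof
    fix \<tau> :: "nat \<Rightarrow> real"
    have "(\<Prod>j\<in>insert j J. 1 - c j * (\<Sum>k\<le>N. a k * damp \<tau> k)) = (1 - c j * (\<Sum>k\<le>N. a k * damp \<tau> k)) * R \<tau>"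
      using insert.hyps by (simp add: R_def)
    moreover have "(\<Sum>k\<le>N. a k * (PL (damp \<tau>) (k # ls) * R \<tau>)) = (\<Sum>k\<le>N. a k * damp \<tau> k) * (PL (damp \<tau>) ls * R \<tau>)"
      by (simp only: sum_distrib_right sum_distrib_left PL_simps mult_ac)
    ultimately show "PL (damp \<tau>) ls * R \<tau> - c j * (\<Sum>k\<le>N. a k * (PL (damp \<tau>) (k # ls) * R \<tau>)) =
      PL (damp \<tau>) ls * (\<Prod>j\<in>insert j J. 1 - c j * (\<Sum>k\<le>N. a k * damp \<tau> k))"
      by (simp only: ring_distribs mult_ac mult_1_left mult_1_right)
  qed
  finally show ?case .
qed

end

text \<open>A predicate on the power sums, so that it applies to both models. By
  \<open>spec_sign_psum\<close> the choice of \<open>\<theta>\<close> is immaterial.\<close>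

definition spec_sign :: "nat \<Rightarrow> real \<Rightarrow> (nat \<Rightarrow> real) \<Rightarrow> bool" where
  "spec_sign n s \<tau> \<longleftrightarrow> (\<exists>\<theta>. \<tau> = psum n \<theta> \<and> (\<forall>i<n. s * \<theta> i > 0))"

text \<open>The functions \<open>g m\<close> are 1 where \<open>s * x\<close> is nonpositive and
  then fall to 0 with slope \<open>m\<close>, so they converge to the step. Each is replaced by a
  Weierstrass polynomial with an error that tends to 0.\<close>

lemma step_approximation:
  "\<exists>(N :: nat \<Rightarrow> nat) a. (\<forall>m. \<forall>x\<in>{-1..1}. \<bar>\<Sum>k\<le>N m. a m k * x ^ k\<bar> \<le> 2) \<and>
     (\<forall>x\<in>{-1..1::real}. (\<lambda>m. \<Sum>k\<le>N m. a m k * x ^ k) \<longlonglongrightarrow> of_bool (s * x \<le> 0))"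
proof -
  define g where "g m x = max 0 (1 - real m * max 0 (s * x))" for m :: nat and x :: real
  have "\<exists>N a. \<forall>x\<in>{-1..1}. \<bar>g m x - (\<Sum>k\<le>N. a k * x ^ k)\<bar> < 1 / real (Suc m)" for m
  proof -
    have "continuous_on {-1..1} (g m)"
      unfolding g_def by (intro continuous_intros)
    note cont = this
    obtain p where p: "real_polynomial_function p" and b: "\<And>x. x \<in> {-1..1} \<Longrightarrow> \<bar>g m x - p x\<bar> < 1 / real (Suc m)"
      by (rule Stone_Weierstrass_real_polynomial_function[OF compact_Icc cont, of "1 / real (Suc m)"]) auto
    from p obtain a N where "p = (\<lambda>x. \<Sum>i\<le>N. a i * x ^ i)"
      unfolding real_polynomial_function_iff_sum by blast
    with b show ?thesis by blast
  qed
  then obtain N a where *: "\<And>m x. x \<in> {-1..1} \<Longrightarrow> \<bar>g m x - (\<Sum>k\<le>N m. a m k * x ^ k)\<bar> < 1 / real (Suc m)"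
    by metis
  have "\<bar>\<Sum>k\<le>N m. a m k * x ^ k\<bar> \<le> 2" if "x \<in> {-1..1}" for m x
  proof -
    have "\<bar>g m x\<bar> \<le> 1" by (auto simp: g_def)
    moreover have "1 / real (Suc m) \<le> 1" by simp
    ultimately show ?thesis using *[OF that, of m] by linarith
  qed
  moreover have "(\<lambda>m. \<Sum>k\<le>N m. a m k * x ^ k) \<longlonglongrightarrow> of_bool (s * x \<le> 0)" if x: "x \<in> {-1..1}" for x
  proof -
    have "(\<lambda>m. g m x) \<longlonglongrightarrow> of_bool (s * x \<le> 0)"
    proof (cases "s * x \<le> 0")
      case True
      then show ?thesis by (simp add: g_def)
    next
      case False
      have "eventually (\<lambda>m. g m x = 0) sequentially"
      proof (rule eventually_sequentiallyI[of "nat \<lceil>1 / (s * x)\<rceil>"])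
        fix m assume "nat \<lceil>1 / (s * x)\<rceil> \<le> m"
        then have "1 / (s * x) \<le> real m" by linarith
        then show "g m x = 0" using False by (simp add: g_def field_simps)
      qed
      then show ?thesis using False by (simp add: tendsto_eventually)
    qed
    moreover have "(\<lambda>m. g m x - (\<Sum>k\<le>N m. a m k * x ^ k)) \<longlonglongrightarrow> 0"
    proof (rule Lim_null_comparison)
      show "\<forall>\<^sub>F m in sequentially. norm (g m x - (\<Sum>k\<le>N m. a m k * x ^ k)) \<le> 1 / real (Suc m)"
        using *[OF x] by (auto intro!: always_eventually less_imp_le)
      show "(\<lambda>m. 1 / real (Suc m)) \<longlonglongrightarrow> 0" using LIMSEQ_inverse_real_of_nat by (simp add: divide_inverse)
    qed
    ultimately have "(\<lambda>m. g m x - (g m x - (\<Sum>k\<le>N m. a m k * x ^ k))) \<longlonglongrightarrow> of_bool (s * x \<le> 0) - 0"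
      by (rule tendsto_diff)
    then show ?thesis by simp
  qed
  ultimately show ?thesis by blast
qed

text \<open>Damping by \<^term>\<open>exp (- psum n \<theta> 2)\<close> moves the eigenvalues into \<^term>\<open>{-1..1::real}\<close> without changing
  their signs, so polynomials can approximate the number of eigenvalues that do not have sign \<open>s\<close>.\<close>

lemma spec_sign_approximation:
  fixes n :: nat and s :: real
  obtains N :: "nat \<Rightarrow> nat" and a B where
    "\<And>\<theta> m. \<bar>\<Prod>j=1..n. 1 - 1 / real j * (\<Sum>k\<le>N m. a m k * damp (psum n \<theta>) k)\<bar> \<le> B"
    "\<And>\<theta>. (\<lambda>m. \<Prod>j=1..n. 1 - 1 / real j * (\<Sum>k\<le>N m. a m k * damp (psum n \<theta>) k))
       \<longlonglongrightarrow> of_bool (spec_sign n s (psum n \<theta>))"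
    "\<And>\<theta>. spec_sign n s (psum n \<theta>) \<longleftrightarrow> (\<forall>i<n. s * \<theta> i > 0)"
proof -
  obtain N :: "nat \<Rightarrow> nat" and a where
    bd: "\<And>m x. x \<in> {-1..1} \<Longrightarrow> \<bar>\<Sum>k\<le>N m. a m k * x ^ k\<bar> \<le> 2" and
    lim: "\<And>x. x \<in> {-1..1} \<Longrightarrow> (\<lambda>m. \<Sum>k\<le>N m. a m k * x ^ k) \<longlonglongrightarrow> of_bool (s * x \<le> 0)"
    using step_approximation[of s] by blast
  define H where "H m \<theta> = (\<Sum>k\<le>N m. a m k * damp (psum n \<theta>) k)" for m \<theta>
  define e where "e \<theta> i = \<theta> i * exp (- psum n \<theta> 2)" for \<theta> :: "nat \<Rightarrow> real" and i
  have e: "e \<theta> i \<in> {-1..1}" if "i < n" for \<theta> i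
  proof -
    have "(\<theta> i)\<^sup>2 \<le> psum n \<theta> 2" unfolding psum_def using that by (intro member_le_sum) auto
    moreover have "\<bar>\<theta> i\<bar> \<le> 1 + (\<theta> i)\<^sup>2"
      using sum_squares_bound[of "\<bar>\<theta> i\<bar>" 1] zero_le_power2[of "\<theta> i"] by simp
    ultimately have "\<bar>\<theta> i\<bar> \<le> exp (psum n \<theta> 2)" using exp_ge_add_one_self[of "psum n \<theta> 2"] by linarith
    then have "\<bar>e \<theta> i\<bar> \<le> 1" unfolding e_def abs_mult by (simp add: exp_minus field_simps)
    then show ?thesis by auto
  qed
  have H: "H m \<theta> = (\<Sum>i<n. \<Sum>k\<le>N m. a m k * e \<theta> i ^ k)" for m \<theta>
  proof -
    have "damp (psum n \<theta>) k = (\<Sum>i<n. e \<theta> i ^ k)" for k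
      unfolding damp_def e_def psum_def[of n \<theta> k] power_mult_distrib sum_distrib_right
      by (simp add: exp_of_nat_mult[symmetric])
    then show ?thesis unfolding H_def by (subst sum.swap) (simp add: sum_distrib_left)
  qed
  define cnt where "cnt \<theta> = card {i. i < n \<and> s * \<theta> i \<le> 0}" for \<theta>
  have Hlim: "(\<lambda>m. H m \<theta>) \<longlonglongrightarrow> real (cnt \<theta>)" for \<theta>
  proof -
    have "(\<lambda>m. H m \<theta>) \<longlonglongrightarrow> (\<Sum>i<n. of_bool (s * e \<theta> i \<le> 0))"
      unfolding H by (intro tendsto_sum lim e) auto
    also have "(\<Sum>i<n. of_bool (s * e \<theta> i \<le> 0)) = (\<Sum>i<n. of_bool (s * \<theta> i \<le> 0) :: real)"
      by (intro sum.cong) (auto simp: e_def mult_le_0_iff zero_le_mult_iff)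
    also have "\<dots> = real (cnt \<theta>)"
      by (simp add: cnt_def of_bool_def sum.If_cases Int_def)
    finally show ?thesis .
  qed
  have Hbd: "\<bar>H m \<theta>\<bar> \<le> 2 * real n" for m \<theta>
  proof -
    have "\<bar>H m \<theta>\<bar> \<le> (\<Sum>i<n. \<bar>\<Sum>k\<le>N m. a m k * e \<theta> i ^ k\<bar>)" unfolding H by (rule sum_abs)
    also have "\<dots> \<le> (\<Sum>i<n. 2)" by (intro sum_mono bd e) auto
    finally show ?thesis by simp
  qed
  have cnt_le: "cnt \<theta> \<le> n" for \<theta>
    unfolding cnt_def using card_mono[of "{..<n}" "{i. i < n \<and> s * \<theta> i \<le> 0}"] by auto
  \<comment> \<open>The count is an integer between 0 and \<open>n\<close>, and interpolation at
    these points turns it into the indicator of 0.\<close>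
  have P: "(\<Prod>j=1..n. 1 - 1 / real j * real (cnt \<theta>)) = of_bool (cnt \<theta> = 0)" for \<theta>
  proof (cases "cnt \<theta> = 0")
    case False
    then have "cnt \<theta> \<in> {1..n}" using cnt_le by auto
    then show ?thesis using False by (auto intro!: bexI[of _ "cnt \<theta>"])
  qed simp
  have cnt_sign: "cnt \<theta> = 0 \<longleftrightarrow> spec_sign n s (psum n \<theta>)" for \<theta>
  proof
    assume "cnt \<theta> = 0"
    then have "{i. i < n \<and> s * \<theta> i \<le> 0} = {}" unfolding cnt_def by simp
    then have "\<forall>i<n. s * \<theta> i > 0" by fastforce
    then show "spec_sign n s (psum n \<theta>)" unfolding spec_sign_def by blast
  next
    assume "spec_sign n s (psum n \<theta>)"
    then obtain \<nu> where \<nu>: "psum n \<theta> = psum n \<nu>" "\<And>i. i < n \<Longrightarrow> s * \<nu> i > 0"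
      unfolding spec_sign_def by blast
    \<comment> \<open>The count is a limit of functions of the power sums, so two families with
      equal power sums have equal counts.\<close>
    have "H m \<theta> = H m \<nu>" for m by (simp add: H_def \<nu>)
    then have "real (cnt \<theta>) = real (cnt \<nu>)" using LIMSEQ_unique[OF Hlim[of \<theta>]] Hlim[of \<nu>] by simp
    moreover have "{i. i < n \<and> s * \<nu> i \<le> 0} = {}" using \<nu>(2) by (auto simp: not_le[symmetric])
    ultimately show "cnt \<theta> = 0" by (simp add: cnt_def)
  qed
  show ?thesis
  proof (rule that[where N = N and a = a and B = "\<Prod>j=1..n. 1 + 2 * real n"]; (unfold H_def[symmetric])?)
    show "\<bar>\<Prod>j=1..n. 1 - 1 / real j * H m \<theta>\<bar> \<le> (\<Prod>j=1..n. 1 + 2 * real n)" for m \<theta>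
      unfolding abs_prod
    proof (rule prod_mono, intro conjI)
      fix j assume j: "j \<in> {1..n}"
      have "\<bar>1 / real j * H m \<theta>\<bar> \<le> 1 * (2 * real n)"
        unfolding abs_mult using j Hbd by (intro mult_mono) auto
      then show "\<bar>1 - 1 / real j * H m \<theta>\<bar> \<le> 1 + 2 * real n" by linarith
    qed auto
    show "(\<lambda>m. \<Prod>j=1..n. 1 - 1 / real j * H m \<theta>) \<longlonglongrightarrow> of_bool (spec_sign n s (psum n \<theta>))" for \<theta>
      unfolding cnt_sign[symmetric] P[symmetric] by (intro tendsto_intros Hlim)
    show "spec_sign n s (psum n \<theta>) \<longleftrightarrow> (\<forall>i<n. s * \<theta> i > 0)" for \<theta>
    proof -
      have "cnt \<theta> = 0 \<longleftrightarrow> {i. i < n \<and> s * \<theta> i \<le> 0} = {}" unfolding cnt_def by simp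
      then show ?thesis unfolding cnt_sign[symmetric] by force
    qed
  qed
qed

lemma spec_sign_psum: "spec_sign n s (psum n \<theta>) \<longleftrightarrow> (\<forall>i<n. s * \<theta> i > 0)"
  by (rule spec_sign_approximation[of n s]) blast

text \<open>The existential quantifier in \<open>spec_sign\<close> gives no measurability by itself;
  the pointwise limit of functions of \<open>\<tau>\<close> does.\<close>

lemma borel_spec_sign:
  assumes "\<And>k. (\<lambda>x. \<tau> x k) \<in> borel_measurable M" "\<And>x. \<exists>\<theta>. \<tau> x = psum n \<theta>"
  shows "(\<lambda>x. of_bool (spec_sign n s (\<tau> x)) :: real) \<in> borel_measurable M"
proof -
  obtain N :: "nat \<Rightarrow> nat" and a where lim: "\<And>\<theta>. (\<lambda>m. \<Prod>j=1..n. 1 - 1 / real j * (\<Sum>k\<le>N m. a m k * damp (psum n \<theta>) k))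
       \<longlonglongrightarrow> of_bool (spec_sign n s (psum n \<theta>))"
    by (rule spec_sign_approximation[of n s]) blast
  show ?thesis
  proof (rule borel_measurable_LIMSEQ_real)
    show "(\<lambda>m. \<Prod>j=1..n. 1 - 1 / real j * (\<Sum>k\<le>N m. a m k * damp (\<tau> x) k)) \<longlonglongrightarrow> of_bool (spec_sign n s (\<tau> x))" for x
    proof -
      obtain \<theta> where "\<tau> x = psum n \<theta>" using assms(2) by blast
      then show ?thesis using lim by (simp only:)
    qed
    show "(\<lambda>x. \<Prod>j=1..n. 1 - 1 / real j * (\<Sum>k\<le>N m. a m k * damp (\<tau> x) k)) \<in> borel_measurable M" for m
      unfolding damp_def
      by (intro borel_measurable_prod borel_measurable_diff borel_measurable_times borel_measurable_sum
          borel_measurable_const assms(1) borel_measurable_exp[THEN measurable_compose[rotated]])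
  qed
qed

context two_spectral_models
begin

theorem spec_sign_integral_eq:
  "(\<integral>x. of_bool (spec_sign n s (\<tau>1 x)) * D1 x \<partial>\<mu>1) = (\<integral>x. of_bool (spec_sign n s (\<tau>2 x)) * D2 x \<partial>\<mu>2)"
proof -
  obtain N :: "nat \<Rightarrow> nat" and a B where bd: "\<And>\<theta> m. \<bar>\<Prod>j=1..n. 1 - 1 / real j * (\<Sum>k\<le>N m. a m k * damp (psum n \<theta>) k)\<bar> \<le> B"
    and lim: "\<And>\<theta>. (\<lambda>m. \<Prod>j=1..n. 1 - 1 / real j * (\<Sum>k\<le>N m. a m k * damp (psum n \<theta>) k))
       \<longlonglongrightarrow> of_bool (spec_sign n s (psum n \<theta>))"
    by (rule spec_sign_approximation[of n s]) blast
  define Q where "Q m \<tau> = (\<Prod>j=1..n. 1 - 1 / real j * (\<Sum>k\<le>N m. a m k * damp \<tau> k))" for m \<tau>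
  have agr: "agree (Q m)" for m
    using agree_prod_damp[where J = "{1..n}" and ls = "[]" and c = "\<lambda>j. 1 / real j" and N = "N m" and a = "a m"] by (simp add: Q_def[abs_def])
  have conv: "(\<lambda>m. \<integral>x. Q m (\<tau> x) * D x \<partial>\<mu>) \<longlonglongrightarrow> (\<integral>x. of_bool (spec_sign n s (\<tau> x)) * D x \<partial>\<mu>)"
    if "spectral_model \<mu> D \<tau> n" for \<mu> :: "'c measure" and D \<tau>
  proof -
    interpret spectral_model \<mu> D \<tau> n by fact
    show ?thesis
    proof (rule integral_dominated_convergence[where w = "\<lambda>x. B * D x"])
      show "(\<lambda>x. of_bool (spec_sign n s (\<tau> x)) * D x) \<in> borel_measurable \<mu>"
        by (intro borel_measurable_times D_meas borel_spec_sign \<tau>_meas roots)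
      show "(\<lambda>x. Q m (\<tau> x) * D x) \<in> borel_measurable \<mu>" for m
        unfolding Q_def damp_def
        by (intro borel_measurable_prod borel_measurable_diff borel_measurable_times borel_measurable_sum
          borel_measurable_const \<tau>_meas D_meas borel_measurable_exp[THEN measurable_compose[rotated]])
      show "integrable \<mu> (\<lambda>x. B * D x)"
        using PL_integrable[of "[]"] by simp
      show "AE x in \<mu>. (\<lambda>m. Q m (\<tau> x) * D x) \<longlonglongrightarrow> of_bool (spec_sign n s (\<tau> x)) * D x"
      proof (rule AE_I2, rule tendsto_mult_right)
        fix x show "(\<lambda>m. Q m (\<tau> x)) \<longlonglongrightarrow> of_bool (spec_sign n s (\<tau> x))"
        proof -
          obtain \<theta> where "\<tau> x = psum n \<theta>" using roots by blast
          then show ?thesis using lim unfolding Q_def by (simp only:)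
        qed
      qed
      show "AE x in \<mu>. norm (Q m (\<tau> x) * D x) \<le> B * D x" for m
      proof (rule AE_I2)
        fix x
        obtain \<theta> where "\<tau> x = psum n \<theta>" using roots by blast
        then have "\<bar>Q m (\<tau> x)\<bar> \<le> B" using bd unfolding Q_def by (simp only:)
        then show "norm (Q m (\<tau> x) * D x) \<le> B * D x"
          using D_nonneg[of x] by (simp add: abs_mult mult_right_mono)
      qed
    qed
  qed
  have "(\<lambda>m. \<integral>x. Q m (\<tau>1 x) * D1 x \<partial>\<mu>1) \<longlonglongrightarrow> (\<integral>x. of_bool (spec_sign n s (\<tau>1 x)) * D1 x \<partial>\<mu>1)"
    by (rule conv[OF M1.spectral_model_axioms])
  moreover have "(\<lambda>m. \<integral>x. Q m (\<tau>1 x) * D1 x \<partial>\<mu>1) \<longlonglongrightarrow> (\<integral>x. of_bool (spec_sign n s (\<tau>2 x)) * D2 x \<partial>\<mu>2)"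
    using conv[OF M2.spectral_model_axioms] agr by (simp add: agree_def)
  ultimately show ?thesis by (rule LIMSEQ_unique)
qed

end

section \<open>Spectra of real symmetric matrices\<close>

definition mv :: "nat \<Rightarrow> (nat \<times> nat \<Rightarrow> real) \<Rightarrow> (nat \<Rightarrow> real) \<Rightarrow> nat \<Rightarrow> real" where
  "mv n b x i = (\<Sum>j<n. symm b i j * x j)"

definition qf :: "nat \<Rightarrow> (nat \<times> nat \<Rightarrow> real) \<Rightarrow> (nat \<Rightarrow> real) \<Rightarrow> real" where
  "qf n b x = (\<Sum>i<n. x i * mv n b x i)"

definition real_eig :: "nat \<Rightarrow> (nat \<times> nat \<Rightarrow> real) \<Rightarrow> real \<Rightarrow> bool" where
  "real_eig n b c \<longleftrightarrow> (\<exists>x. (\<exists>i<n. x i \<noteq> 0) \<and> (\<forall>i<n. mv n b x i = c * x i))"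

definition iso :: "nat \<Rightarrow> (nat \<times> nat \<Rightarrow> real) \<Rightarrow> bool" where
  "iso n b \<longleftrightarrow> (\<exists>x. (\<exists>i<n. x i \<noteq> 0) \<and> qf n b x = 0)"

definition nsq :: "nat \<Rightarrow> (nat \<Rightarrow> real) \<Rightarrow> real" where
  "nsq n x = (\<Sum>i<n. (x i)\<^sup>2)"

lemma nsq_pos: "\<exists>i<n. x i \<noteq> 0 \<Longrightarrow> nsq n x > 0"
  unfolding nsq_def by (auto intro!: sum_pos2)

lemma nsq_0_iff: "nsq n x = 0 \<longleftrightarrow> (\<forall>i<n. x i = 0)"
  by (auto simp: nsq_def sum_nonneg_eq_0_iff)

lemma mv_sym: "(\<Sum>i<n. y i * mv n b x i) = (\<Sum>i<n. x i * mv n b y i)"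
proof -
  have "(\<Sum>i<n. y i * mv n b x i) = (\<Sum>i<n. \<Sum>j<n. y i * (symm b i j * x j))"
    by (simp add: mv_def sum_distrib_left)
  also have "\<dots> = (\<Sum>j<n. \<Sum>i<n. y i * (symm b i j * x j))" by (rule sum.swap)
  also have "\<dots> = (\<Sum>j<n. x j * mv n b y j)"
    by (intro sum.cong refl) (simp add: mv_def sum_distrib_left symm_commute[of b _ j for j] mult_ac)
  finally show ?thesis .
qed

lemma mv_add: "mv n b (\<lambda>i. x i + t * y i) i = mv n b x i + t * mv n b y i"
  by (simp add: mv_def distrib_left sum.distrib sum_distrib_left mult_ac)

lemma qf_add: "qf n b (\<lambda>i. x i + t * y i) = qf n b x + 2 * t * (\<Sum>i<n. y i * mv n b x i) + t\<^sup>2 * qf n b y"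
proof -
  have "qf n b (\<lambda>i. x i + t * y i) =
      qf n b x + t * (\<Sum>i<n. x i * mv n b y i) + t * (\<Sum>i<n. y i * mv n b x i) + t\<^sup>2 * qf n b y"
    by (simp add: qf_def mv_add algebra_simps sum.distrib sum_distrib_left power2_eq_square)
  then show ?thesis by (simp add: mv_sym[of x n b y])
qed

lemma nsq_add: "nsq n (\<lambda>i. x i + t * y i) = nsq n x + 2 * t * (\<Sum>i<n. y i * x i) + t\<^sup>2 * nsq n y"
  by (simp add: nsq_def algebra_simps sum.distrib sum_distrib_left power2_eq_square)

lemma qf_scale: "qf n b (\<lambda>i. t * x i) = t\<^sup>2 * qf n b x"
  by (simp add: qf_def mv_def sum_distrib_left power2_eq_square mult_ac)

lemma nsq_scale: "nsq n (\<lambda>i. t * x i) = t\<^sup>2 * nsq n x"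
  by (simp add: nsq_def sum_distrib_left power_mult_distrib)

lemma qf_cong: "(\<And>i. i < n \<Longrightarrow> x i = y i) \<Longrightarrow> qf n b x = qf n b y"
  by (simp add: qf_def mv_def)

lemma real_eig_qf:
  assumes "\<forall>i<n. mv n b x i = c * x i" shows "qf n b x = c * nsq n x"
  using assms by (simp add: qf_def nsq_def sum_distrib_left power2_eq_square mult_ac)

text \<open>The first-order condition at a minimum. The witness \<open>t\<close> minimises the
  quadratic after \<open>d\<close> has been replaced by the positive majorant
  \<open>s\<close>.\<close>

lemma quadratic_nonneg_linear_zero:
  fixes a d :: real
  assumes "\<And>t. 2 * t * a + t\<^sup>2 * d \<ge> 0" shows "a = 0"
proof (rule ccontr)
  assume a: "a \<noteq> 0"
  define s where "s = 1 + \<bar>d\<bar>"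
  have s: "s > 0" "d \<le> s" by (auto simp: s_def)
  define t where "t = - a / s"
  have "2 * t * a + t\<^sup>2 * d \<le> 2 * t * a + t\<^sup>2 * s"
    using s by (intro add_left_mono mult_left_mono) auto
  also have "\<dots> = - (a\<^sup>2 / s)"
    using s by (simp add: t_def power2_eq_square field_simps)
  also have "\<dots> < 0" using a s by simp
  finally show False using assms[of t] by simp
qed

text \<open>Vectors are functions on all of \<open>nat\<close>. With the coordinates from
  \<open>n\<close> on pinned to 0, the sphere is closed in a Tychonoff product of compact
  sets.\<close>

lemma compact_unit_sphere:
  "compact {x :: nat \<Rightarrow> real. (\<forall>i\<ge>n. x i = 0) \<and> nsq n x = 1}"
proof -
  define K where "K = Pi\<^sub>E UNIV (\<lambda>i. if i < n then {-1..1} else {0::real})"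
  have "compactin (product_topology (\<lambda>i::nat. euclidean :: real topology) UNIV) K"
    unfolding K_def compactin_PiE by auto
  then have "compact K" by (simp add: euclidean_product_topology)
  moreover have "closed {x :: nat \<Rightarrow> real. nsq n x = 1}"
    unfolding nsq_def by (intro closed_Collect_eq continuous_intros) (auto intro!: continuous_on_product_coordinates)
  ultimately have "compact (K \<inter> {x. nsq n x = 1})" by (rule compact_Int_closed)
  also have "K \<inter> {x. nsq n x = 1} = {x. (\<forall>i\<ge>n. x i = 0) \<and> nsq n x = 1}"
  proof -
    have "\<bar>x i\<bar> \<le> 1" if "nsq n x = 1" "i < n" for x and i
    proof -
      have "(x i)\<^sup>2 \<le> nsq n x" unfolding nsq_def using that by (intro member_le_sum) auto
      then show ?thesis using that by (simp add: abs_square_le_1)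
    qed
    note le = this
    show ?thesis
    proof (rule Set.set_eqI, rule iffI)
      fix x assume "x \<in> K \<inter> {x. nsq n x = 1}"
      then have x: "x i \<in> (if i < n then {-1..1} else {0})" "nsq n x = 1" for i
        by (auto simp: K_def PiE_iff)
      have "x i = 0" if "i \<ge> n" for i using x(1)[of i] that by simp
      then show "x \<in> {x. (\<forall>i\<ge>n. x i = 0) \<and> nsq n x = 1}" using x(2) by simp
    next
      fix x :: "nat \<Rightarrow> real" assume x: "x \<in> {x. (\<forall>i\<ge>n. x i = 0) \<and> nsq n x = 1}"
      have "x i \<in> (if i < n then {-1..1} else {0})" for i
        using le[of x i] x by (cases "i < n") (auto simp: abs_le_iff)
      then show "x \<in> K \<inter> {x. nsq n x = 1}" using x by (simp add: K_def PiE_iff)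
    qed
  qed
  finally show ?thesis .
qed

text \<open>Take a minimiser of the form on the unit sphere. Perturbing it along a coordinate
  direction must have zero first-order effect, which is one row of the eigenvector equation.\<close>

lemma min_real_eig:
  assumes "n \<ge> 1"
  obtains c where "real_eig n b c" "\<And>x. qf n b x \<ge> c * nsq n x"
proof -
  define S where "S = {x :: nat \<Rightarrow> real. (\<forall>i\<ge>n. x i = 0) \<and> nsq n x = 1}"
  have "(\<lambda>i. if i = 0 then 1 else 0) \<in> S"
    using assms by (auto simp: S_def nsq_def if_distrib[of "\<lambda>x. x\<^sup>2"] cong: if_cong)
  then have "S \<noteq> {}" by blast
  moreover have "continuous_on S (qf n b)"
    unfolding qf_def[abs_def] mv_def
    by (intro continuous_intros) (auto intro!: continuous_on_subset[OF continuous_on_product_coordinates])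
  ultimately obtain x0 where x0: "x0 \<in> S" "\<And>x. x \<in> S \<Longrightarrow> qf n b x0 \<le> qf n b x"
    using continuous_attains_inf[of S "qf n b"] compact_unit_sphere[of n] unfolding S_def by blast
  define c where "c = qf n b x0"
  have ge: "qf n b x \<ge> c * nsq n x" for x
  proof (cases "\<forall>i<n. x i = 0")
    case True
    then have "nsq n x = 0" "qf n b x = 0" by (simp_all add: nsq_def qf_def)
    then show ?thesis by simp
  next
    case False
    then have pos: "nsq n x > 0" by (intro nsq_pos) auto
    define y where "y i = (if i < n then (1 / sqrt (nsq n x)) * x i else 0)" for i
    have "nsq n y = nsq n (\<lambda>i. (1 / sqrt (nsq n x)) * x i)" by (simp add: nsq_def y_def)
    also have "\<dots> = 1" unfolding nsq_scale using pos by (simp add: power_divide)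
    finally have "y \<in> S" by (simp add: S_def y_def)
    then have "c \<le> qf n b y" using x0(2) by (simp add: c_def)
    also have "qf n b y = qf n b (\<lambda>i. (1 / sqrt (nsq n x)) * x i)" by (rule qf_cong) (simp add: y_def)
    also have "\<dots> = qf n b x / nsq n x" unfolding qf_scale using pos by (simp add: power_divide)
    finally show ?thesis using pos by (simp add: field_simps)
  qed
  have x0n: "nsq n x0 = 1" using x0(1) by (simp add: S_def)
  have "mv n b x0 i = c * x0 i" if i: "i < n" for i
  proof -
    define e :: "nat \<Rightarrow> real" where "e j = of_bool (i = j)" for j
    have s: "(\<Sum>j<n. e j * y j) = y i" for y using i by (simp add: e_def)
    have "2 * t * (mv n b x0 i - c * x0 i) + t\<^sup>2 * (qf n b e - c * nsq n e) \<ge> 0" for t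
      using ge[of "\<lambda>j. x0 j + t * e j"] unfolding qf_add nsq_add x0n c_def[symmetric] s
      by (simp add: algebra_simps)
    then have "mv n b x0 i - c * x0 i = 0" by (rule quadratic_nonneg_linear_zero)
    then show ?thesis by simp
  qed
  moreover have "\<exists>i<n. x0 i \<noteq> 0" using x0n nsq_0_iff[of n x0] by auto
  ultimately have "real_eig n b c" unfolding real_eig_def by blast
  then show ?thesis using ge by (rule that)
qed

section \<open>Traces of powers via complex triangularisation\<close>

definition cmat :: "nat \<Rightarrow> (nat \<times> nat \<Rightarrow> real) \<Rightarrow> complex mat" where
  "cmat n b = Matrix.mat n n (\<lambda>(i, j). complex_of_real (symm b i j))"

lemma cmat_carrier [simp]: "cmat n b \<in> carrier_mat n n"
  by (simp add: cmat_def)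

lemma mult_mat_entry:
  assumes "A \<in> carrier_mat n n" "B \<in> carrier_mat n n" "i < n" "j < n"
  shows "(A * B) $$ (i, j) = (\<Sum>l<n. A $$ (i, l) * B $$ (l, j))"
  using assms by (auto simp: scalar_prod_def atLeast0LessThan intro!: sum.cong)

lemma cmat_pow: "i < n \<Longrightarrow> j < n \<Longrightarrow> (cmat n b ^\<^sub>m k) $$ (i, j) = complex_of_real (mpow n b k i j)"
proof (induction k arbitrary: i j)
  case (Suc k)
  have "(cmat n b ^\<^sub>m Suc k) $$ (i, j) = (\<Sum>l<n. (cmat n b ^\<^sub>m k) $$ (i, l) * cmat n b $$ (l, j))"
    using mult_mat_entry[OF pow_carrier_mat[OF cmat_carrier] cmat_carrier Suc.prems] by simp
  also have "\<dots> = (\<Sum>l<n. complex_of_real (mpow n b k i l * mpow n b 1 l j))"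
    using Suc by (intro sum.cong) (auto simp: cmat_def)
  also have "\<dots> = complex_of_real (mpow n b (k + 1) i j)"
    using Suc.prems by (subst mpow_add) auto
  finally show ?case by (simp only: Suc_eq_plus1)
qed (simp add: cmat_def)

definition mtr :: "'a::comm_ring_1 mat \<Rightarrow> 'a" where
  "mtr A = (\<Sum>i<dim_row A. A $$ (i, i))"

lemma mtr_mult_comm:
  assumes "A \<in> carrier_mat n n" "B \<in> carrier_mat n n"
  shows "mtr (A * B) = mtr (B * A)"
proof -
  have "mtr (A * B) = (\<Sum>i<n. \<Sum>j<n. A $$ (i, j) * B $$ (j, i))"
    using assms by (simp add: mtr_def mult_mat_entry del: index_mult_mat(1))
  also have "\<dots> = (\<Sum>j<n. \<Sum>i<n. A $$ (i, j) * B $$ (j, i))" by (rule sum.swap)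
  also have "\<dots> = mtr (B * A)"
    using assms by (simp add: mtr_def mult_mat_entry mult.commute del: index_mult_mat(1))
  finally show ?thesis .
qed

lemma upper_triangular_pow:
  assumes B: "B \<in> carrier_mat n n" "upper_triangular B"
  shows "upper_triangular (B ^\<^sub>m k) \<and> (\<forall>i<n. (B ^\<^sub>m k) $$ (i, i) = (B $$ (i, i)) ^ k)"
proof (induction k)
  case 0
  then show ?case using B by simp
next
  case (Suc k)
  have C: "B ^\<^sub>m k \<in> carrier_mat n n" by (rule pow_carrier_mat[OF B(1)])
  have z: "(B ^\<^sub>m k) $$ (i, l) = 0" if "l < i" "i < n" for i l
    using Suc C that by (auto intro: upper_triangularD)
  have z': "B $$ (i, l) = 0" if "l < i" "i < n" for i l
    using B that by (auto intro: upper_triangularD)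
  have e: "(B ^\<^sub>m Suc k) $$ (i, j) = (\<Sum>l<n. (B ^\<^sub>m k) $$ (i, l) * B $$ (l, j))" if "i < n" "j < n" for i j
    using mult_mat_entry[OF C B(1) that] by simp
  have "(B ^\<^sub>m Suc k) $$ (i, j) = 0" if "j < i" "i < n" for i j
  proof -
    have "(B ^\<^sub>m k) $$ (i, l) * B $$ (l, j) = 0" if "l < n" for l
      using z[of l i] z'[of j l] \<open>j < i\<close> \<open>i < n\<close> that by (cases "l < i") auto
    then show ?thesis using that by (subst e) auto
  qed
  moreover have "(B ^\<^sub>m Suc k) $$ (i, i) = (B $$ (i, i)) ^ Suc k" if i: "i < n" for i
  proof -
    have "(\<Sum>l<n. (B ^\<^sub>m k) $$ (i, l) * B $$ (l, i)) = (\<Sum>l<n. if l = i then (B ^\<^sub>m k) $$ (i, i) * B $$ (i, i) else 0)"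
    proof (rule sum.cong[OF refl])
      fix l assume "l \<in> {..<n}"
      then show "(B ^\<^sub>m k) $$ (i, l) * B $$ (l, i) = (if l = i then (B ^\<^sub>m k) $$ (i, i) * B $$ (i, i) else 0)"
        using z[of l i] z'[of i l] i by (cases l i rule: linorder_cases) auto
    qed
    then show ?thesis using i Suc by (simp only: e power_Suc2) simp
  qed
  ultimately show ?case using B C by (auto intro!: upper_triangularI)
qed

text \<open>For a real symmetric matrix A and an eigenvector v, the number v* A v is real and equals
  z times the squared norm of v, so z is real. Then the real and imaginary parts of v both satisfy
  the eigenvector equation, and one of them is nonzero.\<close>

lemma real_eig_iff:
  "real_eig n b c \<longleftrightarrow> eigenvalue (cmat n b) (complex_of_real c)"
  and complex_eig_real: "eigenvalue (cmat n b) z \<Longrightarrow> Im z = 0"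
proof -
  have mult: "(cmat n b *\<^sub>v v) $ i = (\<Sum>j<n. complex_of_real (symm b i j) * v $ j)"
    if "v \<in> carrier_vec n" "i < n" for v i
    using that by (auto simp: cmat_def scalar_prod_def atLeast0LessThan intro!: sum.cong)
  have key: "Im z = 0 \<and> real_eig n b (Re z)" if ev: "eigenvalue (cmat n b) z" for z
  proof -
    obtain v where v: "v \<in> carrier_vec n" "v \<noteq> 0\<^sub>v n" "cmat n b *\<^sub>v v = z \<cdot>\<^sub>v v"
      using ev unfolding eigenvalue_def eigenvector_def by (auto simp: cmat_def)
    have eq: "(\<Sum>j<n. complex_of_real (symm b i j) * v $ j) = z * v $ i" if "i < n" for i
    proof -
      have "(cmat n b *\<^sub>v v) $ i = (z \<cdot>\<^sub>v v) $ i" using v(3) by simp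
      then show ?thesis using that v(1) by (simp add: mult)
    qed
    define N where "N = (\<Sum>i<n. (cmod (v $ i))\<^sup>2)"
    define Q where "Q = (\<Sum>i<n. \<Sum>j<n. cnj (v $ i) * (complex_of_real (symm b i j) * v $ j))"
    have "Q = (\<Sum>i<n. cnj (v $ i) * (z * v $ i))"
      unfolding Q_def sum_distrib_left[symmetric] by (intro sum.cong refl) (simp only: eq lessThan_iff)
    also have "\<dots> = (\<Sum>i<n. z * complex_of_real ((cmod (v $ i))\<^sup>2))"
      unfolding complex_norm_square by (simp add: mult_ac)
    finally have Q: "Q = z * complex_of_real N"
      by (simp only: N_def sum_distrib_left of_real_sum)
    have "cnj Q = (\<Sum>i<n. \<Sum>j<n. cnj (v $ j) * (complex_of_real (symm b j i) * v $ i))"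
      unfolding Q_def by (simp add: mult_ac symm_commute[of b _ j for j])
    also have "\<dots> = Q" unfolding Q_def by (rule sum.swap)
    finally have "Im Q = 0" by (simp add: complex_eq_iff)
    moreover obtain i where i: "i < n" "v $ i \<noteq> 0"
      using v(1,2) by (metis carrier_vecD eq_vecI index_zero_vec)
    then have "N > 0" unfolding N_def by (intro sum_pos2[of _ i]) auto
    ultimately have Im: "Im z = 0" using Q by simp
    have re: "mv n b (\<lambda>i. Re (v $ i)) i = Re z * Re (v $ i)" "mv n b (\<lambda>i. Im (v $ i)) i = Re z * Im (v $ i)"
      if "i < n" for i
      using arg_cong[OF eq[OF that], of Re] arg_cong[OF eq[OF that], of Im] Im by (simp_all add: mv_def)
    have "Re (v $ i) \<noteq> 0 \<or> Im (v $ i) \<noteq> 0" using i by (auto simp: complex_eq_iff)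
    then have "real_eig n b (Re z)"
      unfolding real_eig_def
    proof
      assume "Re (v $ i) \<noteq> 0"
      then show "\<exists>x. (\<exists>i<n. x i \<noteq> 0) \<and> (\<forall>i<n. mv n b x i = Re z * x i)"
        using re(1) i by (intro exI[of _ "\<lambda>i. Re (v $ i)"]) auto
    next
      assume "Im (v $ i) \<noteq> 0"
      then show "\<exists>x. (\<exists>i<n. x i \<noteq> 0) \<and> (\<forall>i<n. mv n b x i = Re z * x i)"
        using re(2) i by (intro exI[of _ "\<lambda>i. Im (v $ i)"]) auto
    qed
    with Im show ?thesis by blast
  qed
  show "real_eig n b c \<longleftrightarrow> eigenvalue (cmat n b) (complex_of_real c)"
  proof
    assume "real_eig n b c"
    then obtain x i where x: "i < n" "x i \<noteq> 0" "\<And>i. i < n \<Longrightarrow> mv n b x i = c * x i"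
      unfolding real_eig_def by blast
    define v where "v = Matrix.vec n (\<lambda>i. complex_of_real (x i))"
    have "v \<in> carrier_vec n" by (simp add: v_def)
    moreover have "v \<noteq> 0\<^sub>v n" using x(1,2) by (metis index_vec index_zero_vec(1) of_real_eq_0_iff v_def)
    moreover have "cmat n b *\<^sub>v v = complex_of_real c \<cdot>\<^sub>v v"
    proof (rule eq_vecI)
      fix i assume "i < dim_vec (complex_of_real c \<cdot>\<^sub>v v)"
      then have i: "i < n" by (simp add: v_def)
      have "(cmat n b *\<^sub>v v) $ i = complex_of_real (mv n b x i)"
        using i by (subst mult) (auto simp: v_def mv_def)
      then show "(cmat n b *\<^sub>v v) $ i = (complex_of_real c \<cdot>\<^sub>v v) $ i"
        using x(3)[OF i] i by (simp add: v_def)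
    qed (simp add: v_def cmat_def)
    ultimately show "eigenvalue (cmat n b) (complex_of_real c)"
      unfolding eigenvalue_def eigenvector_def by (auto simp: cmat_def)
  next
    assume "eigenvalue (cmat n b) (complex_of_real c)"
    from key[OF this] show "real_eig n b c" by simp
  qed
  show "eigenvalue (cmat n b) z \<Longrightarrow> Im z = 0" using key by blast
qed

text \<open>In the Schur form the traces of powers are power sums of the diagonal. The diagonal
  entries are the roots of the characteristic polynomial, hence eigenvalues, hence real.\<close>

lemma trp_roots:
  obtains \<theta> where "trp n b = psum n \<theta>" "\<And>c. real_eig n b c \<longleftrightarrow> (\<exists>i<n. \<theta> i = c)"
proof -
  let ?A = "cmat n b"
  obtain es where es: "char_poly ?A = (\<Prod>a\<leftarrow>es. [:- a, 1:])"
    using char_poly_factorized[OF cmat_carrier] by blast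
  obtain B P Q where "schur_decomposition ?A es = (B, P, Q)" by (cases "schur_decomposition ?A es") auto
  from schur_decomposition[OF cmat_carrier es this]
  have sim: "similar_mat_wit ?A B P Q" and B: "upper_triangular B" "diag_mat B = es" by auto
  note c = similar_mat_witD2[OF cmat_carrier sim]
  have ev: "eigenvalue ?A z \<longleftrightarrow> (\<exists>i<n. B $$ (i, i) = z)" for z
  proof -
    have "eigenvalue ?A z \<longleftrightarrow> poly (char_poly ?A) z = 0" by (rule eigenvalue_root_char_poly[OF cmat_carrier])
    also have "\<dots> \<longleftrightarrow> z \<in> set es" unfolding es by (auto simp: poly_prod_list prod_list_zero_iff)
    also have "\<dots> \<longleftrightarrow> (\<exists>i<n. B $$ (i, i) = z)" using c by (auto simp: B(2)[symmetric] diag_mat_def)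
    finally show ?thesis .
  qed
  define \<theta> where "\<theta> i = Re (B $$ (i, i))" for i
  have \<theta>: "B $$ (i, i) = complex_of_real (\<theta> i)" if "i < n" for i
  proof -
    have "eigenvalue ?A (B $$ (i, i))" using ev that by blast
    then have "Im (B $$ (i, i)) = 0" by (rule complex_eig_real)
    then show ?thesis by (simp add: \<theta>_def complex_eq_iff)
  qed
  have "complex_of_real (trp n b k) = complex_of_real (psum n \<theta> k)" for k
  proof -
    have Bk: "B ^\<^sub>m k \<in> carrier_mat n n" using c by (intro pow_carrier_mat)
    have "complex_of_real (trp n b k) = mtr (?A ^\<^sub>m k)"
      by (simp add: trp_def mtr_def cmat_pow cmat_def[THEN arg_cong[where f = dim_row]])
    also have "?A ^\<^sub>m k = P * (B ^\<^sub>m k) * Q" by (rule similar_mat_wit_pow_id[OF sim])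
    also have "mtr (P * (B ^\<^sub>m k) * Q) = mtr (Q * (P * (B ^\<^sub>m k)))"
      using c Bk by (intro mtr_mult_comm[of _ n]) auto
    also have "Q * (P * (B ^\<^sub>m k)) = (Q * P) * (B ^\<^sub>m k)"
      using c Bk by (intro assoc_mult_mat[symmetric]) auto
    also have "\<dots> = B ^\<^sub>m k" using c Bk by simp
    also have "mtr (B ^\<^sub>m k) = (\<Sum>i<n. (B $$ (i, i)) ^ k)"
      using upper_triangular_pow[OF _ B(1), of n k] c Bk by (simp add: mtr_def)
    also have "\<dots> = complex_of_real (psum n \<theta> k)"
      by (simp add: psum_def \<theta>)
    finally show ?thesis .
  qed
  then have "trp n b = psum n \<theta>" by (simp add: fun_eq_iff)
  moreover have "real_eig n b c \<longleftrightarrow> (\<exists>i<n. \<theta> i = c)" for c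
    unfolding real_eig_iff ev using \<theta> by auto
  ultimately show ?thesis by (rule that)
qed

lemma symm_uminus: "symm (\<lambda>p. - b p) i j = - symm b i j"
  by (simp add: symm_def field_simps)

lemma qf_uminus: "qf n (\<lambda>p. - b p) x = - qf n b x"
  by (simp add: qf_def mv_def symm_uminus sum_negf)

lemma real_eig_uminus: "real_eig n (\<lambda>p. - b p) c \<longleftrightarrow> real_eig n b (- c)"
  by (auto simp: real_eig_def mv_def symm_uminus sum_negf minus_equation_iff[of _ "c * x" for x])

lemma definite_not_iso:
  assumes n: "n \<ge> 1" and pos: "\<And>c. real_eig n b c \<Longrightarrow> c > 0"
  shows "\<not> iso n b"
proof
  assume "iso n b"
  then obtain x where x: "\<exists>i<n. x i \<noteq> 0" "qf n b x = 0" unfolding iso_def by blast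
  obtain c where c: "real_eig n b c" "\<And>x. qf n b x \<ge> c * nsq n x" by (rule min_real_eig[OF n, of b]) blast
  have "c * nsq n x > 0" using nsq_pos[OF x(1)] pos[OF c(1)] by simp
  with c(2)[of x] x(2) show False by simp
qed

text \<open>A sign change along the segment from x to y forces a zero of the form on it, which must
  be the zero vector. There a multiple of x equals a multiple of y, and comparing the values of the
  form contradicts the opposite signs. This also covers \<open>n = 1\<close>, where the nonzero
  vectors are not connected.\<close>

lemma not_iso_same_sign:
  assumes "\<not> iso n b" and x: "\<exists>i<n. x i \<noteq> 0" and y: "\<exists>i<n. y i \<noteq> 0" and "qf n b x > 0"
  shows "qf n b y > 0"
proof (rule ccontr)
  assume "\<not> qf n b y > 0"
  moreover have "qf n b y \<noteq> 0" using assms(1) y unfolding iso_def by blast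
  ultimately have neg: "qf n b y < 0" by simp
  define z where "z t i = x i + t * (y i - x i)" for t i
  have "\<exists>t\<ge>0. t \<le> 1 \<and> qf n b (z t) = 0"
  proof (rule IVT2)
    have "z 0 = x" "z 1 = y" by (auto simp: z_def)
    then show "qf n b (z 1) \<le> 0" "0 \<le> qf n b (z 0)" using neg assms(4) by auto
    show "\<forall>t. 0 \<le> t \<and> t \<le> 1 \<longrightarrow> isCont (\<lambda>t. qf n b (z t)) t"
      unfolding z_def qf_add by (auto intro!: continuous_intros)
  qed simp
  then obtain t where t: "0 \<le> t" "t \<le> 1" "qf n b (z t) = 0" by blast
  have "\<not> (\<exists>i<n. z t i \<noteq> 0)" using t(3) assms(1) unfolding iso_def by blast
  then have z0: "(1 - t) * x i = - t * y i" if "i < n" for i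
    using that by (auto simp: z_def algebra_simps)
  have "(1 - t)\<^sup>2 * qf n b x = (- t)\<^sup>2 * qf n b y"
    unfolding qf_scale[symmetric] by (rule qf_cong) (rule z0)
  moreover have "(1 - t)\<^sup>2 * qf n b x \<ge> 0" "(- t)\<^sup>2 * qf n b y \<le> 0"
    using neg assms(4) by (auto intro!: mult_nonneg_nonneg mult_nonneg_nonpos)
  ultimately have "(1 - t)\<^sup>2 * qf n b x = 0" "(- t)\<^sup>2 * qf n b y = 0" by linarith+
  then show False using neg assms(4) by auto
qed

text \<open>Each \<open>\<theta> i\<close> has the sign of the form at an eigenvector, which gives
  one direction by \<open>not_iso_same_sign\<close>. The converse applies the bound of
  \<open>min_real_eig\<close> to the matrix or to its negative.\<close>

theorem iso_iff_spec_sign: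
  assumes n: "n \<ge> 1"
  shows "\<not> iso n b \<longleftrightarrow> spec_sign n 1 (trp n b) \<or> spec_sign n (- 1) (trp n b)"
proof -
  obtain \<theta> where \<theta>: "trp n b = psum n \<theta>" "\<And>c. real_eig n b c \<longleftrightarrow> (\<exists>i<n. \<theta> i = c)"
    by (rule trp_roots) blast
  have "\<not> iso n b \<longleftrightarrow> (\<forall>i<n. \<theta> i > 0) \<or> (\<forall>i<n. \<theta> i < 0)"
  proof
    assume ni: "\<not> iso n b"
    define e where "e = (\<lambda>j::nat. of_bool (j = 0) :: real)"
    have e: "\<exists>i<n. e i \<noteq> 0" using n by (auto simp: e_def)
    have ex: "\<exists>x. (\<exists>i<n. x i \<noteq> 0) \<and> qf n b x = \<theta> i * nsq n x" if "i < n" for i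
    proof -
      have "real_eig n b (\<theta> i)" using \<theta>(2) that by blast
      then show ?thesis unfolding real_eig_def using real_eig_qf by blast
    qed
    show "(\<forall>i<n. \<theta> i > 0) \<or> (\<forall>i<n. \<theta> i < 0)"
    proof (cases "qf n b e > 0")
      case True
      have "\<theta> i > 0" if i: "i < n" for i
      proof -
        obtain x where x: "\<exists>i<n. x i \<noteq> 0" "qf n b x = \<theta> i * nsq n x" using ex[OF i] by blast
        have "qf n b x > 0" by (rule not_iso_same_sign[OF ni e x(1) True])
        then show ?thesis using nsq_pos[OF x(1)] x(2) by (simp add: zero_less_mult_iff)
      qed
      then show ?thesis by blast
    next
      case False
      moreover have "qf n b e \<noteq> 0" using ni e unfolding iso_def by blast
      ultimately have neg: "qf n b e < 0" by simp
      have "\<theta> i < 0" if i: "i < n" for i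
      proof (rule ccontr)
        assume "\<not> \<theta> i < 0"
        obtain x where x: "\<exists>i<n. x i \<noteq> 0" "qf n b x = \<theta> i * nsq n x" using ex[OF i] by blast
        have "qf n b x \<ge> 0" using x(2) nsq_pos[OF x(1)] \<open>\<not> \<theta> i < 0\<close> by simp
        moreover have "qf n b x \<noteq> 0" using ni x(1) unfolding iso_def by blast
        ultimately have "qf n b x > 0" by simp
        from not_iso_same_sign[OF ni x(1) e this] neg show False by simp
      qed
      then show ?thesis by blast
    qed
  next
    assume "(\<forall>i<n. \<theta> i > 0) \<or> (\<forall>i<n. \<theta> i < 0)"
    then show "\<not> iso n b"
    proof
      assume "\<forall>i<n. \<theta> i > 0"
      then show ?thesis using \<theta>(2) by (intro definite_not_iso[OF n]) auto
    next
      assume "\<forall>i<n. \<theta> i < 0"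
      then have "\<not> iso n (\<lambda>p. - b p)"
        using \<theta>(2) by (intro definite_not_iso[OF n]) (auto simp: real_eig_uminus)
      then show ?thesis by (simp add: iso_def qf_uminus)
    qed
  qed
  then show ?thesis unfolding \<theta>(1) spec_sign_psum by simp
qed

section \<open>De Bruijn's recursion\<close>

text \<open>Index sets are arbitrary finite sets of naturals, because the recursion below deletes
  indices from the middle.\<close>

definition opairs :: "nat set \<Rightarrow> (nat \<times> nat) set" where
  "opairs I = {(a, b). a \<in> I \<and> b \<in> I \<and> a < b}"

definition sgnprod :: "nat set \<Rightarrow> (nat \<Rightarrow> real) \<Rightarrow> real" where
  "sgnprod I x = (\<Prod>p\<in>opairs I. sgn (x (snd p) - x (fst p)))"

lemma finite_opairs [simp]: "finite I \<Longrightarrow> finite (opairs I)"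
  by (rule finite_subset[of _ "I \<times> I"]) (auto simp: opairs_def)

text \<open>The odd case is wanted; the even case only makes the induction work.\<close>

lemma sgn_prod_sum_identity:
  fixes V :: "real set"
  assumes "finite V" "c \<notin> V"
  shows "(\<Sum>v\<in>V. sgn (v - c) * (\<Prod>u\<in>V - {v}. sgn (u - v))) =
    (if odd (card V) then \<Prod>v\<in>V. sgn (v - c) else (\<Prod>v\<in>V. sgn (v - c)) - 1)"
  using assms
proof (induction V rule: finite_linorder_max_induct)
  case (insert b V)
  have b: "b \<notin> V" "b \<noteq> c" "c \<notin> V" and lt: "\<And>v. v \<in> V \<Longrightarrow> v < b" using insert by auto
  \<comment> \<open>Adding a new maximum multiplies each old summand by a factor 1.\<close>
  have old: "(\<Prod>u\<in>insert b V - {v}. sgn (u - v)) = (\<Prod>u\<in>V - {v}. sgn (u - v))" if "v \<in> V" for v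
  proof -
    have "insert b V - {v} = insert b (V - {v})" using that b by auto
    then show ?thesis using insert(1) b lt[OF that] by simp
  qed
  have new: "(\<Prod>u\<in>V. sgn (u - b)) = (- 1) ^ card V"
  proof -
    have "(\<Prod>u\<in>V. sgn (u - b)) = (\<Prod>u\<in>V. - 1)"
      using lt by (intro prod.cong) auto
    then show ?thesis by simp
  qed
  have below: "(\<Prod>v\<in>V. sgn (v - c)) = (- 1) ^ card V" if "b < c"
  proof -
    have "(\<Prod>v\<in>V. sgn (v - c)) = (\<Prod>v\<in>V. - 1)"
      using lt that by (intro prod.cong) force+
    then show ?thesis by simp
  qed
  have step: "(\<Sum>v\<in>insert b V. sgn (v - c) * (\<Prod>u\<in>insert b V - {v}. sgn (u - v))) =
     sgn (b - c) * (- 1) ^ card V + (\<Sum>v\<in>V. sgn (v - c) * (\<Prod>u\<in>V - {v}. sgn (u - v)))"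
    using insert(1) b by (simp add: new old)
  show ?case
    unfolding step insert.IH[OF b(3)] using insert(1) b below
    by (cases "b < c"; cases "odd (card V)") auto
qed simp

text \<open>The power of -1 reverses the orientation of the pairs in which \<open>j\<close> is the
  larger index.\<close>

lemma sgnprod_remove:
  assumes I: "finite I" "j \<in> I"
  shows "sgnprod I x = sgnprod (I - {j}) x * (- 1) ^ card {i\<in>I. i < j} * (\<Prod>i\<in>I - {j}. sgn (x i - x j))"
proof -
  define L U where "L = {i\<in>I. i < j}" and "U = {i\<in>I. j < i}"
  define f where "f p = sgn (x (snd p) - x (fst p))" for p :: "nat \<times> nat"
  have fin: "finite L" "finite U" using I by (auto simp: L_def U_def)
  have split: "opairs I = opairs (I - {j}) \<union> ((\<lambda>i. (i, j)) ` L \<union> Pair j ` U)"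
    using I by (auto simp: opairs_def L_def U_def)
  have d: "(\<lambda>i. (i, j)) ` L \<inter> Pair j ` U = {}" "opairs (I - {j}) \<inter> ((\<lambda>i. (i, j)) ` L \<union> Pair j ` U) = {}"
    by (auto simp: opairs_def L_def U_def)
  have "sgnprod I x = sgnprod (I - {j}) x * (prod f ((\<lambda>i. (i, j)) ` L) * prod f (Pair j ` U))"
    unfolding sgnprod_def f_def[symmetric] split using I fin d
    by (simp add: prod.union_disjoint)
  also have "prod f ((\<lambda>i. (i, j)) ` L) = (\<Prod>i\<in>L. - sgn (x i - x j))"
    by (subst prod.reindex) (auto simp: inj_on_def f_def sgn_minus[symmetric] simp del: sgn_minus)
  also have "\<dots> = (- 1) ^ card L * (\<Prod>i\<in>L. sgn (x i - x j))" by (simp add: prod_uminus)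
  also have "prod f (Pair j ` U) = (\<Prod>i\<in>U. sgn (x i - x j))"
    by (subst prod.reindex) (auto simp: inj_on_def f_def)
  also have "(- 1) ^ card L * (\<Prod>i\<in>L. sgn (x i - x j)) * (\<Prod>i\<in>U. sgn (x i - x j)) =
      (- 1) ^ card L * (\<Prod>i\<in>L \<union> U. sgn (x i - x j))"
    using fin by (subst prod.union_disjoint) (auto simp: L_def U_def)
  also have "L \<union> U = I - {j}" by (auto simp: L_def U_def)
  finally show ?thesis by (simp add: L_def mult.assoc)
qed

text \<open>The product of signs \<open>P j\<close> squares to 1, so \<open>sgnprod_remove\<close>
  expresses each summand as \<open>sgnprod I x * P j\<close>, up to the factor with
  \<open>c\<close>. The common factor comes out, and \<open>sgn_prod_sum_identity\<close> evaluates
  the remaining sum.\<close>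

lemma sgnprod_expand_odd:
  assumes I: "finite I" "odd (card I)" and inj: "inj_on x I"
  shows "sgnprod I x = (\<Sum>j\<in>I. (- 1) ^ card {i\<in>I. i < j} * sgnprod (I - {j}) x)"
    and "\<And>c. c \<notin> x ` I \<Longrightarrow> sgnprod I x * (\<Prod>i\<in>I. sgn (x i - c)) =
       (\<Sum>j\<in>I. (- 1) ^ card {i\<in>I. i < j} * sgn (x j - c) * sgnprod (I - {j}) x)"
proof -
  define P where "P j = (\<Prod>i\<in>I - {j}. sgn (x i - x j))" for j
  have P2: "P j * P j = 1" if "j \<in> I" for j
  proof -
    have "P j * P j = (\<Prod>i\<in>I - {j}. sgn (x i - x j) * sgn (x i - x j))"
      by (simp only: P_def prod.distrib)
    also have "\<dots> = 1"
      by (rule prod.neutral) (use inj that in \<open>auto simp: sgn_if inj_on_def\<close>)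
    finally show ?thesis .
  qed
  have rem: "(- 1) ^ card {i\<in>I. i < j} * sgnprod (I - {j}) x = sgnprod I x * P j" if "j \<in> I" for j
  proof -
    have "sgnprod I x * P j = sgnprod (I - {j}) x * (- 1) ^ card {i\<in>I. i < j} * (P j * P j)"
      using sgnprod_remove[OF I(1) that, of x] by (simp add: P_def mult_ac)
    then show ?thesis by (simp add: P2[OF that] mult.commute)
  qed
  have gen: "(\<Sum>j\<in>I. sgn (x j - c) * P j) = (\<Prod>i\<in>I. sgn (x i - c))" if "c \<notin> x ` I" for c
  proof -
    have P': "P j = (\<Prod>u\<in>x ` I - {x j}. sgn (u - x j))" if "j \<in> I" for j
    proof -
      have "x ` I - {x j} = x ` (I - {j})" using inj that by (auto simp: inj_on_def)
      moreover have "inj_on x (I - {j})" using inj by (rule inj_on_subset) auto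
      ultimately show ?thesis by (simp add: P_def prod.reindex)
    qed
    have "odd (card (x ` I))" using I inj by (simp add: card_image)
    then have "(\<Sum>v\<in>x ` I. sgn (v - c) * (\<Prod>u\<in>x ` I - {v}. sgn (u - v))) = (\<Prod>v\<in>x ` I. sgn (v - c))"
      using sgn_prod_sum_identity[OF finite_imageI[OF I(1)] that] by simp
    then show ?thesis using inj by (simp add: sum.reindex prod.reindex P')
  qed
  show "sgnprod I x * (\<Prod>i\<in>I. sgn (x i - c)) =
       (\<Sum>j\<in>I. (- 1) ^ card {i\<in>I. i < j} * sgn (x j - c) * sgnprod (I - {j}) x)" if "c \<notin> x ` I" for c
  proof -
    have "(- 1) ^ card {i\<in>I. i < j} * sgn (x j - c) * sgnprod (I - {j}) x =
        sgnprod I x * (sgn (x j - c) * P j)" if "j \<in> I" for j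
      using rem[OF that] by (simp add: mult_ac)
    then have "(\<Sum>j\<in>I. (- 1) ^ card {i\<in>I. i < j} * sgn (x j - c) * sgnprod (I - {j}) x) =
        (\<Sum>j\<in>I. sgnprod I x * (sgn (x j - c) * P j))"
      by (intro sum.cong refl)
    then show ?thesis by (simp only: gen[OF that, symmetric] sum_distrib_left)
  qed
  have "I \<noteq> {}" using I by auto
  \<comment> \<open>For \<open>c\<close> below all values every \<open>sgn (x i - c)\<close> is 1,
    so the identity with \<open>c\<close> specialises to the one without it.\<close>
  define c where "c = Min (x ` I) - 1"
  have c: "x i - c > 0" if "i \<in> I" for i
  proof -
    have "Min (x ` I) \<le> x i" using I(1) that by (intro Min_le) auto
    then show ?thesis by (simp add: c_def)
  qed
  then have "c \<notin> x ` I" by fastforce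
  from gen[OF this] have "(\<Sum>j\<in>I. P j) = 1" using c by simp
  moreover have "(\<Sum>j\<in>I. (- 1) ^ card {i\<in>I. i < j} * sgnprod (I - {j}) x) = (\<Sum>j\<in>I. sgnprod I x * P j)"
    using rem by (intro sum.cong) auto
  ultimately show "sgnprod I x = (\<Sum>j\<in>I. (- 1) ^ card {i\<in>I. i < j} * sgnprod (I - {j}) x)"
    by (simp add: sum_distrib_left[symmetric])
qed

text \<open>Pfaffian expansion along row \<open>k\<close>: after removal of \<open>k\<close> an odd
  index set remains, and \<open>x k\<close> takes the place of \<open>c\<close>.\<close>

lemma sgnprod_expand_even:
  assumes I: "finite I" "even (card I)" "k \<in> I" and inj: "inj_on x I"
  defines "R \<equiv> I - {k}"
  shows "sgnprod I x = (\<Sum>j\<in>R. (- 1) ^ card {i\<in>I. i < k} * (- 1) ^ card {i\<in>R. i < j} *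
      (sgn (x j - x k) * sgnprod (R - {j}) x))"
proof -
  have "card I \<noteq> 0" using I by auto
  then have R: "finite R" "odd (card R)" "inj_on x R" "x k \<notin> x ` R"
    using I inj by (auto simp: R_def inj_on_def)
  have "sgnprod I x = (- 1) ^ card {i\<in>I. i < k} * (sgnprod R x * (\<Prod>i\<in>R. sgn (x i - x k)))"
    using sgnprod_remove[OF I(1,3), of x] by (simp add: R_def)
  also have "\<dots> = (\<Sum>j\<in>R. (- 1) ^ card {i\<in>I. i < k} * (- 1) ^ card {i\<in>R. i < j} * (sgn (x j - x k) * sgnprod (R - {j}) x))"
    unfolding sgnprod_expand_odd(2)[OF R] by (simp add: sum_distrib_left mult_ac)
  finally show ?thesis .
qed

lemma stdN_singleton: "emeasure stdN {c} = 0"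
  by (simp add: emeasure_density nn_integral_indicator_singleton')

lemma AE_gaussN_neq:
  assumes I: "finite (I :: 'a set)" "a \<in> I" "b \<in> I" "a \<noteq> b"
  shows "AE x in gaussN I. x a \<noteq> x b"
proof -
  define J where "J = I - {a}"
  have J: "finite J" "a \<notin> J" "I = insert a J" using I by (auto simp: J_def)
  let ?f = "\<lambda>x :: 'a \<Rightarrow> real. of_bool (x a = x b) :: real"
  have meas: "?f \<in> borel_measurable (borelN I)"
  proof -
    have [measurable]: "(\<lambda>x. x a) \<in> borel_measurable (borelN I)" "(\<lambda>x. x b) \<in> borel_measurable (borelN I)"
      using I by (auto intro!: measurable_component_singleton)
    have "?f = (\<lambda>x. indicator {0} (x a - x b))" by (auto simp: indicator_def fun_eq_iff)
    then show ?thesis by simp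
  qed
  have int: "integrable (gaussN I) ?f"
    by (rule exp_bdd_integrable[OF I(1) exp_bdd_bounded[of _ 1] meas]) auto
  have "(\<integral>x. ?f x \<partial>gaussN I) = (\<integral>x. (\<integral>y. of_bool (y = x b) \<partial>stdN) \<partial>gaussN J)"
    using G.product_integral_insert[OF J(1,2), of ?f] int I(4) unfolding J(3) by simp
  also have "(\<lambda>x. \<integral>y. of_bool (y = x b) \<partial>stdN) = (\<lambda>x. 0 :: real)"
  proof
    fix x :: "'a \<Rightarrow> real"
    have "(\<integral>y. of_bool (y = x b) \<partial>stdN) = (\<integral>y. indicator {x b} y \<partial>stdN)"
      by (intro Bochner_Integration.integral_cong) (auto simp: indicator_def)
    also have "\<dots> = measure stdN {x b}" by simp
    finally show "(\<integral>y. of_bool (y = x b) \<partial>stdN) = (0 :: real)" by (simp add: measure_def stdN_singleton)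
  qed
  finally have "(\<integral>x. ?f x \<partial>gaussN I) = 0" by simp
  then have "AE x in gaussN I. ?f x = 0"
    using integral_nonneg_eq_0_iff_AE[OF int] by simp
  then show ?thesis by eventually_elim (auto split: if_splits)
qed

lemma AE_gaussN_inj:
  assumes I: "finite I" shows "AE x in gaussN I. inj_on x I"
proof -
  have "AE x in gaussN I. \<forall>p\<in>I \<times> I. fst p \<noteq> snd p \<longrightarrow> x (fst p) \<noteq> x (snd p)"
  proof (subst AE_ball_countable)
    show "\<forall>p\<in>I \<times> I. AE x in gaussN I. fst p \<noteq> snd p \<longrightarrow> x (fst p) \<noteq> x (snd p)"
    proof
      fix p assume p: "p \<in> I \<times> I"
      show "AE x in gaussN I. fst p \<noteq> snd p \<longrightarrow> x (fst p) \<noteq> x (snd p)"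
        using AE_gaussN_neq[OF I, of "fst p" "snd p"] p by (cases "fst p = snd p") auto
    qed
  qed (use I in \<open>auto intro: countable_finite\<close>)
  then show ?thesis by eventually_elim (auto simp: inj_on_def)
qed

section \<open>Integrals of monomials against products of signs\<close>

definition wmon :: "real set \<Rightarrow> nat set \<Rightarrow> (nat \<Rightarrow> nat) \<Rightarrow> (nat \<Rightarrow> real) \<Rightarrow> real" where
  "wmon S I k x = (\<Prod>i\<in>I. indicator S (x i) * x i ^ k i)"

text \<open>A Pfaffian of the antisymmetric array of \<open>skew\<close> values, bordered by the
  \<open>mom\<close> values when the number of indices is odd. Only its expansions
  \<open>Jint_odd\<close> and \<open>Jint_even\<close> are used.\<close>

definition Jint :: "real set \<Rightarrow> nat set \<Rightarrow> (nat \<Rightarrow> nat) \<Rightarrow> real" where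
  "Jint S I k = (\<integral>x. wmon S I k x * sgnprod I x \<partial>gaussN I)"

definition mom :: "real set \<Rightarrow> nat \<Rightarrow> real" where
  "mom S k = (\<integral>u. indicator S u * u ^ k \<partial>stdN)"

definition skew :: "real set \<Rightarrow> nat \<Rightarrow> nat \<Rightarrow> real" where
  "skew S k l = (\<integral>v. (\<integral>u. indicator S u * u ^ k * (indicator S v * v ^ l) * sgn (v - u) \<partial>stdN) \<partial>stdN)"

lemma exp_bdd_wmon: "finite I \<Longrightarrow> exp_bdd I (wmon S I k)"
  unfolding wmon_def[abs_def]
  by (intro exp_bdd_prod exp_bdd_mult exp_bdd_bounded[of "\<lambda>x. indicator S (x i)" 1 for i] exp_bdd_power exp_bdd_proj)
     (auto simp: indicator_def)

lemma exp_bdd_sgn: "exp_bdd I (\<lambda>x. sgn (f x))"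
  by (rule exp_bdd_bounded[of _ 1]) (simp add: sgn_if)

lemma exp_bdd_sgnprod: "exp_bdd I (sgnprod J)"
  unfolding sgnprod_def[abs_def] by (intro exp_bdd_prod exp_bdd_sgn)

lemma borel_wmon:
  assumes S: "S \<in> sets borel" shows "wmon S I k \<in> borel_measurable (borelN I)"
proof -
  have "(\<lambda>x. indicator S (x i) * x i ^ k i :: real) \<in> borel_measurable (borelN I)" if "i \<in> I" for i
  proof -
    have [measurable]: "(\<lambda>x. x i) \<in> borel_measurable (borelN I)" using that by (rule measurable_component_singleton)
    note S[measurable]
    show ?thesis by measurable
  qed
  then show ?thesis unfolding wmon_def[abs_def] by (rule borel_measurable_prod)
qed

lemma borel_sgn_diff:
  assumes "i \<in> I" "j \<in> I" shows "(\<lambda>x. sgn (x j - x i) :: real) \<in> borel_measurable (borelN I)"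
proof -
  have [measurable]: "(\<lambda>x. x i) \<in> borel_measurable (borelN I)" "(\<lambda>x. x j) \<in> borel_measurable (borelN I)"
    using assms by (auto intro!: measurable_component_singleton)
  show ?thesis by measurable
qed

lemma borel_sgnprod:
  assumes "J \<subseteq> I" shows "sgnprod J \<in> borel_measurable (borelN I)"
  unfolding sgnprod_def[abs_def]
  by (intro borel_measurable_prod borel_sgn_diff) (use assms in \<open>auto simp: opairs_def\<close>)

lemma integrable_wmon_mult:
  assumes "finite I" "S \<in> sets borel" "exp_bdd I h" "h \<in> borel_measurable (borelN I)"
  shows "integrable (gaussN I) (\<lambda>x. wmon S I k x * h x)"
  using assms by (intro exp_bdd_integrable exp_bdd_mult exp_bdd_wmon borel_measurable_times borel_wmon)

lemma sgnprod_cong: "(\<And>i. i \<in> I \<Longrightarrow> x i = y i) \<Longrightarrow> sgnprod I x = sgnprod I y"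
  unfolding sgnprod_def by (rule prod.cong) (auto simp: opairs_def)

lemma wmon_cong: "(\<And>i. i \<in> I \<Longrightarrow> x i = y i) \<Longrightarrow> wmon S I k x = wmon S I k y"
  unfolding wmon_def by (rule prod.cong) auto

lemma Jint_single:
  assumes I: "finite I" "j \<in> I" and S: "S \<in> sets borel"
  shows "(\<integral>x. wmon S I k x * sgnprod (I - {j}) x \<partial>gaussN I) = mom S (k j) * Jint S (I - {j}) k"
proof -
  let ?R = "I - {j}"
  let ?F = "\<lambda>x. wmon S I k x * sgnprod ?R x"
  have un: "{j} \<union> ?R = I" using I by auto
  have int: "integrable (gaussN I) ?F"
    using I S by (intro integrable_wmon_mult exp_bdd_sgnprod borel_sgnprod) auto
  have "(\<integral>x. ?F x \<partial>gaussN I) = (\<integral>x. (\<integral>y. ?F (merge {j} ?R (x, y)) \<partial>gaussN ?R) \<partial>gaussN {j})"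
    using G.product_integral_fold[of "{j}" ?R ?F] int I unfolding un by simp
  also have "(\<lambda>x y. ?F (merge {j} ?R (x, y))) =
      (\<lambda>x y. (indicator S (x j) * x j ^ k j) * (wmon S ?R k y * sgnprod ?R y))"
  proof (intro ext)
    fix x y :: "nat \<Rightarrow> real"
    let ?m = "merge {j} ?R (x, y)"
    have m: "?m j = x j" "\<And>i. i \<in> ?R \<Longrightarrow> ?m i = y i" by (auto simp: merge_def)
    have "wmon S I k ?m = (indicator S (?m j) * ?m j ^ k j) * wmon S ?R k ?m"
      unfolding wmon_def using I by (rule prod.remove)
    also have "wmon S ?R k ?m = wmon S ?R k y" by (rule wmon_cong) (rule m)
    finally show "?F ?m = (indicator S (x j) * x j ^ k j) * (wmon S ?R k y * sgnprod ?R y)"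
      using sgnprod_cong[of ?R ?m y] m by simp
  qed
  also have "(\<integral>x. (\<integral>y. (indicator S (x j) * x j ^ k j) * (wmon S ?R k y * sgnprod ?R y) \<partial>gaussN ?R) \<partial>gaussN {j})
     = (\<integral>x. indicator S (x j) * x j ^ k j \<partial>gaussN {j}) * Jint S ?R k"
    by (simp add: Jint_def)
  also have "(\<integral>x. indicator S (x j) * x j ^ k j \<partial>gaussN {j}) = mom S (k j)"
    unfolding mom_def
  proof (rule G.product_integral_singleton)
    note S[measurable]
    show "(\<lambda>u. indicator S u * u ^ k j :: real) \<in> borel_measurable stdN" by measurable
  qed
  finally show ?thesis .
qed

lemma skew_PiM:
  assumes "i \<noteq> j" and S: "S \<in> sets borel"
  shows "(\<integral>x. indicator S (x i) * x i ^ k * (indicator S (x j) * x j ^ l) * sgn (x j - x i) \<partial>gaussN {i, j}) = skew S k l"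
    (is "?L = _")
proof -
  note S[measurable]
  let ?f = "\<lambda>u v. indicator S u * u ^ k * (indicator S v * v ^ l) * sgn (v - u) :: real"
  have [measurable]: "(\<lambda>x. x i) \<in> borel_measurable (borelN {i, j})" "(\<lambda>x. x j) \<in> borel_measurable (borelN {i, j})"
    by (auto intro!: measurable_component_singleton)
  have "integrable (gaussN {i, j}) (\<lambda>x. ?f (x i) (x j))"
  proof (rule exp_bdd_integrable)
    show "exp_bdd {i, j} (\<lambda>x. ?f (x i) (x j))"
      by (intro exp_bdd_mult exp_bdd_power exp_bdd_proj exp_bdd_sgn
          exp_bdd_bounded[of "\<lambda>x. indicator S (x i)" 1 for i]) (auto simp: indicator_def)
    show "(\<lambda>x. ?f (x i) (x j)) \<in> borel_measurable (borelN {i, j})" by measurable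
  qed auto
  then have "?L = (\<integral>x. (\<integral>u. ?f u (x j) \<partial>stdN) \<partial>gaussN {j})"
    using G.product_integral_insert[of "{j}" i "\<lambda>x. ?f (x i) (x j)"] assms(1) by simp
  also have "\<dots> = skew S k l"
    unfolding skew_def
  proof (rule G.product_integral_singleton)
    have "(\<lambda>v. \<integral>u. ?f u v \<partial>stdN) \<in> borel_measurable borel"
      by (rule sigma_finite_measure.borel_measurable_lebesgue_integral[OF prob_space_imp_sigma_finite[OF prob_space_stdN]])
        measurable
    then show "(\<lambda>v. \<integral>u. ?f u v \<partial>stdN) \<in> borel_measurable stdN" by simp
  qed
  finally show ?thesis .
qed

lemma skew_commute:
  assumes S: "S \<in> sets borel" shows "skew S l k = - skew S k l"
proof -
  let ?f = "\<lambda>k l i j x. indicator S (x i) * x i ^ k * (indicator S (x j) * x j ^ l) * sgn (x j - x i) :: real"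
  have "skew S l k = (\<integral>x. ?f l k 1 0 x \<partial>gaussN {1, 0 :: nat})" using skew_PiM[of 1 "0::nat" S l k] S by simp
  also have "{1, 0 :: nat} = {0, 1}" by auto
  also have "?f l k 1 0 = (\<lambda>x. - ?f k l 0 (1::nat) x)"
  proof
    fix x :: "nat \<Rightarrow> real"
    have "sgn (x 0 - x 1) = - sgn (x 1 - x 0)" by (simp add: sgn_if)
    then show "?f l k 1 0 x = - ?f k l 0 1 x" by simp
  qed
  also have "(\<integral>x. - ?f k l 0 1 x \<partial>gaussN {0, 1 :: nat}) = - (\<integral>x. ?f k l 0 1 x \<partial>gaussN {0, 1 :: nat})"
    by (rule integral_minus)
  also have "(\<integral>x. ?f k l 0 1 x \<partial>gaussN {0, 1 :: nat}) = skew S k l"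
    by (rule skew_PiM[OF _ S]) simp
  finally show ?thesis .
qed

lemma Jint_pair:
  assumes I: "finite I" "i \<in> I" "j \<in> I" "i \<noteq> j" and S: "S \<in> sets borel"
  shows "(\<integral>x. wmon S I k x * (sgn (x j - x i) * sgnprod (I - {i} - {j}) x) \<partial>gaussN I) =
     skew S (k i) (k j) * Jint S (I - {i} - {j}) k"
proof -
  let ?R = "I - {i} - {j}"
  let ?F = "\<lambda>x. wmon S I k x * (sgn (x j - x i) * sgnprod ?R x)"
  let ?f = "\<lambda>x. indicator S (x i) * x i ^ k i * (indicator S (x j) * x j ^ k j) * sgn (x j - x i) :: real"
  have un: "{i, j} \<union> ?R = I" using I by auto
  have int: "integrable (gaussN I) ?F"
    using I S by (intro integrable_wmon_mult exp_bdd_mult exp_bdd_sgn exp_bdd_sgnprod borel_measurable_times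
        borel_sgn_diff borel_sgnprod) auto
  have "(\<integral>x. ?F x \<partial>gaussN I) = (\<integral>x. (\<integral>y. ?F (merge {i, j} ?R (x, y)) \<partial>gaussN ?R) \<partial>gaussN {i, j})"
    using G.product_integral_fold[of "{i, j}" ?R ?F] int I unfolding un by auto
  also have "(\<lambda>x y. ?F (merge {i, j} ?R (x, y))) = (\<lambda>x y. ?f x * (wmon S ?R k y * sgnprod ?R y))"
  proof (intro ext)
    fix x y :: "nat \<Rightarrow> real"
    let ?m = "merge {i, j} ?R (x, y)"
    have m: "?m i = x i" "?m j = x j" "\<And>l. l \<in> ?R \<Longrightarrow> ?m l = y l" by (auto simp: merge_def)
    have "wmon S I k ?m = (indicator S (?m i) * ?m i ^ k i) * wmon S (I - {i}) k ?m"
      unfolding wmon_def using I by (intro prod.remove)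
    also have "wmon S (I - {i}) k ?m = (indicator S (?m j) * ?m j ^ k j) * wmon S ?R k ?m"
      unfolding wmon_def using I by (intro prod.remove) auto
    also have "wmon S ?R k ?m = wmon S ?R k y" by (rule wmon_cong) (rule m)
    finally show "?F ?m = ?f x * (wmon S ?R k y * sgnprod ?R y)"
      using sgnprod_cong[of ?R ?m y] m by (simp add: mult_ac)
  qed
  also have "(\<integral>x. (\<integral>y. ?f x * (wmon S ?R k y * sgnprod ?R y) \<partial>gaussN ?R) \<partial>gaussN {i, j})
     = (\<integral>x. ?f x \<partial>gaussN {i, j}) * Jint S ?R k"
    by (simp add: Jint_def)
  also have "(\<integral>x. ?f x \<partial>gaussN {i, j}) = skew S (k i) (k j)"
    using I S by (intro skew_PiM)
  finally show ?thesis .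
qed

lemma Jint_odd:
  assumes I: "finite I" "odd (card I)" and S: "S \<in> sets borel"
  shows "Jint S I k = (\<Sum>j\<in>I. (- 1) ^ card {i\<in>I. i < j} * (mom S (k j) * Jint S (I - {j}) k))"
proof -
  let ?e = "\<lambda>j. (- 1) ^ card {i\<in>I. i < j} :: real"
  have int: "integrable (gaussN I) (\<lambda>x. wmon S I k x * sgnprod (I - {j}) x)" for j
    using I S by (intro integrable_wmon_mult exp_bdd_sgnprod borel_sgnprod) auto
  have mI: "(\<lambda>x. wmon S I k x * sgnprod I x) \<in> borel_measurable (gaussN I)"
    unfolding borel_measurable_gaussN by (intro borel_measurable_times borel_wmon borel_sgnprod S) auto
  have "Jint S I k = (\<integral>x. (\<Sum>j\<in>I. ?e j * (wmon S I k x * sgnprod (I - {j}) x)) \<partial>gaussN I)"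
    unfolding Jint_def
  proof (rule integral_cong_AE)
    show "AE x in gaussN I. wmon S I k x * sgnprod I x = (\<Sum>j\<in>I. ?e j * (wmon S I k x * sgnprod (I - {j}) x))"
      using AE_gaussN_inj[OF I(1)]
      by eventually_elim (simp add: sgnprod_expand_odd(1)[OF I] sum_distrib_left mult_ac)
    show "(\<lambda>x. \<Sum>j\<in>I. ?e j * (wmon S I k x * sgnprod (I - {j}) x)) \<in> borel_measurable (gaussN I)"
      by (intro borel_measurable_sum borel_measurable_times borel_measurable_const borel_measurable_integrable[OF int])
  qed (rule mI)
  also have "\<dots> = (\<Sum>j\<in>I. ?e j * (\<integral>x. wmon S I k x * sgnprod (I - {j}) x \<partial>gaussN I))"
    by (subst Bochner_Integration.integral_sum) (auto intro!: integrable_mult_right int)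
  also have "\<dots> = (\<Sum>j\<in>I. ?e j * (mom S (k j) * Jint S (I - {j}) k))"
    by (intro sum.cong refl) (simp add: Jint_single[OF I(1) _ S])
  finally show ?thesis .
qed

lemma Jint_even:
  assumes I: "finite I" "even (card I)" "i \<in> I" and S: "S \<in> sets borel"
  shows "Jint S I k = (\<Sum>j\<in>I - {i}. (- 1) ^ card {l\<in>I. l < i} * (- 1) ^ card {l\<in>I - {i}. l < j} *
      (skew S (k i) (k j) * Jint S (I - {i} - {j}) k))"
proof -
  let ?R = "I - {i}"
  let ?e = "\<lambda>j. (- 1) ^ card {l\<in>I. l < i} * (- 1) ^ card {l\<in>?R. l < j} :: real"
  let ?g = "\<lambda>j x. wmon S I k x * (sgn (x j - x i) * sgnprod (?R - {j}) x)"
  have int: "integrable (gaussN I) (?g j)" if "j \<in> ?R" for j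
    using I S that by (intro integrable_wmon_mult exp_bdd_mult exp_bdd_sgn exp_bdd_sgnprod borel_measurable_times
        borel_sgn_diff borel_sgnprod) auto
  have mI: "(\<lambda>x. wmon S I k x * sgnprod I x) \<in> borel_measurable (gaussN I)"
    unfolding borel_measurable_gaussN by (intro borel_measurable_times borel_wmon borel_sgnprod S) auto
  have "Jint S I k = (\<integral>x. (\<Sum>j\<in>?R. ?e j * ?g j x) \<partial>gaussN I)"
    unfolding Jint_def
  proof (rule integral_cong_AE)
    show "AE x in gaussN I. wmon S I k x * sgnprod I x = (\<Sum>j\<in>?R. ?e j * ?g j x)"
      using AE_gaussN_inj[OF I(1)]
      by eventually_elim (simp add: sgnprod_expand_even[OF I] sum_distrib_left mult_ac)
    show "(\<lambda>x. \<Sum>j\<in>?R. ?e j * ?g j x) \<in> borel_measurable (gaussN I)"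
      by (intro borel_measurable_sum borel_measurable_times[OF borel_measurable_const] borel_measurable_integrable[OF int])
  qed (rule mI)
  also have "\<dots> = (\<Sum>j\<in>?R. ?e j * (\<integral>x. ?g j x \<partial>gaussN I))"
    by (subst Bochner_Integration.integral_sum) (auto intro!: integrable_mult_right int)
  also have "\<dots> = (\<Sum>j\<in>?R. ?e j * (skew S (k i) (k j) * Jint S (?R - {j}) k))"
    by (intro sum.cong refl) (use Jint_pair[OF I(1,3) _ _ S] in auto)
  finally show ?thesis .
qed

section \<open>The field of coefficients and gradings by powers of sqrt pi\<close>

abbreviation K2 :: "real set" where "K2 \<equiv> Rats_adjoin (sqrt 2)"

lemma K2_Rats: "x \<in> \<rat> \<Longrightarrow> x \<in> K2"
  and K2_sqrt2: "sqrt 2 \<in> K2"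
  and K2_add: "x \<in> K2 \<Longrightarrow> y \<in> K2 \<Longrightarrow> x + y \<in> K2"
  and K2_mult: "x \<in> K2 \<Longrightarrow> y \<in> K2 \<Longrightarrow> x * y \<in> K2"
  and K2_uminus: "x \<in> K2 \<Longrightarrow> - x \<in> K2"
  and K2_inverse: "x \<in> K2 \<Longrightarrow> inverse x \<in> K2"
  unfolding Rats_adjoin_def is_subfield_def by blast+

lemma K2_power: "x \<in> K2 \<Longrightarrow> x ^ k \<in> K2"
  by (induction k) (auto intro: K2_mult K2_Rats)

lemma K2_divide: "x \<in> K2 \<Longrightarrow> y \<in> K2 \<Longrightarrow> x / y \<in> K2"
  unfolding divide_inverse by (intro K2_mult K2_inverse)

lemma K2_inverse_sqrt2: "1 / sqrt 2 \<in> K2"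
  by (intro K2_divide K2_sqrt2 K2_Rats) auto

text \<open>\<open>T m s\<close> bounds the power of \<open>sqrt pi\<close> by \<open>m\<close> and prescribes its parity by that of \<open>s\<close>.\<close>

locale graded_field =
  fixes T :: "nat \<Rightarrow> nat \<Rightarrow> real set"
  assumes T_0: "0 \<in> T m s"
    and T_K2: "c \<in> K2 \<Longrightarrow> c \<in> T 0 0"
    and T_add: "x \<in> T m s \<Longrightarrow> y \<in> T m s \<Longrightarrow> x + y \<in> T m s"
    and T_mult: "x \<in> T m s \<Longrightarrow> y \<in> T m' s' \<Longrightarrow> x * y \<in> T (m + m') (s + s')"
    and T_parity: "T m (s + 2) = T m s"
begin

lemma T_scale: "c \<in> K2 \<Longrightarrow> x \<in> T m s \<Longrightarrow> c * x \<in> T m s"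
  using T_mult[OF T_K2, of c x m s] by simp

lemma T_uminus: "x \<in> T m s \<Longrightarrow> - x \<in> T m s"
  using T_scale[of "- 1" x] by (simp add: K2_Rats)

lemma T_sum: "(\<And>a. a \<in> A \<Longrightarrow> f a \<in> T m s) \<Longrightarrow> sum f A \<in> T m s"
  by (induction A rule: infinite_finite_induct) (auto intro: T_0 T_add)

lemma T_sign: "x \<in> T m s \<Longrightarrow> (- 1) ^ i * x \<in> T m s"
  by (cases "even i") (auto intro: T_uminus)

text \<open>Each pair of indices absorbs a factor pi and raises the bound by one; a single leftover
  index absorbs \<open>sqrt pi\<close> and also raises it by one. Together this makes
  \<open>(card I + 1) div 2\<close>. The leftover index shifts the parity by one, hence the term
  \<open>card I mod 2\<close>.\<close>

lemma Jint_in_T: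
  assumes S: "S \<in> sets borel"
    and mom: "\<And>k. sqrt pi * mom S k \<in> T 1 (k + 1)"
    and skew: "\<And>k l. pi * skew S k l \<in> T 1 (k + l)"
    and I: "finite I"
  shows "sqrt pi ^ card I * Jint S I k \<in> T ((card I + 1) div 2) (sum k I + card I mod 2)"
  using I
proof (induction "card I" arbitrary: I rule: less_induct)
  case less
  note IH = less.hyps and fin = less.prems
  show ?case
  proof (cases "I = {}")
    case True
    have "Jint S {} k = 1"
      using prob_space.prob_space[OF prob_space_gaussN, of "{} :: nat set"]
      by (simp add: Jint_def wmon_def sgnprod_def opairs_def)
    then show ?thesis using True T_K2[of 1] by (simp add: K2_Rats)
  next
    case False
    then obtain i where i: "i \<in> I" by blast
    show ?thesis
    proof (cases "odd (card I)")
      case True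
      obtain q where q: "card I = 2 * q + 1" using True by (auto elim!: oddE)
      have "sqrt pi ^ card I * Jint S I k =
          (\<Sum>j\<in>I. (- 1) ^ card {i\<in>I. i < j} * ((sqrt pi * mom S (k j)) * (sqrt pi ^ card (I - {j}) * Jint S (I - {j}) k)))"
        unfolding Jint_odd[OF fin True S] sum_distrib_left
        by (intro sum.cong refl) (simp add: q card_Diff_singleton mult_ac)
      also have "\<dots> \<in> T ((card I + 1) div 2) (sum k I + card I mod 2)"
      proof (intro T_sum T_sign)
        fix j assume j: "j \<in> I"
        have c: "card (I - {j}) = 2 * q" using j fin q by simp
        have "sqrt pi ^ card (I - {j}) * Jint S (I - {j}) k \<in>
            T ((card (I - {j}) + 1) div 2) (sum k (I - {j}) + card (I - {j}) mod 2)"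
          using fin c q by (intro IH) auto
        from T_mult[OF mom[of "k j"] this]
        show "(sqrt pi * mom S (k j)) * (sqrt pi ^ card (I - {j}) * Jint S (I - {j}) k)
           \<in> T ((card I + 1) div 2) (sum k I + card I mod 2)"
          using sum.remove[OF fin j, of k] c q by (simp add: add_ac)
      qed
      finally show ?thesis .
    next
      case even: False
      have "card I \<noteq> 0" using i fin by auto
      with even obtain q where q: "card I = 2 * q + 2"
        by (metis add.commute add_2_eq_Suc' evenE mult_Suc_right not0_implies_Suc mult_0_right)
      have "sqrt pi ^ card I * Jint S I k =
          (\<Sum>j\<in>I - {i}. (- 1) ^ card {l\<in>I. l < i} * ((- 1) ^ card {l\<in>I - {i}. l < j} *
            ((pi * skew S (k i) (k j)) * (sqrt pi ^ card (I - {i} - {j}) * Jint S (I - {i} - {j}) k))))"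
        unfolding Jint_even[OF fin even[unfolded not_not] i S] sum_distrib_left
      proof (rule sum.cong[OF refl])
        fix j assume "j \<in> I - {i}"
        then have "card (I - {i} - {j}) = 2 * q" using i fin q by simp
        then have "sqrt pi ^ card I = pi * sqrt pi ^ card (I - {i} - {j})"
          by (simp add: q power_add)
        then show "sqrt pi ^ card I * ((- 1) ^ card {l\<in>I. l < i} * (- 1) ^ card {l\<in>I - {i}. l < j} *
          (skew S (k i) (k j) * Jint S (I - {i} - {j}) k)) =
          (- 1) ^ card {l\<in>I. l < i} * ((- 1) ^ card {l\<in>I - {i}. l < j} *
          ((pi * skew S (k i) (k j)) * (sqrt pi ^ card (I - {i} - {j}) * Jint S (I - {i} - {j}) k)))"
          by (simp add: mult_ac)
      qed
      also have "\<dots> \<in> T ((card I + 1) div 2) (sum k I + card I mod 2)"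
      proof (intro T_sum T_sign)
        fix j assume j: "j \<in> I - {i}"
        have c: "card (I - {i} - {j}) = 2 * q" using i j fin q by simp
        have "sqrt pi ^ card (I - {i} - {j}) * Jint S (I - {i} - {j}) k \<in>
            T ((card (I - {i} - {j}) + 1) div 2) (sum k (I - {i} - {j}) + card (I - {i} - {j}) mod 2)"
          using fin c q by (intro IH) auto
        from T_mult[OF skew[of "k i" "k j"] this]
        show "(pi * skew S (k i) (k j)) * (sqrt pi ^ card (I - {i} - {j}) * Jint S (I - {i} - {j}) k)
           \<in> T ((card I + 1) div 2) (sum k I + card I mod 2)"
          using sum.remove[OF fin i, of k] sum.remove[of "I - {i}" j k] fin j c q by (simp add: add_ac)
      qed
      finally show ?thesis .
    qed
  qed
qed

lemma wmon_Suc: "finite I \<Longrightarrow> a \<in> I \<Longrightarrow> x a * wmon S I k x = wmon S I (k(a := k a + 1)) x"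
proof -
  assume I: "finite I" "a \<in> I"
  have "wmon S (I - {a}) k x = wmon S (I - {a}) (k(a := k a + 1)) x"
    unfolding wmon_def by (rule prod.cong) auto
  then show ?thesis
    unfolding wmon_def prod.remove[OF I] by simp
qed

text \<open>The Vandermonde product is multiplied out one factor at a time. Either choice raises one
  exponent by one, so all monomials have the same total degree and therefore the same
  parity.\<close>

lemma Jint_pairs_in_T:
  assumes S: "S \<in> sets borel"
    and mom: "\<And>k. sqrt pi * mom S k \<in> T 1 (k + 1)"
    and skew: "\<And>k l. pi * skew S k l \<in> T 1 (k + l)"
    and I: "finite I" and P: "finite P" "P \<subseteq> I \<times> I"
  shows "sqrt pi ^ card I * (\<integral>x. wmon S I k x * (\<Prod>p\<in>P. x (snd p) - x (fst p)) * sgnprod I x \<partial>gaussN I)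
      \<in> T ((card I + 1) div 2) (sum k I + card I mod 2 + card P)"
  using P
proof (induction P arbitrary: k)
  case empty
  then show ?case using Jint_in_T[OF S mom skew I] by (simp add: Jint_def)
next
  case (insert p P)
  obtain a b where p: "p = (a, b)" by fastforce
  have ab: "a \<in> I" "b \<in> I" using insert p by auto
  let ?D = "\<lambda>x. \<Prod>p\<in>P. x (snd p) - x (fst p) :: real"
  let ?F = "\<lambda>k x. wmon S I k x * ?D x * sgnprod I x"
  have int: "integrable (gaussN I) (?F k)" for k
  proof -
    have "exp_bdd I ?D" using insert.prems I by (intro exp_bdd_intros) auto
    moreover have "?D \<in> borel_measurable (borelN I)"
      using insert.prems by (intro borel_measurable_prod borel_measurable_diff measurable_component_singleton) auto
    ultimately show ?thesis
      using I S unfolding mult.assoc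
      by (intro integrable_wmon_mult exp_bdd_mult exp_bdd_sgnprod borel_measurable_times borel_sgnprod) auto
  qed
  have "(\<integral>x. wmon S I k x * (\<Prod>p\<in>insert p P. x (snd p) - x (fst p)) * sgnprod I x \<partial>gaussN I) =
     (\<integral>x. ?F (k(b := k b + 1)) x - ?F (k(a := k a + 1)) x \<partial>gaussN I)"
    using insert.hyps wmon_Suc[OF I ab(1), symmetric] wmon_Suc[OF I ab(2), symmetric]
    by (intro Bochner_Integration.integral_cong refl) (simp add: p algebra_simps)
  also have "\<dots> = (\<integral>x. ?F (k(b := k b + 1)) x \<partial>gaussN I) - (\<integral>x. ?F (k(a := k a + 1)) x \<partial>gaussN I)"
    by (rule Bochner_Integration.integral_diff[OF int int])
  finally have eq: "sqrt pi ^ card I * (\<integral>x. wmon S I k x * (\<Prod>p\<in>insert p P. x (snd p) - x (fst p)) * sgnprod I x \<partial>gaussN I) =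
     sqrt pi ^ card I * (\<integral>x. ?F (k(b := k b + 1)) x \<partial>gaussN I) + - (sqrt pi ^ card I * (\<integral>x. ?F (k(a := k a + 1)) x \<partial>gaussN I))"
    by (simp add: right_diff_distrib)
  have sum: "sum (k(c := k c + 1)) I = sum k I + 1" if "c \<in> I" for c
  proof -
    have "sum (k(c := k c + 1)) (I - {c}) = sum k (I - {c})" by (rule sum.cong) auto
    then show ?thesis using sum.remove[OF I that, of k] sum.remove[OF I that, of "k(c := k c + 1)"] by simp
  qed
  have "sqrt pi ^ card I * (\<integral>x. ?F (k(c := k c + 1)) x \<partial>gaussN I)
      \<in> T ((card I + 1) div 2) (sum k I + card I mod 2 + card (insert p P))" if "c \<in> I" for c
    using insert.IH[of "k(c := k c + 1)", unfolded sum[OF that]] insert.prems insert.hyps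
    by (simp only: card_insert_disjoint insert_subset simp_thms Suc_eq_plus1 add_ac)
  then show ?case unfolding eq using ab by (intro T_add T_uminus)
qed

end

section \<open>The one- and two-dimensional integrals\<close>

lemma std_normal_density_0: "\<phi> 0 = 1 / sqrt (2 * pi)"
  by (simp add: std_normal_density_def)

lemma integrable_stdN_bounded_power:
  fixes h :: "real \<Rightarrow> real"
  assumes "h \<in> borel_measurable borel" "\<And>u. \<bar>h u\<bar> \<le> B"
  shows "integrable stdN (\<lambda>u. h u * u ^ k)"
proof (rule Bochner_Integration.integrable_bound)
  have "integrable lborel (\<lambda>u. \<phi> u * \<bar>u\<bar> ^ k)"
    by (rule integrable_std_normal_moment_abs)
  then have "integrable stdN (\<lambda>u. \<bar>u\<bar> ^ k)" by (subst integrable_stdN) auto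
  then show "integrable stdN (\<lambda>u. B * \<bar>u\<bar> ^ k)" by (rule integrable_mult_right)
  show "AE u in stdN. norm (h u * u ^ k) \<le> norm (B * \<bar>u\<bar> ^ k)"
  proof (rule AE_I2)
    fix u
    have "\<bar>h u\<bar> * \<bar>u\<bar> ^ k \<le> \<bar>B\<bar> * \<bar>u\<bar> ^ k"
      using assms(2)[of u] by (intro mult_right_mono) auto
    then show "norm (h u * u ^ k) \<le> norm (B * \<bar>u\<bar> ^ k)" by (simp add: abs_mult power_abs)
  qed
qed (use assms(1) in measurable)

text \<open>Chosen so that \<open>\<phi> u * gker j u\<close> is the derivative of
  \<open>- (u ^ j * \<phi> u)\<close>. Integrating it leaves boundary terms only, which yields the
  recursions for \<open>mom\<close> and \<open>skew\<close>.\<close>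

definition gker :: "nat \<Rightarrow> real \<Rightarrow> real" where
  "gker j u = u ^ Suc j - real j * u ^ (j - 1)"

lemma integrable_gker:
  fixes h :: "real \<Rightarrow> real"
  assumes "h \<in> borel_measurable borel" "\<And>u. \<bar>h u\<bar> \<le> B"
  shows "integrable stdN (\<lambda>u. h u * gker j u)"
proof -
  have "integrable stdN (\<lambda>u. h u * u ^ Suc j - real j * (h u * u ^ (j - 1)))"
    by (intro Bochner_Integration.integrable_diff integrable_mult_right integrable_stdN_bounded_power[OF assms])
  then show ?thesis by (simp add: gker_def algebra_simps)
qed

lemma DERIV_pow_std_normal:
  "((\<lambda>u. - (u ^ j * \<phi> u)) has_real_derivative \<phi> u * gker j u) (at u)"
  by (rule derivative_eq_intros DERIV_std_normal_density refl)+ (simp add: gker_def algebra_simps)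

lemma continuous_gker: "isCont (\<lambda>u. \<phi> u * gker j u) u"
  unfolding gker_def std_normal_density_def by (intro continuous_intros) auto

lemma pow_std_normal_tendsto:
  "((\<lambda>u. - (u ^ j * \<phi> u)) \<longlongrightarrow> 0) at_top"
  "((\<lambda>u. - (u ^ j * \<phi> u)) \<longlongrightarrow> 0) at_bot"
proof -
  have *: "((\<lambda>u::real. u ^ j * exp (- u\<^sup>2 / 2)) \<longlongrightarrow> 0) at_top"
  proof (rule Lim_null_comparison)
    show "((\<lambda>u::real. exp (1 / 2) * (u ^ j / exp u)) \<longlongrightarrow> 0) at_top"
      by (rule tendsto_mult_right_zero[OF tendsto_power_div_exp_0])
    show "\<forall>\<^sub>F u::real in at_top. norm (u ^ j * exp (- u\<^sup>2 / 2)) \<le> exp (1 / 2) * (u ^ j / exp u)"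
      using eventually_ge_at_top[of 0]
    proof eventually_elim
      fix u :: real assume u: "0 \<le> u"
      have "0 \<le> (u - 1)\<^sup>2" by simp
      then have "- u\<^sup>2 / 2 \<le> 1 / 2 + - u" by (simp add: power2_eq_square algebra_simps)
      then have "exp (- u\<^sup>2 / 2) \<le> exp (1 / 2) * exp (- u)" unfolding exp_add[symmetric] by simp
      then have "u ^ j * exp (- u\<^sup>2 / 2) \<le> u ^ j * (exp (1 / 2) * exp (- u))"
        using u by (intro mult_left_mono) auto
      then show "norm (u ^ j * exp (- u\<^sup>2 / 2)) \<le> exp (1 / 2) * (u ^ j / exp u)"
      proof -
        have "exp (1 / 2) * (u ^ j / exp u) = u ^ j * (exp (1 / 2) * exp (- u))"
          by (simp add: exp_minus field_simps)
        moreover have "norm (u ^ j * exp (- u\<^sup>2 / 2)) = u ^ j * exp (- u\<^sup>2 / 2)"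
          using u by simp
        ultimately show ?thesis using \<open>u ^ j * exp (- u\<^sup>2 / 2) \<le> u ^ j * (exp (1 / 2) * exp (- u))\<close>
          by presburger
      qed
    qed
  qed
  have t: "((\<lambda>u. u ^ j * \<phi> u) \<longlongrightarrow> 0) at_top"
    using tendsto_mult_right_zero[OF *, of "1 / sqrt (2 * pi)"] by (simp add: std_normal_density_def mult_ac)
  then show "((\<lambda>u. - (u ^ j * \<phi> u)) \<longlongrightarrow> 0) at_top"
    using tendsto_minus by fastforce
  have "((\<lambda>u. - ((- 1) ^ j * (u ^ j * \<phi> u))) \<longlongrightarrow> 0) at_top"
    using tendsto_minus[OF tendsto_mult_right_zero[OF t, of "(- 1) ^ j"]] by simp
  also have "(\<lambda>u. - ((- 1) ^ j * (u ^ j * \<phi> u))) = (\<lambda>u. - ((- u) ^ j * \<phi> (- u)))"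
  proof
    fix u :: real
    show "- ((- 1) ^ j * (u ^ j * \<phi> u)) = - ((- u) ^ j * \<phi> (- u))"
      unfolding power_minus[of u j] by (simp add: std_normal_density_def)
  qed
  finally show "((\<lambda>u. - (u ^ j * \<phi> u)) \<longlongrightarrow> 0) at_bot"
    by (subst filterlim_at_bot_mirror)
qed

lemma gker_interval:
  assumes "a < b"
    and A: "(((\<lambda>u. - (u ^ j * \<phi> u)) \<circ> real_of_ereal) \<longlongrightarrow> A) (at_right a)"
    and B: "(((\<lambda>u. - (u ^ j * \<phi> u)) \<circ> real_of_ereal) \<longlongrightarrow> B) (at_left b)"
  shows "(\<integral>u. indicator (einterval a b) u * gker j u \<partial>stdN) = B - A"
proof -
  have int: "integrable stdN (\<lambda>u. indicator (einterval a b) u * gker j u)"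
    by (rule integrable_gker[of _ 1]) (auto simp: indicator_def)
  have meas: "(\<lambda>u. indicator (einterval a b) u * gker j u) \<in> borel_measurable borel"
    unfolding gker_def by measurable
  have "(LBINT u=a..b. \<phi> u * gker j u) = B - A"
  proof (rule interval_integral_FTC_integrable[OF assms(1) _ _ _ A B])
    show "((\<lambda>u. - (u ^ j * \<phi> u)) has_vector_derivative \<phi> u * gker j u) (at u)" for u
      using DERIV_pow_std_normal by (simp add: has_real_derivative_iff_has_vector_derivative)
    show "set_integrable lborel (einterval a b) (\<lambda>u. \<phi> u * gker j u)"
      using integrable_stdN[OF meas] int by (simp add: set_integrable_def mult_ac)
  qed (rule continuous_gker)
  then show ?thesis
    using integral_stdN[OF meas] less_imp_le[OF assms(1)]
    by (simp add: interval_lebesgue_integral_def set_lebesgue_integral_def mult_ac)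
qed

lemma gker_up: "(\<integral>u. indicator {a<..} u * gker j u \<partial>stdN) = a ^ j * \<phi> a"
  and gker_down: "(\<integral>u. indicator {..<a} u * gker j u \<partial>stdN) = - (a ^ j * \<phi> a)"
proof -
  have "isCont (\<lambda>u. - (u ^ j * \<phi> u)) a"
    using DERIV_pow_std_normal DERIV_isCont by blast
  then have "((\<lambda>u. - (u ^ j * \<phi> u)) \<longlongrightarrow> - (a ^ j * \<phi> a)) (at a within X)" for X
    by (auto simp: isCont_def intro: tendsto_within_subset)
  note lim = this pow_std_normal_tendsto
  show "(\<integral>u. indicator {a<..} u * gker j u \<partial>stdN) = a ^ j * \<phi> a"
    using gker_interval[of "ereal a" \<infinity> j "- (a ^ j * \<phi> a)" 0, unfolded ereal_tendsto_simps, OF _ lim(1,2)]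
    by simp
  show "(\<integral>u. indicator {..<a} u * gker j u \<partial>stdN) = - (a ^ j * \<phi> a)"
    using gker_interval[of "- \<infinity>" "ereal a" j 0 "- (a ^ j * \<phi> a)", unfolded ereal_tendsto_simps, OF _ lim(3,1)]
    by simp
qed

text \<open>\<open>\<beta>\<close> says whether the origin is a boundary point of \<open>S\<close>, and \<open>\<delta>\<close> is its orientation.\<close>

definition ray :: "real set \<Rightarrow> real \<Rightarrow> real \<Rightarrow> bool" where
  "ray S \<beta> \<delta> \<longleftrightarrow> S = {0<..} \<and> \<beta> = 1 \<and> \<delta> = 1 \<or> S = {..<0} \<and> \<beta> = 1 \<and> \<delta> = - 1 \<or> S = UNIV \<and> \<beta> = 0 \<and> \<delta> = 0"

lemma ray_borel: "ray S \<beta> \<delta> \<Longrightarrow> S \<in> sets borel"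
  by (auto simp: ray_def)

lemma ray_cases:
  assumes "ray S \<beta> \<delta>"
  obtains "S = {0<..}" "\<beta> = 1" "\<delta> = 1" | "S = {..<0}" "\<beta> = 1" "\<delta> = - 1" | "S = UNIV" "\<beta> = 0" "\<delta> = 0"
  using assms unfolding ray_def by blast

lemma AE_stdN_neq: "AE u in stdN. u \<noteq> c"
  using stdN_singleton[of c] by (intro AE_I[of _ _ "{c}"]) auto

text \<open>Only the jumps of the step function \<open>h\<close> contribute, each multiplied by the
  value of \<open>u ^ j * \<phi> u\<close> at the jump.\<close>

lemma gker_combination:
  fixes h :: "real \<Rightarrow> real"
  assumes h: "h \<in> borel_measurable borel"
    and eq: "\<And>u. u \<noteq> a \<Longrightarrow> u \<noteq> c \<Longrightarrow> h u = p * indicator {a<..} u + q * indicator {..<a} u + r * indicator {c<..} u + s * indicator {..<c} u"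
  shows "(\<integral>u. h u * gker j u \<partial>stdN) = (p - q) * (a ^ j * \<phi> a) + (r - s) * (c ^ j * \<phi> c)"
proof -
  have i: "integrable stdN (\<lambda>u. indicator {d<..} u * gker j u)" "integrable stdN (\<lambda>u. indicator {..<d} u * gker j u)" for d
    by (rule integrable_gker[of _ 1]; auto simp: indicator_def)+
  have "(\<integral>u. h u * gker j u \<partial>stdN) = (\<integral>u. p * (indicator {a<..} u * gker j u) + q * (indicator {..<a} u * gker j u)
      + r * (indicator {c<..} u * gker j u) + s * (indicator {..<c} u * gker j u) \<partial>stdN)"
  proof (rule integral_cong_AE)
    show "AE u in stdN. h u * gker j u = p * (indicator {a<..} u * gker j u) + q * (indicator {..<a} u * gker j u)
      + r * (indicator {c<..} u * gker j u) + s * (indicator {..<c} u * gker j u)"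
      using AE_stdN_neq[of a] AE_stdN_neq[of c] by eventually_elim (simp add: eq distrib_right)
  qed (use h in \<open>auto simp: gker_def\<close>)
  also have "\<dots> = p * (a ^ j * \<phi> a) + q * - (a ^ j * \<phi> a)
      + r * (c ^ j * \<phi> c) + s * - (c ^ j * \<phi> c)"
    using i by (simp add: gker_up gker_down)
  finally show ?thesis by (simp add: algebra_simps)
qed

lemma ray_gker:
  assumes "ray S \<beta> \<delta>"
  shows "(\<integral>u. indicator S u * gker j u \<partial>stdN) = \<delta> * (0 ^ j * \<phi> 0)"
  using assms
proof (cases rule: ray_cases)
  case 1
  then show ?thesis using gker_up[of 0] by simp
next
  case 2
  then show ?thesis using gker_down[of 0] by simp
next
  case 3
  have "(\<integral>u. indicator S u * gker j u \<partial>stdN) = (1 - 1) * (0 ^ j * \<phi> 0) + (0 - 0) * (0 ^ j * \<phi> 0)"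
    by (rule gker_combination) (auto simp: 3 indicator_def)
  then show ?thesis using 3 by simp
qed

text \<open>The sign jumps down by 2 at \<open>v\<close>. At the origin the integrand jumps up by 1
  for both half-lines, hence \<open>\<beta>\<close> where \<open>ray_gker\<close> has
  \<open>\<delta>\<close>.\<close>

lemma ray_gker_sgn:
  assumes "ray S \<beta> \<delta>" and v: "v \<in> S"
  shows "(\<integral>u. (indicator S u * sgn (v - u)) * gker j u \<partial>stdN) =
     \<beta> * (0 ^ j * \<phi> 0) - 2 * (v ^ j * \<phi> v)"
  using assms(1)
proof (cases rule: ray_cases)
  case 1
  have "(\<integral>u. (indicator S u * sgn (v - u)) * gker j u \<partial>stdN) = (1 - 0) * (0 ^ j * \<phi> 0) + (- 2 - 0) * (v ^ j * \<phi> v)"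
    by (rule gker_combination) (use v in \<open>auto simp: 1 indicator_def sgn_if\<close>)
  then show ?thesis using 1 by simp
next
  case 2
  have "(\<integral>u. (indicator S u * sgn (v - u)) * gker j u \<partial>stdN) = (0 - - 1) * (0 ^ j * \<phi> 0) + (0 - 2) * (v ^ j * \<phi> v)"
    by (rule gker_combination) (use v in \<open>auto simp: 2 indicator_def sgn_if\<close>)
  then show ?thesis using 2 by simp
next
  case 3
  have "(\<integral>u. (indicator S u * sgn (v - u)) * gker j u \<partial>stdN) = (0 - 0) * (0 ^ j * \<phi> 0) + (- 1 - 1) * (v ^ j * \<phi> v)"
    by (rule gker_combination) (auto simp: 3 indicator_def sgn_if)
  then show ?thesis using 3 by simp
qed

lemma ray_mom_Suc:
  assumes "ray S \<beta> \<delta>"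
  shows "mom S (Suc j) = real j * mom S (j - 1) + \<delta> * (0 ^ j * \<phi> 0)"
proof -
  have [measurable]: "S \<in> sets borel" using assms by (rule ray_borel)
  have i: "integrable stdN (\<lambda>u. indicator S u * u ^ k)" for k
    by (rule integrable_stdN_bounded_power[of _ 1]) (auto simp: indicator_def)
  have "(\<integral>u. indicator S u * gker j u \<partial>stdN) = (\<integral>u. indicator S u * u ^ Suc j - real j * (indicator S u * u ^ (j - 1)) \<partial>stdN)"
    by (intro Bochner_Integration.integral_cong refl) (simp add: gker_def algebra_simps)
  also have "\<dots> = mom S (Suc j) - real j * mom S (j - 1)"
    unfolding mom_def by (subst Bochner_Integration.integral_diff[OF i integrable_mult_right[OF i]]) simp
  finally show ?thesis using ray_gker[OF assms] by simp
qed

text \<open>What the boundary term at \<open>u = v\<close> leaves behind when the inner integral of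
  \<open>skew\<close> is integrated by parts.\<close>

definition bet :: "real set \<Rightarrow> nat \<Rightarrow> real" where
  "bet S m = (\<integral>v. indicator S v * v ^ m * \<phi> v \<partial>stdN)"

text \<open>Substitute \<open>v = x / sqrt 2\<close>: the square of \<open>\<phi> (x / sqrt 2)\<close> is a multiple of \<open>\<phi> x\<close>.\<close>

lemma ray_bet:
  assumes "ray S \<beta> \<delta>"
  shows "pi * bet S m = (1 / sqrt 2) ^ (m + 2) * (sqrt pi * mom S m)"
proof -
  have [measurable]: "S \<in> sets borel" using assms by (rule ray_borel)
  have S: "indicator S (x / sqrt 2) = (indicator S x :: real)" for x
    using assms by (cases rule: ray_cases) (auto simp: indicator_def field_simps)
  have dens: "\<phi> (x / sqrt 2) * \<phi> (x / sqrt 2) = \<phi> x / sqrt (2 * pi)" for x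
    by (simp add: std_normal_density_def exp_add[symmetric] power_divide field_simps)
  have "bet S m = (\<integral>v. \<phi> v * (indicator S v * v ^ m * \<phi> v) \<partial>lborel)"
    unfolding bet_def by (rule integral_stdN) measurable
  also have "\<dots> = \<bar>1 / sqrt 2\<bar> *\<^sub>R (\<integral>x. \<phi> (0 + 1 / sqrt 2 * x) *
      (indicator S (0 + 1 / sqrt 2 * x) * (0 + 1 / sqrt 2 * x) ^ m * \<phi> (0 + 1 / sqrt 2 * x)) \<partial>lborel)"
    by (rule lborel_integral_real_affine) simp
  also have "(\<lambda>x. \<phi> (0 + 1 / sqrt 2 * x) *
      (indicator S (0 + 1 / sqrt 2 * x) * (0 + 1 / sqrt 2 * x) ^ m * \<phi> (0 + 1 / sqrt 2 * x))) =
      (\<lambda>x. ((1 / sqrt 2) ^ m / sqrt (2 * pi)) * (\<phi> x * (indicator S x * x ^ m)))"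
  proof
    fix x
    have "\<phi> (x / sqrt 2) * (indicator S (x / sqrt 2) * (x / sqrt 2) ^ m * \<phi> (x / sqrt 2)) =
       (\<phi> (x / sqrt 2) * \<phi> (x / sqrt 2)) * (indicator S x * (x / sqrt 2) ^ m)"
      by (simp add: S mult_ac)
    also have "\<dots> = ((1 / sqrt 2) ^ m / sqrt (2 * pi)) * (\<phi> x * (indicator S x * x ^ m))"
      unfolding dens by (simp add: power_divide)
    finally show "\<phi> (0 + 1 / sqrt 2 * x) *
      (indicator S (0 + 1 / sqrt 2 * x) * (0 + 1 / sqrt 2 * x) ^ m * \<phi> (0 + 1 / sqrt 2 * x)) =
      ((1 / sqrt 2) ^ m / sqrt (2 * pi)) * (\<phi> x * (indicator S x * x ^ m))" by simp
  qed
  also have "(\<integral>x. ((1 / sqrt 2) ^ m / sqrt (2 * pi)) * (\<phi> x * (indicator S x * x ^ m)) \<partial>lborel) =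
      ((1 / sqrt 2) ^ m / sqrt (2 * pi)) * mom S m"
    unfolding mom_def by (subst integral_stdN) auto
  finally have "pi * bet S m = (sqrt pi * sqrt pi) * (\<bar>1 / sqrt 2\<bar> * ((1 / sqrt 2) ^ m / (sqrt 2 * sqrt pi)) * mom S m)"
    by (simp add: real_sqrt_mult)
  also have "\<dots> = (1 / sqrt 2) ^ (m + 2) * (sqrt pi * mom S m)"
    by (simp add: power_add power2_eq_square field_simps del: real_sqrt_mult_self)
  finally show ?thesis .
qed

text \<open>For fixed \<open>v\<close> the inner integral \<open>h k v\<close> satisfies a recursion
  by \<open>ray_gker_sgn\<close>; integrating it against \<open>v ^ l\<close> over \<open>S\<close>
  gives the claim.\<close>

lemma ray_skew_Suc:
  assumes "ray S \<beta> \<delta>"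
  shows "skew S (Suc j) l = real j * skew S (j - 1) l + \<beta> * (0 ^ j * \<phi> 0) * mom S l - 2 * bet S (l + j)"
proof -
  have [measurable]: "S \<in> sets borel" using assms by (rule ray_borel)
  define h where "h k v = (\<integral>u. (indicator S u * sgn (v - u)) * u ^ k \<partial>stdN)" for k v
  have iu: "integrable stdN (\<lambda>u. (indicator S u * sgn (v - u)) * u ^ k)" for v k
    by (rule integrable_stdN_bounded_power[of _ 1]) (auto simp: indicator_def sgn_if)
  have sk: "skew S k l = (\<integral>v. indicator S v * v ^ l * h k v \<partial>stdN)" for k
    unfolding skew_def h_def
    by (intro Bochner_Integration.integral_cong refl)
      (simp only: integral_mult_right_zero[symmetric] mult_ac)
  have hm: "h k \<in> borel_measurable borel" for k
    unfolding h_def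
    by (rule sigma_finite_measure.borel_measurable_lebesgue_integral[OF prob_space_imp_sigma_finite[OF prob_space_stdN]])
      measurable
  have hb: "\<bar>h k v\<bar> \<le> (\<integral>u. \<bar>u\<bar> ^ k \<partial>stdN)" for k v
    unfolding h_def
  proof (rule order_trans[OF integral_abs_bound], rule integral_mono)
    show "integrable stdN (\<lambda>u. \<bar>(indicator S u * sgn (v - u)) * u ^ k\<bar>)" using iu by (rule integrable_abs)
    have "integrable stdN (\<lambda>u. 1 * u ^ k)" by (rule integrable_stdN_bounded_power[of _ 1]) auto
    from integrable_abs[OF this] show "integrable stdN (\<lambda>u. \<bar>u\<bar> ^ k)" by (simp add: power_abs)
    show "\<bar>(indicator S u * sgn (v - u)) * u ^ k\<bar> \<le> \<bar>u\<bar> ^ k" for u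
      by (auto simp: indicator_def sgn_if power_abs abs_mult)
  qed
  have iv: "integrable stdN (\<lambda>v. indicator S v * v ^ l * h k v)" for k
  proof -
    have "integrable stdN (\<lambda>v. (indicator S v * h k v) * v ^ l)"
      using hm hb by (intro integrable_stdN_bounded_power[of _ "\<integral>u. \<bar>u\<bar> ^ k \<partial>stdN"])
        (auto simp: indicator_def intro: order_trans[OF abs_ge_zero])
    then show ?thesis by (simp add: mult_ac)
  qed
  have ib: "integrable stdN (\<lambda>v. indicator S v * v ^ m * \<phi> v)" for m
  proof -
    have "\<phi> v \<le> 1" for v
    proof -
      have "1 / sqrt (2 * pi) \<le> 1" using pi_gt3 by (simp add: real_le_rsqrt)
      moreover have "exp (- v\<^sup>2 / 2) \<le> 1" by simp
      ultimately have "1 / sqrt (2 * pi) * exp (- v\<^sup>2 / 2) \<le> 1 * 1" by (intro mult_mono) auto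
      then show ?thesis by (simp add: std_normal_density_def)
    qed
    then have "integrable stdN (\<lambda>v. (indicator S v * \<phi> v) * v ^ m)"
      by (intro integrable_stdN_bounded_power[of _ 1]) (auto simp: indicator_def)
    then show ?thesis by (simp add: mult_ac)
  qed
  have im: "integrable stdN (\<lambda>v. indicator S v * v ^ m)" for m
    by (rule integrable_stdN_bounded_power[of _ 1]) (auto simp: indicator_def)
  have hrec: "h (Suc j) v - real j * h (j - 1) v = \<beta> * (0 ^ j * \<phi> 0) - 2 * (v ^ j * \<phi> v)"
    if "v \<in> S" for v
  proof -
    have "h (Suc j) v - real j * h (j - 1) v = (\<integral>u. (indicator S u * sgn (v - u)) * u ^ Suc j - real j * ((indicator S u * sgn (v - u)) * u ^ (j - 1)) \<partial>stdN)"
      unfolding h_def by (subst Bochner_Integration.integral_diff[OF iu integrable_mult_right[OF iu]]) simp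
    also have "\<dots> = (\<integral>u. (indicator S u * sgn (v - u)) * gker j u \<partial>stdN)"
      by (intro Bochner_Integration.integral_cong refl) (simp add: gker_def algebra_simps)
    finally show ?thesis using ray_gker_sgn[OF assms that] by simp
  qed
  have "skew S (Suc j) l - real j * skew S (j - 1) l =
     (\<integral>v. indicator S v * v ^ l * h (Suc j) v - real j * (indicator S v * v ^ l * h (j - 1) v) \<partial>stdN)"
    unfolding sk by (subst Bochner_Integration.integral_diff) (auto intro!: integrable_mult_right iv)
  also have "\<dots> = (\<integral>v. \<beta> * (0 ^ j * \<phi> 0) * (indicator S v * v ^ l)
      - 2 * (indicator S v * v ^ (l + j) * \<phi> v) \<partial>stdN)"
  proof (rule Bochner_Integration.integral_cong[OF refl])
    fix v
    show "indicator S v * v ^ l * h (Suc j) v - real j * (indicator S v * v ^ l * h (j - 1) v) =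
       \<beta> * (0 ^ j * \<phi> 0) * (indicator S v * v ^ l) - 2 * (indicator S v * v ^ (l + j) * \<phi> v)"
    proof (cases "v \<in> S")
      case True
      have "v ^ l * h (Suc j) v - real j * (v ^ l * h (j - 1) v) = v ^ l * (h (Suc j) v - real j * h (j - 1) v)"
        by (simp add: algebra_simps)
      then show ?thesis using True unfolding hrec[OF True] by (simp add: algebra_simps power_add)
    qed simp
  qed
  also have "\<dots> = \<beta> * (0 ^ j * \<phi> 0) * mom S l - 2 * bet S (l + j)"
    unfolding mom_def bet_def
    by (subst Bochner_Integration.integral_diff) (auto intro!: integrable_mult_right ib im)
  finally show ?thesis by simp
qed

text \<open>The recursion lowers the first exponent by two, leaving boundary terms that lie in the
  right grade. When the first exponent is 0, antisymmetry exchanges the two, and the same recursion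
  applies with second exponent 0; it ends at \<open>skew S 0 0\<close>, which is 0 by
  antisymmetry.\<close>

lemma (in graded_field) skew_in_T:
  assumes ray: "ray S \<beta> \<delta>"
    and mom: "\<And>k. sqrt pi * mom S k \<in> T 1 (k + 1)"
  shows "pi * skew S k l \<in> T 1 (k + l)"
proof -
  have \<beta>: "\<beta> \<in> K2" using ray by (cases rule: ray_cases) (auto intro: K2_Rats)
  have S: "S \<in> sets borel" using ray by (rule ray_borel)
  have pi_sqrt: "pi * \<phi> 0 = (1 / sqrt 2) * sqrt pi"
  proof -
    have "pi * \<phi> 0 = (sqrt pi * sqrt pi) / (sqrt 2 * sqrt pi)"
      by (simp add: std_normal_density_0 real_sqrt_mult)
    then show ?thesis by (simp del: real_sqrt_mult_self)
  qed
  have bet: "pi * bet S m \<in> T 1 (m + 1)" for m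
    unfolding ray_bet[OF ray] by (intro T_scale mom K2_power K2_inverse_sqrt2)
  have step: "pi * skew S (Suc j) l \<in> T 1 (Suc j + l)" if IH: "j > 0 \<Longrightarrow> pi * skew S (j - 1) l \<in> T 1 (j - 1 + l)" for j l
  proof -
    have eq: "pi * skew S (Suc j) l = real j * (pi * skew S (j - 1) l)
        + ((\<beta> * 0 ^ j * (1 / sqrt 2)) * (sqrt pi * mom S l) + (- 2) * (pi * bet S (l + j)))"
    proof -
      have "pi * skew S (Suc j) l = real j * (pi * skew S (j - 1) l)
        + (\<beta> * 0 ^ j * (pi * \<phi> 0) * mom S l + (- 2) * (pi * bet S (l + j)))"
        unfolding ray_skew_Suc[OF ray] by (simp add: algebra_simps)
      then show ?thesis unfolding pi_sqrt by (simp add: mult_ac)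
    qed
    have 1: "real j * (pi * skew S (j - 1) l) \<in> T 1 (Suc j + l)"
    proof (cases "j = 0")
      case True
      then show ?thesis by (simp add: T_0)
    next
      case False
      then have "pi * skew S (j - 1) l \<in> T 1 (j - 1 + l + 2)" using IH unfolding T_parity by simp
      also have "j - 1 + l + 2 = Suc j + l" using False by simp
      finally have "pi * skew S (j - 1) l \<in> T 1 (Suc j + l)" .
      moreover have "real j \<in> K2" by (intro K2_Rats) auto
      ultimately show ?thesis by (rule T_scale[rotated])
    qed
    have 2: "(\<beta> * 0 ^ j * (1 / sqrt 2)) * (sqrt pi * mom S l) \<in> T 1 (Suc j + l)"
    proof (cases "j = 0")
      case True
      have "\<beta> * 0 ^ j * (1 / sqrt 2) \<in> K2" by (intro K2_mult \<beta> K2_power K2_inverse_sqrt2 K2_Rats) auto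
      from T_scale[OF this mom[of l]] show ?thesis using True by simp
    qed (simp add: T_0 power_0_left)
    have 3: "(- 2) * (pi * bet S (l + j)) \<in> T 1 (Suc j + l)"
      using T_scale[of "- 2", OF _ bet[of "l + j"]] by (simp add: K2_Rats add_ac)
    show ?thesis unfolding eq by (intro T_add 1 2 3)
  qed
  have zero: "pi * skew S k 0 \<in> T 1 (k + 0)" for k
  proof (induction k rule: less_induct)
    case (less k)
    show ?case
    proof (cases k)
      case 0
      have "skew S 0 0 = 0" using skew_commute[OF S, of 0 0] by simp
      then show ?thesis using 0 by (simp add: T_0)
    next
      case (Suc j)
      show ?thesis unfolding Suc by (rule step, rule less) (simp add: Suc)
    qed
  qed
  show ?thesis
  proof (induction k rule: less_induct)
    case (less k)
    show ?case
    proof (cases k)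
      case 0
      then show ?thesis using T_uminus[OF zero[of l]] skew_commute[OF S, of 0 l] by simp
    next
      case (Suc j)
      show ?thesis unfolding Suc by (rule step, rule less) (simp add: Suc)
    qed
  qed
qed

section \<open>The gradings for half-lines and for the whole line\<close>

inductive_set Tspan :: "nat \<Rightarrow> nat \<Rightarrow> real set" for m s :: nat where
  zero: "0 \<in> Tspan m s"
| add_base: "c \<in> K2 \<Longrightarrow> r \<le> m \<Longrightarrow> even (r + s) \<Longrightarrow> x \<in> Tspan m s \<Longrightarrow> c * sqrt pi ^ r + x \<in> Tspan m s"

lemma Tspan_base: "c \<in> K2 \<Longrightarrow> r \<le> m \<Longrightarrow> even (r + s) \<Longrightarrow> c * sqrt pi ^ r \<in> Tspan m s"
  using Tspan.add_base[OF _ _ _ Tspan.zero] by fastforce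

lemma Tspan_add: "x \<in> Tspan m s \<Longrightarrow> y \<in> Tspan m s \<Longrightarrow> x + y \<in> Tspan m s"
  by (induction rule: Tspan.induct) (auto simp: add.assoc intro: Tspan.add_base)

lemma Tspan_base_mult:
  assumes "c \<in> K2" "r \<le> m" "even (r + s)" "y \<in> Tspan m' s'"
  shows "c * sqrt pi ^ r * y \<in> Tspan (m + m') (s + s')"
  using assms(4)
proof (induction rule: Tspan.induct)
  case (add_base d r' y)
  have "(c * d) * sqrt pi ^ (r + r') + c * sqrt pi ^ r * y \<in> Tspan (m + m') (s + s')"
    using add_base assms by (intro Tspan.add_base K2_mult) auto
  then show ?case by (simp add: algebra_simps power_add)
qed (simp add: Tspan.zero)

lemma Tspan_mult:
  assumes "x \<in> Tspan m s" "y \<in> Tspan m' s'"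
  shows "x * y \<in> Tspan (m + m') (s + s')"
  using assms(1)
proof (induction rule: Tspan.induct)
  case (add_base c r x)
  then show ?case
    using Tspan_add[OF Tspan_base_mult[OF add_base(1-3) assms(2)]] by (simp add: distrib_right)
qed (simp add: Tspan.zero)

lemma Tspan_parity: "Tspan m (s + 2) = Tspan m s"
proof -
  have "x \<in> Tspan m (s + 2) \<Longrightarrow> x \<in> Tspan m s" for x
    by (induction rule: Tspan.induct) (auto intro: Tspan.intros)
  moreover have "x \<in> Tspan m s \<Longrightarrow> x \<in> Tspan m (s + 2)" for x
    by (induction rule: Tspan.induct) (auto intro: Tspan.intros)
  ultimately show ?thesis by blast
qed

lemma Tspan_K2: "c \<in> K2 \<Longrightarrow> c \<in> Tspan 0 0"
  using Tspan_base[of c 0 0 0] by simp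

interpretation half: graded_field Tspan
  by standard (auto intro: Tspan.zero Tspan_add Tspan_mult Tspan_K2 simp: Tspan_parity simp del: add_2_eq_Suc')

text \<open>Where \<open>Tspan\<close> admits lower powers of \<open>sqrt pi\<close>, this demands
  exactly the top power. It fits the whole line and makes the normalising constant a single term, by
  which one can divide.\<close>

definition Tfull :: "nat \<Rightarrow> nat \<Rightarrow> real set" where
  "Tfull m s = {x. x / sqrt pi ^ m \<in> K2}"

interpretation full: graded_field Tfull
proof
  show "x + y \<in> Tfull m s" if "x \<in> Tfull m s" "y \<in> Tfull m s" for x y m s
    using that K2_add unfolding Tfull_def by (simp add: add_divide_distrib)
  show "x * y \<in> Tfull (m + m') (s + s')" if "x \<in> Tfull m s" "y \<in> Tfull m' s'" for x y m s m' s'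
    using that K2_mult[of "x / sqrt pi ^ m" "y / sqrt pi ^ m'"] unfolding Tfull_def by (simp add: power_add)
qed (auto simp: Tfull_def K2_Rats)

lemma mom_UNIV_0: "mom UNIV 0 = 1"
  using prob_space.prob_space[OF prob_space_stdN] by (simp add: mom_def)

lemma mom_half_0: "mom {0<..} 0 = 1 / 2" "mom {..<0} 0 = 1 / 2"
proof -
  have m: "mom S 0 = (\<integral>x. \<phi> x * indicator S x \<partial>lborel)" if "S \<in> sets borel" for S
    unfolding mom_def using that by (subst integral_stdN) simp_all
  have "mom {..<0} 0 = (\<integral>x. \<phi> x * indicator {..<0} x \<partial>lborel)"
    by (rule m) simp
  also have "\<dots> = \<bar>- 1\<bar> *\<^sub>R (\<integral>x. \<phi> (0 + - 1 * x) * indicator {..<0} (0 + - 1 * x) \<partial>lborel)"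
    by (rule lborel_integral_real_affine) simp
  also have "\<dots> = (\<integral>x. \<phi> x * indicator {0<..} x \<partial>lborel)"
    by (simp add: std_normal_density_def indicator_def)
  also have "\<dots> = mom {0<..} 0" by (rule m[symmetric]) simp
  finally have eq: "mom {..<0} 0 = mom {0<..} 0" .
  have i: "integrable stdN (indicator {0<..} :: real \<Rightarrow> real)" "integrable stdN (indicator {..<0} :: real \<Rightarrow> real)"
    using integrable_stdN_bounded_power[of "indicator {0<..}" 1 0] integrable_stdN_bounded_power[of "indicator {..<0}" 1 0]
    by simp_all
  have "1 = mom UNIV 0" by (simp add: mom_UNIV_0)
  also have "\<dots> = (\<integral>u. indicator {0<..} u + indicator {..<0} u \<partial>stdN)"
    unfolding mom_def
  proof (rule integral_cong_AE)
    show "AE u in stdN. indicator UNIV u * u ^ 0 = (indicator {0<..} u + indicator {..<0} u :: real)"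
      using AE_stdN_neq[of 0] by eventually_elim (auto simp: indicator_def)
  qed auto
  also have "\<dots> = mom {0<..} 0 + mom {..<0} 0"
    using i by (simp add: mom_def)
  finally show "mom {0<..} 0 = 1 / 2" "mom {..<0} 0 = 1 / 2" using eq by simp_all
qed

lemma sqrt_pi_density_0: "sqrt pi * \<phi> 0 = 1 / sqrt 2"
  by (simp add: std_normal_density_0 real_sqrt_mult)

lemma mom_half_in_Tspan:
  assumes "S = {0<..} \<or> S = {..<0}"
  shows "sqrt pi * mom S k \<in> Tspan 1 (k + 1)"
proof -
  have "ray S 1 1 \<or> ray S 1 (- 1)" using assms by (auto simp: ray_def)
  moreover have "1 \<in> K2" "- 1 \<in> K2" by (auto intro!: K2_Rats)
  ultimately obtain \<delta> where ray: "ray S 1 \<delta>" and \<delta>: "\<delta> \<in> K2" by blast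
  show ?thesis
  proof (induction k rule: less_induct)
    case (less k)
    show ?case
    proof (cases k)
      case 0
      have "(1 / 2) * sqrt pi ^ 1 \<in> Tspan 1 (k + 1)"
        by (intro Tspan_base K2_Rats) (auto simp: 0)
      moreover have "mom S 0 = 1 / 2" using assms mom_half_0 by blast
      then have "sqrt pi * mom S k = (1 / 2) * sqrt pi ^ 1" by (simp only: 0) simp
      ultimately show ?thesis by (simp only:)
    next
      case (Suc j)
      have eq: "sqrt pi * mom S k = real j * (sqrt pi * mom S (j - 1)) + (\<delta> * 0 ^ j * (1 / sqrt 2)) * sqrt pi ^ 0"
        unfolding Suc ray_mom_Suc[OF ray] sqrt_pi_density_0[symmetric] by (simp add: algebra_simps)
      have "real j * (sqrt pi * mom S (j - 1)) \<in> Tspan 1 (k + 1)"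
      proof (cases "j = 0")
        case False
        have "sqrt pi * mom S (j - 1) \<in> Tspan 1 (j - 1 + 1)" using Suc False by (intro less) auto
        then have "sqrt pi * mom S (j - 1) \<in> Tspan 1 (j - 1 + 1 + 2)" by (simp only: Tspan_parity)
        also have "j - 1 + 1 + 2 = k + 1" using Suc False by simp
        finally have *: "sqrt pi * mom S (j - 1) \<in> Tspan 1 (k + 1)" .
        have "real j \<in> Tspan 0 0" by (intro Tspan_K2 K2_Rats) auto
        from Tspan_mult[OF this *] show ?thesis by simp
      qed (simp add: Tspan.zero)
      moreover have "(\<delta> * 0 ^ j * (1 / sqrt 2)) * sqrt pi ^ 0 \<in> Tspan 1 (k + 1)"
      proof (cases "j = 0")
        case True
        then show ?thesis using Suc
          by (intro Tspan_base K2_mult \<delta> K2_power K2_inverse_sqrt2 K2_Rats) auto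
      qed (simp add: Tspan.zero power_0_left)
      ultimately show ?thesis unfolding eq by (rule Tspan_add)
    qed
  qed
qed

lemma mom_UNIV_in_Tfull: "sqrt pi * mom UNIV k \<in> Tfull 1 (k + 1)"
proof -
  have ray: "ray UNIV 0 0" by (simp add: ray_def)
  have "mom UNIV k \<in> K2"
  proof (induction k rule: less_induct)
    case (less k)
    show ?case
    proof (cases k)
      case 0
      then show ?thesis by (simp add: mom_UNIV_0 K2_Rats)
    next
      case (Suc j)
      show ?thesis
        unfolding Suc ray_mom_Suc[OF ray] using less[of "j - 1"] Suc
        by (cases "j = 0") (auto intro!: K2_mult intro: K2_Rats)
    qed
  qed
  then show ?thesis by (simp add: Tfull_def)
qed

section \<open>Integrals of the Vandermonde weight\<close>

lemma opairs_lessThan: "opairs {..<n} = pairs n"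
  by (auto simp: opairs_def pairs_def)

lemma wmon_zero: "wmon S {..<n} (\<lambda>_. 0) x = of_bool (\<forall>i<n. x i \<in> S)"
  unfolding wmon_def by (auto simp: indicator_def)

lemma aVdm_eq: "aVdm n x = (\<Prod>p\<in>pairs n. x (snd p) - x (fst p)) * sgnprod {..<n} x"
  unfolding aVdm_def sgnprod_def opairs_lessThan prod.distrib[symmetric] by (simp add: abs_sgn)

definition Vint :: "nat \<Rightarrow> real set \<Rightarrow> real" where
  "Vint n S = (\<integral>x. of_bool (\<forall>i<n. x i \<in> S) * aVdm n x \<partial>gaussN {..<n})"

lemma (in graded_field) Vint_in_T:
  assumes ray: "ray S \<beta> \<delta>"
    and mom: "\<And>k. sqrt pi * mom S k \<in> T 1 (k + 1)"
  shows "sqrt pi ^ n * Vint n S \<in> T ((n + 1) div 2) (n mod 2 + card (pairs n))"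
proof -
  have "sqrt pi ^ card {..<n} * (\<integral>x. wmon S {..<n} (\<lambda>_. 0) x * (\<Prod>p\<in>pairs n. x (snd p) - x (fst p)) * sgnprod {..<n} x \<partial>gaussN {..<n})
      \<in> T ((card {..<n} + 1) div 2) (sum (\<lambda>_. 0) {..<n} + card {..<n} mod 2 + card (pairs n))"
    by (rule Jint_pairs_in_T[OF ray_borel[OF ray] mom skew_in_T[OF ray mom]]) (simp_all, auto simp: pairs_def)
  then show ?thesis by (simp add: wmon_zero Vint_def aVdm_eq mult.assoc)
qed

lemma card_pairs: "2 * card (pairs n) + n = n * n"
proof (induction n)
  case (Suc n)
  have "pairs (Suc n) = pairs n \<union> (\<lambda>i. (i, n)) ` {..<n}" by (auto simp: pairs_def less_Suc_eq)
  moreover have "pairs n \<inter> (\<lambda>i. (i, n)) ` {..<n} = {}" by (auto simp: pairs_def)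
  ultimately have "card (pairs (Suc n)) = card (pairs n) + n"
    by (simp add: card_Un_disjoint card_image inj_on_def)
  with Suc show ?case by simp
qed (simp add: pairs_def)

text \<open>The parity that the grading prescribes is that of the top exponent
  \<open>(n + 1) div 2\<close>. So all exponents of \<open>sqrt pi\<close> differ from the top one
  by even numbers.\<close>

lemma card_pairs_parity: "even ((n + 1) div 2 + (n mod 2 + card (pairs n)))"
proof -
  obtain m where "n = 2 * m \<or> n = 2 * m + 1" by (metis oddE evenE)
  then show ?thesis
  proof
    assume n: "n = 2 * m"
    have "card (pairs n) + m = 2 * (m * m)" using card_pairs[of n] by (simp add: n)
    moreover have "(n + 1) div 2 = m" "n mod 2 = 0" by (auto simp: n)
    ultimately show ?thesis by (simp add: add.commute)
  next
    assume n: "n = 2 * m + 1"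
    have "2 * card (pairs n) + (2 * m + 1) = (2 * m + 1) * (2 * m + 1)" using card_pairs[of n] by (simp add: n)
    then have "card (pairs n) = 2 * (m * m) + m" by (simp add: algebra_simps)
    moreover have "(n + 1) div 2 = m + 1" "n mod 2 = 1" by (auto simp: n)
    ultimately show ?thesis by simp
  qed
qed

text \<open>Lowering the exponent of \<open>sqrt pi\<close> from \<open>m\<close> by
  \<open>2 * i\<close> amounts to a factor \<open>inverse pi ^ i\<close>.\<close>

lemma Tspan_poly:
  assumes "x \<in> Tspan m s" "even (m + s)"
  shows "\<exists>P. (\<forall>i. poly.coeff P i \<in> K2) \<and> degree P \<le> m div 2 \<and> x = sqrt pi ^ m * poly P (inverse pi)"
  using assms(1)
proof (induction rule: Tspan.induct)
  case zero
  show ?case by (rule exI[of _ 0]) (auto intro: K2_Rats)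
next
  case (add_base c r x)
  then obtain P where P: "\<And>i. poly.coeff P i \<in> K2" "degree P \<le> m div 2" "x = sqrt pi ^ m * poly P (inverse pi)"
    by blast
  have "even (m - r)" using add_base assms(2) by auto
  then obtain i where i: "m = r + 2 * i" using add_base(2) by (metis dvd_def le_add_diff_inverse)
  have "sqrt pi ^ m * inverse pi ^ i = sqrt pi ^ r * ((sqrt pi)\<^sup>2 * inverse pi) ^ i"
    unfolding i by (simp only: power_add power_mult power_mult_distrib mult.assoc)
  then have pow: "sqrt pi ^ m * inverse pi ^ i = sqrt pi ^ r" by simp
  show ?case
  proof (intro exI[of _ "Polynomial.monom c i + P"] conjI allI)
    show "poly.coeff (Polynomial.monom c i + P) k \<in> K2" for k
      using add_base(1) P(1) by (auto intro: K2_add)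
    show "degree (Polynomial.monom c i + P) \<le> m div 2"
      using P(2) i by (intro degree_add_le order_trans[OF degree_monom_le]) auto
    show "c * sqrt pi ^ r + x = sqrt pi ^ m * poly (Polynomial.monom c i + P) (inverse pi)"
      unfolding pow[symmetric] P(3) by (simp add: poly_monom algebra_simps)
  qed
qed

lemma Vint_half:
  assumes "S = {0<..} \<or> S = {..<0}"
  shows "\<exists>P. (\<forall>i. poly.coeff P i \<in> K2) \<and> degree P \<le> (n + 1) div 4 \<and>
     sqrt pi ^ n * Vint n S = sqrt pi ^ ((n + 1) div 2) * poly P (inverse pi)"
proof -
  obtain \<delta> where ray: "ray S 1 \<delta>" using assms by (auto simp: ray_def)
  have "sqrt pi ^ n * Vint n S \<in> Tspan ((n + 1) div 2) (n mod 2 + card (pairs n))"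
    by (rule half.Vint_in_T[OF ray mom_half_in_Tspan[OF assms]])
  from Tspan_poly[OF this card_pairs_parity] show ?thesis by (simp add: div_mult2_eq[symmetric])
qed

lemma Vint_full: "\<exists>q\<in>K2. sqrt pi ^ n * Vint n UNIV = q * sqrt pi ^ ((n + 1) div 2)"
proof -
  have ray: "ray UNIV 0 0" by (simp add: ray_def)
  have "sqrt pi ^ n * Vint n UNIV \<in> Tfull ((n + 1) div 2) (n mod 2 + card (pairs n))"
    by (rule full.Vint_in_T[OF ray mom_UNIV_in_Tfull])
  then show ?thesis
    by (intro bexI[of _ "sqrt pi ^ n * Vint n UNIV / sqrt pi ^ ((n + 1) div 2)"]) (auto simp: Tfull_def)
qed

section \<open>The probability of isotropy\<close>

lemma measure_of_bool: "{x \<in> space M. P x} \<in> sets M \<Longrightarrow> (\<integral>x. of_bool (P x) \<partial>M) = measure M {x \<in> space M. P x}"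
proof -
  assume "{x \<in> space M. P x} \<in> sets M"
  have "(\<integral>x. of_bool (P x) \<partial>M) = (\<integral>x. indicator {x \<in> space M. P x} x \<partial>M)"
    by (intro Bochner_Integration.integral_cong) (auto simp: indicator_def)
  also have "\<dots> = measure M ({x \<in> space M. P x} \<inter> space M)" by simp
  also have "{x \<in> space M. P x} \<inter> space M = {x \<in> space M. P x}" by auto
  finally show ?thesis .
qed

lemma Vint_UNIV: "Vint n UNIV = (\<integral>x. aVdm n x \<partial>gaussN {..<n})"
  by (simp add: Vint_def)

lemma aVdm_nonneg: "aVdm n x \<ge> 0"
  unfolding aVdm_def by (intro prod_nonneg) auto

lemma aVdm_integrable: "integrable (gaussN {..<n}) (aVdm n)"
  by (intro exp_bdd_integrable exp_bdd_aVdm borel_aVdm) auto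

lemma Vint_UNIV_pos: "Vint n UNIV > 0"
proof (rule ccontr)
  assume "\<not> Vint n UNIV > 0"
  moreover have "Vint n UNIV \<ge> 0"
    unfolding Vint_UNIV by (intro Bochner_Integration.integral_nonneg aVdm_nonneg)
  ultimately have "(\<integral>x. aVdm n x \<partial>gaussN {..<n}) = 0" by (simp add: Vint_UNIV)
  then have "AE x in gaussN {..<n}. aVdm n x = 0"
    using integral_nonneg_eq_0_iff_AE[OF aVdm_integrable[of n]] aVdm_nonneg by simp
  moreover have "AE x in gaussN {..<n}. inj_on x {..<n}" by (rule AE_gaussN_inj) auto
  ultimately have "AE x in gaussN {..<n}. False"
  proof eventually_elim
    fix x :: "nat \<Rightarrow> real"
    assume "aVdm n x = 0" and inj: "inj_on x {..<n}"
    then obtain p where "p \<in> pairs n" "x (snd p) = x (fst p)" unfolding aVdm_def by auto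
    with inj show False unfolding pairs_def inj_on_def by force
  qed
  then show False
    using prob_space.AE_False[OF prob_space_gaussN] by blast
qed

interpretation eig: spectral_model "gaussN {..<n}" "\<lambda>x. aVdm n x / Vint n UNIV" "psum n" n
proof
  fix x :: "nat \<Rightarrow> real" and ls :: "nat list" and k :: nat and t :: real
  show "0 \<le> aVdm n x / Vint n UNIV" using aVdm_nonneg[of n x] Vint_UNIV_pos[of n] by simp
  show "(\<lambda>x. aVdm n x / Vint n UNIV) \<in> borel_measurable (gaussN {..<n})"
    unfolding borel_measurable_gaussN by measurable
  show "(\<lambda>x. psum n x k) \<in> borel_measurable (gaussN {..<n})"
    unfolding borel_measurable_gaussN by measurable
  show "integrable (gaussN {..<n}) (\<lambda>x. PL (psum n x) ls * (aVdm n x / Vint n UNIV))"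
    by (intro exp_bdd_integrable exp_bdd_intros exp_bdd_PL exp_bdd_psum exp_bdd_aVdm) (auto, measurable)
  show "(\<integral>x. aVdm n x / Vint n UNIV \<partial>gaussN {..<n}) = 1"
    using Vint_UNIV_pos[of n] by (simp add: Vint_UNIV)
  show "\<exists>\<theta>. psum n x = psum n \<theta>" by blast
  assume "0 \<le> t"
  from eigenvalue_loop[OF this, of n k ls]
  show "(1 + 2 * t) * (\<integral>x. exp (- t * psum n x 2) * PL (psum n x) (Suc k # ls) * (aVdm n x / Vint n UNIV) \<partial>gaussN {..<n}) =
     (\<integral>x. exp (- t * psum n x 2) * loop_rhs (psum n x) k ls * (aVdm n x / Vint n UNIV) \<partial>gaussN {..<n})"
    by (simp only: times_divide_eq_right integral_divide_zero)
qed

interpretation goe: spectral_model "gaussN (sq n)" "\<lambda>_. 1" "trp n" n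
proof
  fix b :: "nat \<times> nat \<Rightarrow> real" and ls :: "nat list" and k :: nat and t :: real
  show "(\<lambda>x. trp n x k) \<in> borel_measurable (gaussN (sq n))"
    unfolding borel_measurable_gaussN by measurable
  show "integrable (gaussN (sq n)) (\<lambda>x. PL (trp n x) ls * 1)"
    by (intro exp_bdd_integrable exp_bdd_intros exp_bdd_PL exp_bdd_trp) (auto, measurable)
  show "(\<integral>x. 1 \<partial>gaussN (sq n)) = (1 :: real)"
    using prob_space.prob_space[OF prob_space_gaussN] by simp
  show "\<exists>\<theta>. trp n b = psum n \<theta>" by (rule trp_roots[of n b]) blast
  assume "0 \<le> t"
  from matrix_loop[OF this, of n k ls]
  show "(1 + 2 * t) * (\<integral>x. exp (- t * trp n x 2) * PL (trp n x) (Suc k # ls) * 1 \<partial>gaussN (sq n)) =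
     (\<integral>x. exp (- t * trp n x 2) * loop_rhs (trp n x) k ls * 1 \<partial>gaussN (sq n))"
    by simp
qed auto

interpretation goe_eig: two_spectral_models "gaussN (sq n)" "\<lambda>_. 1" "trp n" "gaussN {..<n}"
    "\<lambda>x. aVdm n x / Vint n UNIV" "psum n" n
  ..

lemma goe_spec_sign:
  "(\<integral>b. of_bool (spec_sign n s (trp n b)) \<partial>gaussN (sq n)) = Vint n {x. s * x > 0} / Vint n UNIV"
  using goe_eig.spec_sign_integral_eq[of n s] by (simp add: spec_sign_psum Vint_def)

lemma borel_spec_sign_trp: "(\<lambda>b. of_bool (spec_sign n s (trp n b)) :: real) \<in> borel_measurable (borelN (sq n))"
proof (rule borel_spec_sign)
  show "\<exists>\<theta>. trp n b = psum n \<theta>" for b by (rule trp_roots[of n b]) blast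
qed measurable

text \<open>The complement is where one of two measurable indicators is nonzero, by
  \<open>iso_iff_spec_sign\<close>; the quantifier over vectors in \<open>iso\<close> is thereby
  avoided.\<close>

lemma sets_iso:
  assumes "n \<ge> 1" shows "{b \<in> space (borelN (sq n)). iso n b} \<in> sets (borelN (sq n))"
proof -
  let ?f = "\<lambda>b. of_bool (spec_sign n 1 (trp n b)) + of_bool (spec_sign n (- 1) (trp n b)) :: real"
  have "?f \<in> borel_measurable (borelN (sq n))" by (intro borel_measurable_add borel_spec_sign_trp)
  then have "{b \<in> space (borelN (sq n)). ?f b = 0} \<in> sets (borelN (sq n))" by measurable
  also have "{b \<in> space (borelN (sq n)). ?f b = 0} = {b \<in> space (borelN (sq n)). iso n b}"
    using iso_iff_spec_sign[OF assms] by auto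
  finally show ?thesis .
qed

section \<open>Transfer to the matrices of the GOE\<close>

lemma quad_form_eq:
  assumes "A \<in> carrier_mat n n" "x \<in> carrier_vec n"
  shows "quad_form A x = qf n (\<lambda>ij. A $$ ij) (\<lambda>i. x $ i)"
proof -
  have "quad_form A x = (\<Sum>i<n. \<Sum>j<n. x $ i * (A $$ (i, j) * x $ j))"
    using assms by (simp add: quad_form_def scalar_prod_def atLeast0LessThan sum_distrib_left)
  \<comment> \<open>Transposing leaves the double sum unchanged, so any matrix has the quadratic
    form of its symmetric part, which is what \<open>qf\<close> uses.\<close>
  moreover have "(\<Sum>i<n. \<Sum>j<n. x $ i * (A $$ (j, i) * x $ j)) = (\<Sum>i<n. \<Sum>j<n. x $ i * (A $$ (i, j) * x $ j))"
    by (subst sum.swap) (simp add: mult_ac)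
  moreover have "qf n (\<lambda>ij. A $$ ij) (\<lambda>i. x $ i) =
      (\<Sum>i<n. \<Sum>j<n. x $ i * (A $$ (i, j) * x $ j)) / 2 + (\<Sum>i<n. \<Sum>j<n. x $ i * (A $$ (j, i) * x $ j)) / 2"
  proof -
    have "x $ i * (symm (\<lambda>ij. A $$ ij) i j * x $ j) =
        x $ i * (A $$ (i, j) * x $ j) / 2 + x $ i * (A $$ (j, i) * x $ j) / 2" for i j
      by (simp add: symm_def distrib_left distrib_right add_divide_distrib)
    then show ?thesis
      by (simp only: qf_def mv_def sum_distrib_left sum.distrib sum_divide_distrib)
  qed
  ultimately show ?thesis by simp
qed

lemma isotropic_iff_iso:
  assumes A: "A \<in> carrier_mat n n"
  shows "isotropic A \<longleftrightarrow> iso n (\<lambda>ij. A $$ ij)"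
proof
  assume "isotropic A"
  then obtain x where x: "x \<in> carrier_vec n" "x \<noteq> 0\<^sub>v n" "quad_form A x = 0"
    using A unfolding isotropic_def by auto
  then have "\<exists>i<n. x $ i \<noteq> 0" by (metis carrier_vecD eq_vecI index_zero_vec)
  then show "iso n (\<lambda>ij. A $$ ij)" using x(3) quad_form_eq[OF A x(1)] unfolding iso_def by auto
next
  assume "iso n (\<lambda>ij. A $$ ij)"
  then obtain x i where x: "i < n" "x i \<noteq> 0" "qf n (\<lambda>ij. A $$ ij) x = 0" unfolding iso_def by blast
  define v where "v = Matrix.vec n x"
  have v: "v \<in> carrier_vec n" by (simp add: v_def)
  have "v \<noteq> 0\<^sub>v n" using x(1,2) by (metis index_vec index_zero_vec(1) v_def)
  moreover have "quad_form A v = 0"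
    unfolding quad_form_eq[OF A v] x(3)[symmetric] by (rule qf_cong) (simp add: v_def)
  ultimately show "isotropic A" using A v unfolding isotropic_def by auto
qed

text \<open>Serves two purposes: with \<open>c = sqrt 2\<close> it passes from the GOE normalisation
  to \<open>symm\<close>, and with \<open>c = 1\<close> it ignores values of \<open>b\<close>
  outside the index square.\<close>

lemma iso_scale:
  assumes c: "c \<noteq> 0" and eq: "\<And>i j. i < n \<Longrightarrow> j < n \<Longrightarrow> symm b i j = c * symm b' i j"
  shows "iso n b \<longleftrightarrow> iso n b'"
proof -
  have "qf n b x = c * qf n b' x" for x
    using eq by (simp add: qf_def mv_def sum_distrib_left mult_ac)
  then show ?thesis using c by (simp add: iso_def)
qed

lemma sets_isotropic:
  assumes "n \<ge> 1" shows "{M \<in> space (mat_borel n). isotropic M} \<in> sets (mat_borel n)"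
proof -
  let ?e = "\<lambda>A. \<lambda>ij\<in>{..<n} \<times> {..<n}. A $$ ij"
  let ?E = "{b \<in> space (borelN (sq n)). iso n b}"
  have "?e -` ?E \<inter> carrier_mat n n \<in> sets (mat_borel n)"
    unfolding mat_borel_def by (intro in_vimage_algebra sets_iso assms)
  also have "?e -` ?E \<inter> carrier_mat n n = {M \<in> space (mat_borel n). isotropic M}"
  proof -
    have "iso n (?e A) \<longleftrightarrow> isotropic A" if "A \<in> carrier_mat n n" for A :: "real mat"
      unfolding isotropic_iff_iso[OF that] by (rule iso_scale[of 1]) (auto simp: symm_def)
    then show ?thesis by (auto simp: space_PiM)
  qed
  finally show ?thesis .
qed

lemma rho_inf_eq_measure:
  assumes n: "n \<ge> 1"
  shows "rho_inf n = measure (gaussN (sq n)) {b \<in> space (gaussN (sq n)). iso n b}"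
proof -
  let ?g = "\<lambda>b. let B = Matrix.mat n n b in (1 / sqrt 2) \<cdot>\<^sub>m (B + transpose_mat B)"
  have "rho_inf n = measure (GOE n) {M \<in> space (mat_borel n). isotropic M}"
    by (simp add: rho_inf_def GOE_def)
  also have "\<dots> = measure (gaussian_entries n) (?g -` {M \<in> space (mat_borel n). isotropic M} \<inter> space (gaussian_entries n))"
    unfolding GOE_def by (rule measure_distr[OF measurable_GOE_map sets_isotropic[OF n]])
  also have "?g -` {M \<in> space (mat_borel n). isotropic M} \<inter> space (gaussian_entries n) =
      {b \<in> space (gaussN (sq n)). iso n b}"
  proof -
    have c: "?g b \<in> carrier_mat n n" for b by (simp add: Let_def)
    have "isotropic (?g b) \<longleftrightarrow> iso n b" for b
      unfolding isotropic_iff_iso[OF c]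
      by (rule iso_scale[of "sqrt 2"]) (auto simp: symm_def Let_def field_simps)
    then show ?thesis using c by (auto simp: gaussian_entries_def)
  qed
  finally show ?thesis by (simp add: gaussian_entries_def)
qed

theorem rho_inf_Vint:
  assumes n: "n \<ge> 1"
  shows "rho_inf n = 1 - (Vint n {0<..} + Vint n {..<0}) / Vint n UNIV"
proof -
  interpret prob_space "gaussN (sq n)" by (rule prob_space_gaussN)
  let ?p = "\<lambda>s b. of_bool (spec_sign n s (trp n b)) :: real"
  have int: "integrable (gaussN (sq n)) (?p s)" for s
    by (rule exp_bdd_integrable[OF _ exp_bdd_bounded[of _ 1] borel_spec_sign_trp]) auto
  have "rho_inf n = (\<integral>b. of_bool (iso n b) \<partial>gaussN (sq n))"
    unfolding rho_inf_eq_measure[OF n]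
  proof (rule measure_of_bool[symmetric])
    have "space (gaussN (sq n)) = space (borelN (sq n))" by (rule sets_eq_imp_space_eq[OF sets_gaussN])
    then show "{b \<in> space (gaussN (sq n)). iso n b} \<in> sets (gaussN (sq n))"
      using sets_iso[OF n] by (simp add: sets_gaussN)
  qed
  also have "\<dots> = (\<integral>b. 1 - (?p 1 b + ?p (- 1) b) \<partial>gaussN (sq n))"
  proof (rule Bochner_Integration.integral_cong[OF refl])
    fix b
    obtain \<theta> where \<theta>: "trp n b = psum n \<theta>" by (rule trp_roots[of n b]) blast
    \<comment> \<open>Index 0 shows that the two signs exclude each other; for \<open>n = 0\<close>
      both would hold vacuously.\<close>
    have "\<not> (spec_sign n 1 (trp n b) \<and> spec_sign n (- 1) (trp n b))"
      unfolding \<theta> spec_sign_psum using n by (auto intro!: exI[of _ 0] dest!: spec[of _ 0])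
    then show "of_bool (iso n b) = 1 - (?p 1 b + ?p (- 1) b)"
      using iso_iff_spec_sign[OF n, of b] by auto
  qed
  also have "\<dots> = 1 - ((\<integral>b. ?p 1 b \<partial>gaussN (sq n)) + (\<integral>b. ?p (- 1) b \<partial>gaussN (sq n)))"
    using int by (simp add: prob_space)
  also have "\<dots> = 1 - (Vint n {x. 1 * x > 0} + Vint n {x. - 1 * x > 0}) / Vint n UNIV"
    unfolding goe_spec_sign by (simp add: add_divide_distrib)
  also have "{x. 1 * x > 0} = {0 :: real<..}" by auto
  also have "{x. - 1 * x > 0} = {..<0 :: real}" by auto
  finally show ?thesis .
qed

theorem mainTheorem6:
  fixes n :: nat
  assumes "n \<ge> 1"
  shows "\<exists>P :: real poly. (\<forall>i. poly.coeff P i \<in> Rats_adjoin (sqrt 2)) \<and>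
           degree P \<le> (n + 1) div 4 \<and> rho_inf n = poly P (inverse pi)"
proof -
  define a where "a = sqrt pi ^ n"
  define c where "c = sqrt pi ^ ((n + 1) div 2)"
  have ac: "a > 0" "c > 0" by (simp_all add: a_def c_def)
  obtain P where P: "\<And>i. poly.coeff P i \<in> K2" "degree P \<le> (n + 1) div 4" "a * Vint n {0<..} = c * poly P (inverse pi)"
    using Vint_half[of "{0<..}" n] unfolding a_def c_def by blast
  obtain Q where Q: "\<And>i. poly.coeff Q i \<in> K2" "degree Q \<le> (n + 1) div 4" "a * Vint n {..<0} = c * poly Q (inverse pi)"
    using Vint_half[of "{..<0}" n] unfolding a_def c_def by blast
  obtain q where q: "q \<in> K2" "a * Vint n UNIV = q * c"
    using Vint_full[of n] unfolding a_def c_def by blast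
  have "q \<noteq> 0" using q ac Vint_UNIV_pos[of n] by auto
  \<comment> \<open>The power \<open>c\<close> of \<open>sqrt pi\<close> is common to the numerators
    and the denominator and cancels; what remains of the denominator is the constant
    \<open>q\<close>.\<close>
  define R where "R = 1 + Polynomial.smult (- inverse q) (P + Q)"
  have one: "poly.coeff (1 :: real poly) i \<in> K2" for i
    by (cases "i = 0") (auto intro!: K2_Rats)
  have "poly.coeff R i \<in> K2" for i
    unfolding R_def coeff_add coeff_smult using P(1) Q(1) q(1) one
    by (intro K2_add K2_mult K2_uminus K2_inverse)
  moreover have "degree R \<le> (n + 1) div 4"
    unfolding R_def using P(2) Q(2) by (intro degree_add_le order_trans[OF degree_smult_le]) auto
  moreover have "rho_inf n = poly R (inverse pi)"
  proof -
    have "(Vint n {0<..} + Vint n {..<0}) / Vint n UNIV = (a * Vint n {0<..} + a * Vint n {..<0}) / (a * Vint n UNIV)"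
      using ac by (simp add: distrib_left[symmetric])
    also have "\<dots> = inverse q * (poly P (inverse pi) + poly Q (inverse pi))"
      unfolding P(3) Q(3) q(2) using ac \<open>q \<noteq> 0\<close> by (simp add: field_simps)
    finally show ?thesis unfolding rho_inf_Vint[OF assms] R_def by simp
  qed
  ultimately show ?thesis by blast
qed

end
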